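(* Let $\lambda$ be a partition and let $n\ge|\lambda|$. Let $\mu^{(1)},\dots,\mu^{(r)}$ be the partitions $\mu$ of $|\lambda|$ with $\mu<\lambda$ strictly in dominance order, listed in any fixed order. Let $D$ be the determinant of the $(r+1)\times(r+1)$ matrix whose first row is $$\big(m_\lambda[X],\,m_{\mu^{(1)}}[X],\dots,m_{\mu^{(r)}}[X]\big)$$ and whose row $s+1$ ($1\le s\le r$) is $$\big(\langle m_\lambda[X]\rangle_{\lambda',\mu^{(s)\prime}},\,\langle m_{\mu^{(1)}}[X]\rangle_{\lambda',\mu^{(s)\prime}},\dots,\langle m_{\mu^{(r)}}[X]\rangle_{\lambda',\mu^{(s)\prime}}\big).$$ Then $$J_\lambda(X;q,t)=\frac{c_\lambda(q,t)}{u_\lambda(t,q)}\,D.$$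
   Context: $X=x_1+\cdots+x_n$ and $m_\mu[X]$ is the monomial symmetric polynomial in $x_1,\dots,x_n$. $J_\lambda(X;q,t)$ is Macdonald's integral form of the Macdonald polynomial. Dominance order: for $|\lambda|=|\mu|$, $\lambda\le\mu$ iff $\lambda_1+\cdots+\lambda_i\le\mu_1+\cdots+\mu_i$ for all $i$; $\mu'$ denotes the conjugate partition. For $\beta\in\mathbb{N}^n$, $[|\beta|]_{t,q}=t^{\beta_1}q^{n-1}+t^{\beta_2}q^{n-2}+\cdots+t^{\beta_n}$. Divided differences on polynomials in $x_1,\dots,x_{2n}$: $\partial_i f=(f-\sigma_if)/(x_i-x_{i+1})$, $\sigma_i$ exchanging $x_i,x_{i+1}$; $\partial_{\omega}=(\partial_{2n-1})(\partial_{2n-2}\partial_{2n-1})\cdots(\partial_1\partial_2\cdots\partial_{2n-1})$. Scalar product $\langle f,g\rangle=\partial_\omega(fg)$. For $I\in\mathbb{Z}^{2n}$, $\bar x^I=(-x_1)^{I_1}\cdots(-x_{2n})^{I_{2n}}$; $\rho=(0,1,\dots,2n-1)$; for $\alpha\in\mathbb{N}^n$, $\alpha'=(0,\dots,0,\alpha_1,\dots,\alpha_n)\in\mathbb{N}^{2n}$ ($n$ zeros). For a symmetric polynomial $f$ in $x_1,\dots,x_n$ (viewed as a polynomial in $x_1,\dots,x_{2n}$) and partitions $\kappa,\nu$ with at most $n$ parts, $\langle f\rangle_{\kappa\nu}=\sum_\alpha\langle\bar x^{\rho-\alpha'},f\rangle\big([|\kappa|]_{t,q}-[|\alpha|]_{t,q}\big)$,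 summed over the distinct permutations $\alpha\in\mathbb{N}^n$ of $\nu$. $u_\lambda(t,q)=\prod_{\mu<\lambda}\big([|\lambda'|]_{t,q}-[|\mu'|]_{t,q}\big)$ over partitions $\mu$ of $|\lambda|$ strictly dominated by $\lambda$. $c_\lambda(q,t)=\prod_{(i,j)\in\lambda}\big(1-q^{\lambda_i-j}t^{\lambda'_j-i+1}\big)$, product over cells $(i,j)$ of the diagram of $\lambda$. *)

theory Defs
  imports
    "HOL-Library.Poly_Mapping"
    "HOL-Computational_Algebra.Polynomial"
    "HOL-Computational_Algebra.Fraction_Field"
    "HOL-Combinatorics.Transposition"
    "HOL-Combinatorics.Permutations"
    "Jordan_Normal_Form.Determinant"
begin

text \<open>The field \<open>\<rat>(q,t)\<close>, as fractions of polynomials in \<open>t\<close> over polynomials in \<open>q\<close>.\<close>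

type_synonym qtfield = "rat poly poly fract"

definition q_par :: qtfield where
  "q_par = Fract [:[:0, 1:]:] 1"

definition t_par :: qtfield where
  "t_par = Fract [:0, 1:] 1"

text \<open>
  Laurent polynomials over \<open>\<rat>(q,t)\<close> in variables \<open>x\<^sub>1, x\<^sub>2, \<dots>\<close>: an exponent vector is a finitely
  supported map from (1-based) variable indices to integers.  Negative exponents are only there
  to make sense of \<open>(-x\<^sub>1)\<^bsup>I\<^sub>1\<^esup> \<cdots>\<close> for \<open>I \<in> \<int>\<^sup>2\<^sup>n\<close>; ordinary polynomials, in any number of variables,
  are viewed as elements of this same ring.
\<close>

type_synonym laurent = "(nat \<Rightarrow>\<^sub>0 int) \<Rightarrow>\<^sub>0 qtfield"

definition const :: "qtfield \<Rightarrow> laurent" where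
  "const a = Poly_Mapping.single 0 a"

definition var :: "nat \<Rightarrow> laurent" where
  "var i = Poly_Mapping.single (Poly_Mapping.single i 1) 1"

text \<open>\<open>xbar N I\<close> is \<open>(-x\<^sub>1)\<^bsup>I\<^sub>1\<^esup> \<cdots> (-x\<^sub>N)\<^bsup>I\<^sub>N\<^esup>\<close>.\<close>

definition xbar :: "nat \<Rightarrow> (nat \<Rightarrow> int) \<Rightarrow> laurent" where
  "xbar N I = (\<Prod>i=1..N. Poly_Mapping.single (Poly_Mapping.single i (I i)) ((-1) powi I i))"

text \<open>Partitions are weakly decreasing lists of positive integers.\<close>

definition partitions_of :: "nat \<Rightarrow> nat list set" where
  "partitions_of d = {lam. sorted_wrt (\<ge>) lam \<and> 0 \<notin> set lam \<and> sum_list lam = d}"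

text \<open>The parts with 1-based index, continued by zeros (and with value 0 at index 0).\<close>

definition part :: "nat list \<Rightarrow> nat \<Rightarrow> nat" where
  "part lam i = (if 1 \<le> i \<and> i \<le> length lam then lam ! (i - 1) else 0)"

definition conj_part :: "nat list \<Rightarrow> nat list" where
  "conj_part lam = map (\<lambda>j. card {i \<in> {1..length lam}. j \<le> part lam i}) [1..<Suc (part lam 1)]"

definition dominance_le :: "nat list \<Rightarrow> nat list \<Rightarrow> bool" where
  "dominance_le lam mu \<longleftrightarrow> sum_list lam = sum_list mu \<and>
     (\<forall>i. (\<Sum>k=1..i. part lam k) \<le> (\<Sum>k=1..i. part mu k))"

definition strictly_below :: "nat list \<Rightarrow> nat list set" where
  "strictly_below lam = {mu \<in> partitions_of (sum_list lam). dominance_le mu lam \<and> mu \<noteq> lam}"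

text \<open>
  The distinct permutations \<open>\<alpha> \<in> \<nat>\<^sup>n\<close> of a partition with at most \<open>n\<close> parts (padded by zeros).
  Compositions are functions on 1-based indices vanishing outside \<open>{1..n}\<close>; there are none if the
  partition has more than \<open>n\<close> parts.
\<close>

definition rearrangements :: "nat \<Rightarrow> nat list \<Rightarrow> (nat \<Rightarrow> nat) set" where
  "rearrangements n nu =
     (if length nu \<le> n then {part nu \<circ> \<pi> | \<pi>. \<pi> permutes {1..n}} else {})"

definition monomial_sym :: "nat \<Rightarrow> nat list \<Rightarrow> laurent" where
  "monomial_sym n mu = (\<Sum>\<alpha>\<in>rearrangements n mu. \<Prod>i=1..n. var i ^ \<alpha> i)"

definition power_sum :: "nat \<Rightarrow> nat list \<Rightarrow> laurent" where
  "power_sum n rho = (\<Prod>k\<leftarrow>rho. \<Sum>i=1..n. var i ^ k)"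

text \<open>
  For \<open>d \<le> n\<close> the power sum products \<open>p\<^sub>\<rho>\<close> with \<open>|\<rho>| = d\<close> form a basis of the homogeneous symmetric
  polynomials of degree \<open>d\<close> in \<open>n\<close> variables, and restriction to \<open>n\<close> variables is an isomorphism
  from the symmetric functions of degree \<open>d\<close> onto these polynomials.  The next definitions are
  meaningful, and only used, for \<open>d \<le> n\<close>.
\<close>

definition power_sum_coords :: "nat \<Rightarrow> nat \<Rightarrow> laurent \<Rightarrow> nat list \<Rightarrow> qtfield" where
  "power_sum_coords n d f = (THE c. (\<forall>rho. rho \<notin> partitions_of d \<longrightarrow> c rho = 0) \<and>
     f = (\<Sum>rho\<in>partitions_of d. const (c rho) * power_sum n rho))"

definition z_qt :: "nat list \<Rightarrow> qtfield" where
  "z_qt rho = (\<Prod>k\<in>set rho. of_nat (k ^ count_list rho k * fact (count_list rho k))) *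
     (\<Prod>k\<leftarrow>rho. (1 - q_par ^ k) / (1 - t_par ^ k))"

text \<open>
  Macdonald's scalar product on degree \<open>d\<close>: the bilinear form with
  \<open>\<langle>p\<^sub>\<rho>, p\<^sub>\<sigma>\<rangle> = \<delta>\<^sub>\<rho>\<^sub>\<sigma> z\<^sub>\<rho> \<Prod>\<^sub>i (1 - q\<^bsup>\<rho>\<^sub>i\<^esup>) / (1 - t\<^bsup>\<rho>\<^sub>i\<^esup>)\<close>.
\<close>

definition qt_scalar :: "nat \<Rightarrow> nat \<Rightarrow> laurent \<Rightarrow> laurent \<Rightarrow> qtfield" where
  "qt_scalar n d f g =
     (\<Sum>rho\<in>partitions_of d. z_qt rho * power_sum_coords n d f rho * power_sum_coords n d g rho)"

text \<open>
  The polynomials \<open>P\<^sub>\<lambda>\<close>, \<open>|\<lambda>| = d\<close>, are the unique family that is unitriangular with respect to the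
  monomial basis and dominance order, and orthogonal for Macdonald's scalar product.
\<close>

definition is_macdonald_family :: "nat \<Rightarrow> nat \<Rightarrow> (nat list \<Rightarrow> laurent) \<Rightarrow> bool" where
  "is_macdonald_family n d P \<longleftrightarrow>
     (\<forall>lam\<in>partitions_of d. \<exists>v :: nat list \<Rightarrow> qtfield.
        P lam = monomial_sym n lam + (\<Sum>mu\<in>strictly_below lam. const (v mu) * monomial_sym n mu)) \<and>
     (\<forall>lam\<in>partitions_of d. \<forall>mu\<in>partitions_of d.
        lam \<noteq> mu \<longrightarrow> qt_scalar n d (P lam) (P mu) = 0)"

definition macdonald_P :: "nat \<Rightarrow> nat list \<Rightarrow> laurent" where
  "macdonald_P n lam = (THE f. \<exists>P. is_macdonald_family n (sum_list lam) P \<and> f = P lam)"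

definition c_coeff :: "nat list \<Rightarrow> qtfield" where
  "c_coeff lam = (\<Prod>i=1..length lam. \<Prod>j=1..part lam i.
     1 - q_par ^ (part lam i - j) * t_par ^ (part (conj_part lam) j - i + 1))"

definition macdonald_J :: "nat \<Rightarrow> nat list \<Rightarrow> laurent" where
  "macdonald_J n lam = const (c_coeff lam) * macdonald_P n lam"

text \<open>The automorphism of the Laurent polynomial ring exchanging \<open>x\<^sub>i\<close> and \<open>x\<^sub>i\<^sub>+\<^sub>1\<close>.\<close>

definition swap_vars :: "nat \<Rightarrow> laurent \<Rightarrow> laurent" where
  "swap_vars i f =
     Poly_Mapping.map_key (Poly_Mapping.map_key (Transposition.transpose i (i + 1))) f"

text \<open>The exact quotient \<open>(f - \<sigma>\<^sub>i f) / (x\<^sub>i - x\<^sub>i\<^sub>+\<^sub>1)\<close>.\<close>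

definition div_diff :: "nat \<Rightarrow> laurent \<Rightarrow> laurent" where
  "div_diff i f = (THE g. g * (var i - var (i + 1)) = f - swap_vars i f)"

text \<open>
  \<open>(\<partial>\<^sub>2\<^sub>n\<^sub>-\<^sub>1)(\<partial>\<^sub>2\<^sub>n\<^sub>-\<^sub>2 \<partial>\<^sub>2\<^sub>n\<^sub>-\<^sub>1) \<cdots> (\<partial>\<^sub>1 \<cdots> \<partial>\<^sub>2\<^sub>n\<^sub>-\<^sub>1)\<close>, composed as operators (rightmost factor applied
  first).
\<close>

definition div_diff_omega :: "nat \<Rightarrow> laurent \<Rightarrow> laurent" where
  "div_diff_omega n f = foldr div_diff (concat (map (\<lambda>k. [k..<2*n]) (rev [1..<2*n]))) f"

definition dd_scalar :: "nat \<Rightarrow> laurent \<Rightarrow> laurent \<Rightarrow> laurent" where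
  "dd_scalar n f g = div_diff_omega n (f * g)"

text \<open>\<open>[|\<beta>|]\<^bsub>t,q\<^esub>\<close> for \<open>\<beta> \<in> \<nat>\<^sup>n\<close>.\<close>

definition tq_size :: "nat \<Rightarrow> (nat \<Rightarrow> nat) \<Rightarrow> qtfield" where
  "tq_size n \<beta> = (\<Sum>i=1..n. t_par ^ \<beta> i * q_par ^ (n - i))"

text \<open>
  The exponent vector \<open>\<rho> - \<alpha>'\<close> in \<open>\<int>\<^sup>2\<^sup>n\<close>, where \<open>\<rho> = (0, 1, \<dots>, 2n-1)\<close> and \<open>\<alpha>'\<close> is \<open>\<alpha>\<close> preceded by
  \<open>n\<close> zeros.
\<close>

definition rho_minus :: "nat \<Rightarrow> (nat \<Rightarrow> nat) \<Rightarrow> nat \<Rightarrow> int" where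
  "rho_minus n \<alpha> i = (int i - 1) - (if i \<le> n then 0 else int (\<alpha> (i - n)))"

text \<open>\<open>bracket n kappa nu f\<close> is \<open>\<langle>f\<rangle>\<^bsub>\<kappa>\<nu>\<^esub>\<close>.\<close>

definition bracket :: "nat \<Rightarrow> nat list \<Rightarrow> nat list \<Rightarrow> laurent \<Rightarrow> laurent" where
  "bracket n kappa nu f = (\<Sum>\<alpha>\<in>rearrangements n nu.
     dd_scalar n (xbar (2*n) (rho_minus n \<alpha>)) f * const (tq_size n (part kappa) - tq_size n \<alpha>))"

definition u_coeff :: "nat \<Rightarrow> nat list \<Rightarrow> qtfield" where
  "u_coeff n lam = (\<Prod>mu\<in>strictly_below lam.
     tq_size n (part (conj_part lam)) - tq_size n (part (conj_part mu)))"

end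

theory Submission
  imports Defs
begin

text \<open>
  Up to sign, \<open>\<langle>x\<^sup>\<rho>\<^sup>-\<^sup>\<alpha>, f\<rangle>\<close> is the Hall pairing of the Schur function \<open>s\<^sub>\<alpha>\<close> with \<open>\<omega> f\<close>.
  As \<open>m\<^sub>\<nu>\<close> is the sum of the \<open>s\<^sub>\<alpha>\<close> over the permutations \<open>\<alpha>\<close> of \<open>\<nu>\<close>, and Macdonald's operator \<open>D\<close>
  (with \<open>q\<close> and \<open>t\<close> exchanged) weights each \<open>s\<^sub>\<alpha>\<close> by \<open>[|\<alpha>|]\<close>, the bracket of \<open>f\<close> at \<open>(\<kappa>, \<nu>)\<close> is
  \<open>\<langle>([|\<kappa>|] - D) m\<^sub>\<nu>, \<omega> f\<rangle>\<close>.  The determinant lies in the span of the \<open>m\<^sub>\<mu>\<close> with \<open>\<mu> \<le> \<lambda>\<close> and all the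
  brackets of its rows vanish on it, so it is an eigenvector of the adjoint of \<open>D\<close>; the brackets
  are triangular for the dominance order, which gives the coefficient of \<open>m\<^sub>\<lambda>\<close>.  Since \<open>D\<close> is self-adjoint
  for Macdonald's scalar product and has distinct eigenvalues, these eigenvectors are orthogonal and
  hence are the Macdonald polynomials.

  The Hall pairing and the self-adjointness are read off on power sums.  Under the
  maximal divided difference, multiplication by a power sum in the first \<open>n\<close> variables is minus
  multiplication by the one in the last \<open>n\<close> variables; on alternating functionals these become
  raising and lowering operators which, up to degree \<open>n\<close>, satisfy the Heisenberg commutation relations.
\<close>

section \<open>Laurent polynomials\<close>

text \<open>Macdonald polynomials enter through a definite description, so existence must be proved
  too: the determinants supply the family, and uniqueness removes the dependence on the listing. D
  is never constructed; \<open>wform\<close> carries it inside the pairing, and eigenvectors are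
  recognised by testing.

  In the relevant degree the maximal divided difference of a monomial is, up to a fixed sign, the
  sign of the permutation sorting its exponents, or 0. Pairings thus become functionals on exponent
  vectors, read as particles on the positions 0, ..., 2n-1. Without an upper bound raising and
  lowering would commute; the bound \<open>M\<close> in \<open>raise\<close>, which the alternating
  functional imposes by itself, is the only source of the Heisenberg term.

  The q-weights form a finite geometric sequence. Replacing its sum by \<open>resid n\<close>, which
  differs by the constant 1/(1 - q), makes one recursion valid in all degrees. The factors are then
  t^r - 1 on one side and 1 - q^(-s) on the other. The weight (1 - q^r)/(1 - t^r) of
  \<open>z_qt\<close> turns the former into q^r - 1, and the latter is q^s - 1 up to a power of q
  that depends only on the degree: hence the symmetry.\<close>

abbreviation xmon :: "(nat \<Rightarrow>\<^sub>0 int) \<Rightarrow> laurent" where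
  "xmon k \<equiv> Poly_Mapping.single k 1"

abbreviation lookup where "lookup \<equiv> Poly_Mapping.lookup"

abbreviation keys where "keys \<equiv> Poly_Mapping.keys"

abbreviation expo :: "nat \<Rightarrow> int \<Rightarrow> nat \<Rightarrow>\<^sub>0 int" where
  "expo \<equiv> Poly_Mapping.single"

lemma const_0 [simp]: "const 0 = 0" and const_1 [simp]: "const 1 = 1"
  by (simp_all add: const_def)

lemma const_add: "const (a + b) = const a + const b"
  and const_diff: "const (a - b) = const a - const b"
  and const_minus: "const (- a) = - const a"
  by (simp_all add: const_def single_add single_diff single_uminus)

lemma const_mult: "const (a * b) = const a * const b"
  by (simp add: const_def mult_single)

lemma const_sum: "const (sum f A) = (\<Sum>x\<in>A. const (f x))"
  by (induction A rule: infinite_finite_induct) (simp_all add: const_add)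

lemma const_power: "const (a ^ k) = const a ^ k"
  by (induction k) (simp_all add: const_mult)

lemma single_eq_const_xmon: "Poly_Mapping.single k a = const a * xmon k"
  by (simp add: const_def mult_single)

lemma lookup_const_mult: "lookup (const a * f) k = a * lookup f k"
  by (simp add: const_def map.rep_eq when_def flip: mult_map_scale_conv_mult)

lemma xmon_add: "xmon (k + l) = xmon k * xmon l"
  by (simp add: mult_single)

lemma xmon_sum: "finite A \<Longrightarrow> xmon (sum f A) = (\<Prod>x\<in>A. xmon (f x))"
  by (induction A rule: finite_induct) (simp_all add: xmon_add)

lemma var_power: "var i ^ k = xmon (expo i (int k))"
  by (induction k) (simp_all add: var_def mult_single single_add[symmetric])

lemma laurent_induct [case_names single add]:
  assumes "\<And>k a. P (Poly_Mapping.single k a)" and "\<And>f g. P f \<Longrightarrow> P g \<Longrightarrow> P (f + g)"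
  shows "P (f :: laurent)"
proof -
  have eq: "f = (\<Sum>k\<in>keys f. Poly_Mapping.single k (lookup f k))"
  proof (rule poly_mapping_eqI)
    fix l
    have "lookup (\<Sum>k\<in>keys f. Poly_Mapping.single k (lookup f k)) l =
        (\<Sum>k\<in>keys f. if k = l then lookup f k else 0)"
      by (simp add: lookup_sum lookup_single when_def)
    also have "\<dots> = lookup f l"
      by (simp add: sum.delta in_keys_iff)
    finally show "lookup f l = lookup (\<Sum>k\<in>keys f. Poly_Mapping.single k (lookup f k)) l" ..
  qed
  have "P (\<Sum>k\<in>A. Poly_Mapping.single k (lookup f k))" if "finite A" for A
    using that
  proof (induction A rule: finite_induct)
    case empty
    show ?case using assms(1)[of 0 0] by simp
  qed (simp add: assms)
  then show ?thesis using eq by (metis finite_keys)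
qed

lemma laurent_lookup_expand:
  assumes "finite A" "keys f \<subseteq> A"
  shows "f = (\<Sum>k\<in>A. const (lookup f k) * xmon k)"
proof (rule poly_mapping_eqI)
  fix l
  have "lookup (\<Sum>k\<in>A. const (lookup f k) * xmon k) l = (\<Sum>k\<in>A. if k = l then lookup f k else 0)"
    unfolding lookup_sum by (rule sum.cong) (auto simp: lookup_const_mult lookup_single when_def)
  also have "\<dots> = lookup f l"
    using assms by (auto simp: sum.delta in_keys_iff)
  finally show "lookup f l = lookup (\<Sum>k\<in>A. const (lookup f k) * xmon k) l" ..
qed

text \<open>The linear extension of a function on exponent vectors. Functionals are handled through
  their values on monomials, so that shifts, weights and alternation can be expressed on exponents
  alone.\<close>

definition lin :: "((nat \<Rightarrow>\<^sub>0 int) \<Rightarrow> qtfield) \<Rightarrow> laurent \<Rightarrow> qtfield" where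
  "lin \<Phi> f = (\<Sum>k\<in>keys f. lookup f k * \<Phi> k)"

lemma lin_superset:
  assumes "finite A" "keys f \<subseteq> A"
  shows "lin \<Phi> f = (\<Sum>k\<in>A. lookup f k * \<Phi> k)"
  unfolding lin_def by (rule sum.mono_neutral_left) (use assms in \<open>auto simp: in_keys_iff\<close>)

lemma lin_0 [simp]: "lin \<Phi> 0 = 0"
  by (simp add: lin_def)

lemma lin_add: "lin \<Phi> (f + g) = lin \<Phi> f + lin \<Phi> g"
proof -
  have "lin \<Phi> h = (\<Sum>k\<in>keys f \<union> keys g. lookup h k * \<Phi> k)" if "h \<in> {f, g, f + g}" for h
    by (rule lin_superset) (use that keys_add[of f g] in auto)
  then show ?thesis by (simp add: lookup_add distrib_right sum.distrib)
qed

lemma lin_sum: "lin \<Phi> (sum f A) = (\<Sum>x\<in>A. lin \<Phi> (f x))"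
  by (induction A rule: infinite_finite_induct) (simp_all add: lin_add)

lemma lin_single [simp]: "lin \<Phi> (Poly_Mapping.single k a) = a * \<Phi> k"
  by (simp add: lin_def)

lemma lin_const_mult: "lin \<Phi> (const a * f) = a * lin \<Phi> f"
proof -
  have "lin \<Phi> (const a * f) = (\<Sum>k\<in>keys f. lookup (const a * f) k * \<Phi> k)"
    by (rule lin_superset) (auto simp: in_keys_iff lookup_const_mult)
  then show ?thesis by (simp add: lookup_const_mult lin_def sum_distrib_left mult.assoc)
qed

text \<open>Multiplication by a monomial is transposed into a shift of the argument; this is how
  power sums become operators on functionals.\<close>

lemma lin_mon_mult: "lin \<Phi> (xmon l * f) = lin (\<lambda>k. \<Phi> (l + k)) f"
  by (induction f rule: laurent_induct) (simp_all add: distrib_left lin_add mult_single)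

lemma lin_fun_add: "lin (\<lambda>k. \<Phi> k + \<Psi> k) f = lin \<Phi> f + lin \<Psi> f"
  and lin_fun_mult: "lin (\<lambda>k. a * \<Phi> k) f = a * lin \<Phi> f"
  and lin_fun_zero: "lin (\<lambda>k. 0) f = 0"
  by (simp_all add: lin_def distrib_left sum.distrib sum_distrib_left ac_simps)

lemma lin_fun_sum: "lin (\<lambda>k. \<Sum>x\<in>A. \<Phi> x k) f = (\<Sum>x\<in>A. lin (\<Phi> x) f)"
  by (induction A rule: infinite_finite_induct) (simp_all add: lin_fun_add lin_fun_zero)

section \<open>Divided differences\<close>

abbreviation perm_expo :: "(nat \<Rightarrow> nat) \<Rightarrow> (nat \<Rightarrow>\<^sub>0 int) \<Rightarrow> (nat \<Rightarrow>\<^sub>0 int)" where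
  "perm_expo \<pi> c \<equiv> Poly_Mapping.map_key \<pi> c"

abbreviation swap_expo :: "nat \<Rightarrow> (nat \<Rightarrow>\<^sub>0 int) \<Rightarrow> (nat \<Rightarrow>\<^sub>0 int)" where
  "swap_expo i \<equiv> perm_expo (Transposition.transpose i (Suc i))"

lemma lookup_perm_expo: "inj \<pi> \<Longrightarrow> lookup (perm_expo \<pi> c) j = lookup c (\<pi> j)"
  by (simp add: map_key.rep_eq)

lemma lookup_swap_expo: "lookup (swap_expo i c) j = lookup c (Transposition.transpose i (Suc i) j)"
  by (simp add: lookup_perm_expo)

lemma swap_expo_idem [simp]: "swap_expo i (swap_expo i c) = c"
  by (rule poly_mapping_eqI) (simp add: lookup_swap_expo)

lemma inj_swap_expo: "inj (swap_expo i)"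
  by (metis injI swap_expo_idem)

lemma swap_expo_add: "swap_expo i (c + e) = swap_expo i c + swap_expo i e"
  by (rule poly_mapping_eqI) (simp add: lookup_swap_expo lookup_add)

lemma swap_vars_single [simp]:
  "swap_vars i (Poly_Mapping.single c a) = Poly_Mapping.single (swap_expo i c) a"
  unfolding swap_vars_def Suc_eq_plus1[symmetric]
  using map_key_single[OF inj_swap_expo, of i "swap_expo i c" a] by simp

lemma swap_vars_add: "swap_vars i (f + g) = swap_vars i f + swap_vars i g"
  unfolding swap_vars_def Suc_eq_plus1[symmetric] by (rule map_key_plus[OF inj_swap_expo])

lemma swap_vars_0 [simp]: "swap_vars i 0 = 0"
  using swap_vars_add[of i 0 0] by simp

lemma swap_vars_minus: "swap_vars i (- f) = - swap_vars i f"
  using swap_vars_add[of i f "- f"] by (simp add: eq_neg_iff_add_eq_0 add.commute)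

lemma swap_vars_diff: "swap_vars i (f - g) = swap_vars i f - swap_vars i g"
  using swap_vars_add[of i f "- g"] by (simp add: swap_vars_minus)

lemma swap_vars_mult: "swap_vars i (f * g) = swap_vars i f * swap_vars i g"
proof (induction f rule: laurent_induct)
  case (single k a)
  show ?case
    by (induction g rule: laurent_induct)
      (simp_all add: mult_single swap_expo_add distrib_left swap_vars_add)
qed (simp add: distrib_right swap_vars_add)

lemma swap_vars_idem [simp]: "swap_vars i (swap_vars i f) = f"
  by (induction f rule: laurent_induct) (simp_all add: swap_vars_add)

lemma swap_expo_far: "i + 1 < j \<or> j + 1 < i \<Longrightarrow> swap_expo i (swap_expo j c) = swap_expo j (swap_expo i c)"
  by (rule poly_mapping_eqI) (auto simp: lookup_swap_expo Transposition.transpose_def)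

lemma swap_expo_braid:
  "swap_expo (Suc i) (swap_expo i (swap_expo (Suc i) c)) = swap_expo i (swap_expo (Suc i) (swap_expo i c))"
  by (rule poly_mapping_eqI) (auto simp: lookup_swap_expo Transposition.transpose_def)

lemma swap_vars_far: "i + 1 < j \<or> j + 1 < i \<Longrightarrow> swap_vars i (swap_vars j f) = swap_vars j (swap_vars i f)"
proof (induction f rule: laurent_induct)
  case (single k a)
  then show ?case using swap_expo_far[of i j k] by simp
qed (simp add: swap_vars_add)

lemma swap_vars_braid:
  "swap_vars (Suc i) (swap_vars i (swap_vars (Suc i) f)) = swap_vars i (swap_vars (Suc i) (swap_vars i f))"
proof (induction f rule: laurent_induct)
  case (single k a)
  then show ?case using swap_expo_braid[of i k] by simp
qed (simp add: swap_vars_add)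

lemma swap_expo_expo: "swap_expo i (expo j m) = expo (Transposition.transpose i (Suc i) j) m"
  by (rule poly_mapping_eqI)
    (auto simp: lookup_swap_expo lookup_single when_def Transposition.transpose_def)

lemma swap_vars_var: "swap_vars i (var j) = var (Transposition.transpose i (Suc i) j)"
  unfolding var_def by (simp add: swap_expo_expo del: One_nat_def)

lemma swap_vars_const [simp]: "swap_vars i (const a) = const a"
proof -
  have "swap_expo i 0 = 0" by (rule poly_mapping_eqI) (simp add: lookup_swap_expo)
  then show ?thesis by (simp add: const_def)
qed

lemma var_inj: "i \<noteq> j \<Longrightarrow> var i - var j \<noteq> 0"
proof
  assume "i \<noteq> j" "var i - var j = 0"
  then have "lookup (var i) (expo i 1) = lookup (var j) (expo i 1)" by simp
  moreover have "expo j (1::int) \<noteq> expo i 1"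
    using \<open>i \<noteq> j\<close> by (metis lookup_single_eq lookup_single_not_eq zero_neq_one)
  ultimately show False by (simp add: var_def lookup_single)
qed

text \<open>The symmetric factor comes out, which leaves \<open>var i ^ k - var (Suc i) ^ k\<close>,
  a multiple of \<open>var i - var (Suc i)\<close>.\<close>

lemma div_diff_ex_aux:
  assumes "swap_expo i e = e"
  shows "\<exists>g. g * (var i - var (Suc i)) = xmon (e + expo i (int k)) - swap_vars i (xmon (e + expo i (int k)))"
proof -
  have "xmon (e + expo i (int k)) - swap_vars i (xmon (e + expo i (int k))) =
      xmon e * (var i ^ k - var (Suc i) ^ k)"
    using assms by (simp add: swap_expo_add swap_expo_expo var_power xmon_add swap_vars_mult right_diff_distrib
        del: One_nat_def)
  also have "var i ^ k - var (Suc i) ^ k = (var i - var (Suc i)) * (\<Sum>j<k. var (Suc i) ^ (k - Suc j) * var i ^ j)"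
    by (rule power_diff_sumr2)
  finally show ?thesis
    by (intro exI[of _ "xmon e * (\<Sum>j<k. var (Suc i) ^ (k - Suc j) * var i ^ j)"])
      (simp add: ac_simps)
qed

lemma div_diff_ex_mon:
  "\<exists>g. g * (var i - var (Suc i)) = xmon c - swap_vars i (xmon c)"
proof -
  have main: "\<exists>g. g * (var i - var (Suc i)) = xmon c - swap_vars i (xmon c)"
    if "lookup c (Suc i) \<le> lookup c i" for c
  proof -
    \<comment> \<open>Splitting off the surplus of the larger exponent leaves a vector fixed by the
      swap, even when exponents are negative.\<close>
    define k where "k = nat (lookup c i - lookup c (Suc i))"
    define e where "e = c - expo i (int k)"
    have "swap_expo i e = e"
      by (rule poly_mapping_eqI)
        (use that in \<open>auto simp: lookup_swap_expo Transposition.transpose_def e_def k_def lookup_minus lookup_single\<close>)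
    from div_diff_ex_aux[OF this, of k] show ?thesis by (simp add: e_def)
  qed
  show ?thesis
  proof (cases "lookup c (Suc i) \<le> lookup c i")
    case False
    then have "lookup (swap_expo i c) (Suc i) \<le> lookup (swap_expo i c) i"
      by (simp add: lookup_swap_expo)
    from main[OF this] obtain g where "g * (var i - var (Suc i)) = xmon (swap_expo i c) - xmon c"
      by auto
    then have "(- g) * (var i - var (Suc i)) = xmon c - swap_vars i (xmon c)" by simp
    then show ?thesis by blast
  qed (rule main)
qed

lemma div_diff_ex: "\<exists>g. g * (var i - var (Suc i)) = f - swap_vars i f"
proof (induction f rule: laurent_induct)
  case (single k a)
  obtain g where g: "g * (var i - var (Suc i)) = xmon k - swap_vars i (xmon k)"
    using div_diff_ex_mon by blast
  have "const a * g * (var i - var (Suc i)) = Poly_Mapping.single k a - swap_vars i (Poly_Mapping.single k a)"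
    unfolding mult.assoc g by (simp add: single_eq_const_xmon[of _ a] right_diff_distrib swap_vars_mult)
  then show ?case by blast
next
  case (add f g)
  then obtain f' g' where "f' * (var i - var (Suc i)) = f - swap_vars i f"
    "g' * (var i - var (Suc i)) = g - swap_vars i g" by blast
  then have "(f' + g') * (var i - var (Suc i)) = (f + g) - swap_vars i (f + g)"
    by (simp add: distrib_right swap_vars_add)
  then show ?case by blast
qed

text \<open>Laurent polynomials form an integral domain, so the quotient is unique. Later
  evaluations of divided differences therefore only verify the defining equation.\<close>

lemma div_diff_unique:
  assumes "g * (var i - var (Suc i)) = f - swap_vars i f"
  shows "div_diff i f = g"
  unfolding div_diff_def Suc_eq_plus1[symmetric]
proof (rule the_equality)
  fix h assume "h * (var i - var (Suc i)) = f - swap_vars i f"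
  then have "h * (var i - var (Suc i)) = g * (var i - var (Suc i))" using assms by simp
  then show "h = g" using var_inj[of i "i + 1"] by simp
qed (rule assms)

lemma div_diff_eq: "div_diff i f * (var i - var (Suc i)) = f - swap_vars i f"
  using div_diff_ex[of i f] div_diff_unique[of _ i f] by metis

lemma div_diff_add: "div_diff i (f + g) = div_diff i f + div_diff i g"
  by (rule div_diff_unique) (simp only: distrib_right div_diff_eq swap_vars_add, simp)

lemma div_diff_sym_mult: "swap_vars i s = s \<Longrightarrow> div_diff i (s * f) = s * div_diff i f"
  by (rule div_diff_unique) (simp only: mult.assoc div_diff_eq swap_vars_mult, simp add: right_diff_distrib)

lemma div_diff_sym: "swap_vars i f = f \<Longrightarrow> div_diff i f = 0"
  by (rule div_diff_unique) simp

section \<open>Antisymmetry of the maximal divided difference\<close>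

lemma swap_vars_div_diff_far:
  assumes "i + 1 < j \<or> j + 1 < i" "swap_vars j f = f"
  shows "swap_vars j (div_diff i f) = div_diff i f"
proof -
  have "swap_vars j (div_diff i f) * (var i - var (Suc i)) = f - swap_vars i f"
    using arg_cong[OF div_diff_eq[of i f], of "swap_vars j"] assms
    by (auto simp: swap_vars_mult swap_vars_diff swap_vars_var swap_vars_far[of j i])
  then show ?thesis using div_diff_unique by metis
qed

text \<open>This does the work of the braid relation: the symmetry of \<open>f\<close> at
  \<open>i\<close> is moved to \<open>Suc i\<close>. Cleared of denominators, the result is a
  combination of three images of \<open>f\<close> over the Vandermonde product in three variables,
  and \<open>swap_vars (Suc i)\<close> changes the sign of both.\<close>

lemma swap_vars_div_diff_div_diff:
  assumes f: "swap_vars i f = f"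
  defines "k \<equiv> div_diff i (div_diff (Suc i) f)"
  shows "swap_vars (Suc i) k = k"
proof -
  define a b c where "a = var i" and "b = var (Suc i)" and "c = var (Suc (Suc i))"
  define h where "h = div_diff (Suc i) f"
  define rf srf where "rf = swap_vars (Suc i) f" and "srf = swap_vars i rf"
  have r: "swap_vars (Suc i) a = a" "swap_vars (Suc i) b = c" "swap_vars (Suc i) c = b"
    and s: "swap_vars i a = b" "swap_vars i b = a" "swap_vars i c = c"
    by (simp_all add: a_def b_def c_def swap_vars_var Transposition.transpose_def)
  have h: "h * (b - c) = f - rf"
    using div_diff_eq[of "Suc i" f] by (simp add: h_def b_def c_def rf_def)
  have k: "k * (a - b) = h - swap_vars i h"
    using div_diff_eq[of i h] by (simp add: k_def h_def a_def b_def)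
  have sh: "swap_vars i h * (a - c) = f - srf"
    using arg_cong[OF h, of "swap_vars i"] by (simp add: swap_vars_mult swap_vars_diff s f srf_def)
  \<comment> \<open>By the braid relation for swaps and the symmetry of \<open>f\<close>, the third
    image is invariant, so that the other two are merely interchanged.\<close>
  have rsrf: "swap_vars (Suc i) srf = srf"
    using swap_vars_braid[of i f] by (simp add: srf_def rf_def f)
  have eq: "k * ((a - b) * (b - c) * (a - c)) = (a - b) * f - (a - c) * rf + (b - c) * srf"
  proof -
    have "k * ((a - b) * (b - c) * (a - c)) = (k * (a - b)) * (b - c) * (a - c)"
      by (simp add: ac_simps)
    also have "\<dots> = (h * (b - c)) * (a - c) - (swap_vars i h * (a - c)) * (b - c)"
      unfolding k by (simp add: algebra_simps)
    finally show ?thesis unfolding h sh by (simp add: algebra_simps)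
  qed
  have "swap_vars (Suc i) k * ((a - c) * (c - b) * (a - b)) = (a - c) * rf - (a - b) * f + (c - b) * srf"
    using arg_cong[OF eq, of "swap_vars (Suc i)"]
    by (simp add: swap_vars_mult swap_vars_diff swap_vars_add r rsrf rf_def)
  then have "swap_vars (Suc i) k * ((a - b) * (b - c) * (a - c)) = k * ((a - b) * (b - c) * (a - c))"
    unfolding eq by (simp add: algebra_simps)
  moreover have "(a - b) * (b - c) * (a - c) \<noteq> 0"
    unfolding a_def b_def c_def using var_inj[of i "Suc i"] var_inj[of "Suc i" "Suc (Suc i)"]
      var_inj[of i "Suc (Suc i)"] by simp
  ultimately show ?thesis by simp
qed

text \<open>The tail of the product that acts on x_m, ..., x_N. It allows the chains to be peeled
  off one at a time; the chain starting at \<open>m\<close> acts first.\<close>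

definition omega_from :: "nat \<Rightarrow> nat \<Rightarrow> laurent \<Rightarrow> laurent" where
  "omega_from N m f = foldr div_diff (concat (map (\<lambda>k. [k..<N]) (rev [m..<N]))) f"

lemma div_diff_omega_eq: "div_diff_omega n = omega_from (2 * n) 1"
  by (simp add: fun_eq_iff div_diff_omega_def omega_from_def)

lemma omega_from_step:
  "m < N \<Longrightarrow> omega_from N m f = omega_from N (Suc m) (foldr div_diff [m..<N] f)"
proof -
  assume "m < N"
  then have "rev [m..<N] = rev [Suc m..<N] @ [m]" by (simp add: upt_conv_Cons)
  then show ?thesis by (simp add: omega_from_def)
qed

lemma omega_from_end: "N \<le> m \<Longrightarrow> omega_from N m f = f"
  by (simp add: omega_from_def)

lemma foldr_div_diff_add:
  "foldr div_diff is (f + g) = foldr div_diff is f + foldr div_diff is g"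
  by (induction "is") (simp_all add: div_diff_add)

lemma foldr_div_diff_const:
  "foldr div_diff is (const a * f) = const a * foldr div_diff is f"
  by (induction "is") (simp_all add: div_diff_sym_mult)

lemma foldr_div_diff_0: "foldr div_diff is 0 = 0"
  by (induction "is") (simp_all add: div_diff_sym)

lemma omega_from_add: "omega_from N m (f + g) = omega_from N m f + omega_from N m g"
  and omega_from_const: "omega_from N m (const a * f) = const a * omega_from N m f"
  and omega_from_0: "omega_from N m 0 = 0"
  by (simp_all add: omega_from_def foldr_div_diff_add foldr_div_diff_const foldr_div_diff_0)

lemma omega_from_sum: "omega_from N m (sum f A) = (\<Sum>x\<in>A. omega_from N m (f x))"
  by (induction A rule: infinite_finite_induct) (simp_all add: omega_from_0 omega_from_add)

lemma foldr_div_diff_far: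
  assumes "swap_vars j f = f" "\<And>i. i \<in> set is \<Longrightarrow> i + 1 < j \<or> j + 1 < i"
  shows "swap_vars j (foldr div_diff is f) = foldr div_diff is f"
  using assms(2) by (induction "is") (simp_all add: assms(1) swap_vars_div_diff_far)

text \<open>Read from the right: the indices above \<open>Suc i\<close> preserve the symmetry at
  \<open>i\<close>, the pair \<open>i\<close>, \<open>Suc i\<close> moves it to
  \<open>Suc i\<close>, and the indices below \<open>i\<close> do not disturb it there.\<close>

lemma swap_vars_foldr_div_diff:
  assumes f: "swap_vars i f = f" and "m \<le> i" "Suc i < N"
  shows "swap_vars (Suc i) (foldr div_diff [m..<N] f) = foldr div_diff [m..<N] f"
proof -
  have upt: "[m..<N] = [m..<i] @ i # Suc i # [Suc (Suc i)..<N]"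
    using assms upt_add_eq_append[of m i "N - i"] by (simp add: upt_conv_Cons)
  have "swap_vars i (foldr div_diff [Suc (Suc i)..<N] f) = foldr div_diff [Suc (Suc i)..<N] f"
    by (rule foldr_div_diff_far[OF f]) auto
  note swap_vars_div_diff_div_diff[OF this]
  from foldr_div_diff_far[OF this, of "[m..<i]"] show ?thesis
    by (simp add: upt)
qed

text \<open>Each chain moves the symmetry one index up. Once it has arrived at \<open>N - 1\<close>,
  the next operator to act is \<open>div_diff (N - 1)\<close>, which gives zero.\<close>

lemma omega_from_sym:
  "swap_vars i f = f \<Longrightarrow> m \<le> i \<Longrightarrow> i < N \<Longrightarrow> omega_from N m f = 0"
proof (induction "N - m" arbitrary: m i f)
  case (Suc k)
  then have "m < N" by simp
  note step = omega_from_step[OF this]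
  show ?case
  proof (cases "Suc i < N")
    case True
    have "omega_from N (Suc m) (foldr div_diff [m..<N] f) = 0"
      by (rule Suc.hyps(1)[of _ "Suc i"]) (use Suc True swap_vars_foldr_div_diff in auto)
    then show ?thesis by (simp add: step)
  next
    case False
    then have "[m..<N] = [m..<i] @ [i]" using Suc.prems
      by (metis Suc_lessI upt_Suc_append)
    then have "foldr div_diff [m..<N] f = 0"
      by (simp add: div_diff_sym Suc.prems foldr_div_diff_0)
    then show ?thesis by (simp add: step omega_from_0)
  qed
qed simp

text \<open>By polarisation, since \<open>swap_vars i f + f\<close> is symmetric.\<close>

lemma omega_from_swap:
  assumes "m \<le> i" "i < N"
  shows "omega_from N m (swap_vars i f) = - omega_from N m f"
proof -
  have "omega_from N m (swap_vars i f + f) = 0"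
    by (rule omega_from_sym) (use assms in \<open>auto simp: swap_vars_add add.commute\<close>)
  then show ?thesis by (simp add: omega_from_add eq_neg_iff_add_eq_0)
qed

section \<open>The alternating functional\<close>

definition fexp :: "nat set \<Rightarrow> (nat \<Rightarrow> int) \<Rightarrow> (nat \<Rightarrow>\<^sub>0 int)" where
  "fexp A g = (\<Sum>i\<in>A. expo i (g i))"

lemma lookup_fexp: "finite A \<Longrightarrow> lookup (fexp A g) j = (if j \<in> A then g j else 0)"
  by (simp add: fexp_def lookup_sum lookup_single when_def)

definition rho_expo :: "nat \<Rightarrow> (nat \<Rightarrow>\<^sub>0 int)" where
  "rho_expo N = fexp {1..N} (\<lambda>i. int i - 1)"

lemma lookup_rho: "lookup (rho_expo N) i = (if i \<in> {1..N} then int i - 1 else 0)"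
  by (simp add: rho_expo_def lookup_fexp)

lemma perm_expo_id: "perm_expo id c = c"
  by (rule poly_mapping_eqI) (simp add: lookup_perm_expo)

lemma perm_rho_inj:
  assumes "\<pi> permutes {1..N}" "\<pi>' permutes {1..N}"
    and eq: "perm_expo \<pi> (rho_expo N) = perm_expo \<pi>' (rho_expo N)"
  shows "\<pi> = \<pi>'"
proof
  fix i
  show "\<pi> i = \<pi>' i"
  proof (cases "i \<in> {1..N}")
    case True
    then have "\<pi> i \<in> {1..N}" "\<pi>' i \<in> {1..N}"
      using assms permutes_in_image by metis+
    then show ?thesis
      using arg_cong[OF eq, of "\<lambda>c. lookup c i"]
      by (simp add: lookup_perm_expo[OF permutes_inj[OF assms(1)]]
          lookup_perm_expo[OF permutes_inj[OF assms(2)]] lookup_rho)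
  next
    case False
    then show ?thesis using assms by (simp add: permutes_not_in)
  qed
qed

text \<open>The value of the maximal divided difference on a monomial, up to
  \<open>omega_sign\<close>, as \<open>omega_from_xmon\<close> confirms. The agreement is special to
  nonnegative exponents and the degree of \<open>rho_expo\<close>; for other Laurent monomials the
  two can differ.\<close>

definition alt_sign :: "nat \<Rightarrow> (nat \<Rightarrow>\<^sub>0 int) \<Rightarrow> int" where
  "alt_sign N c = (if \<exists>\<pi>. \<pi> permutes {1..N} \<and> c = perm_expo \<pi> (rho_expo N)
     then sign (THE \<pi>. \<pi> permutes {1..N} \<and> c = perm_expo \<pi> (rho_expo N)) else 0)"

lemma alt_sign_perm:
  assumes "\<pi> permutes {1..N}"
  shows "alt_sign N (perm_expo \<pi> (rho_expo N)) = sign \<pi>"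
proof -
  have "(THE \<pi>'. \<pi>' permutes {1..N} \<and> perm_expo \<pi> (rho_expo N) = perm_expo \<pi>' (rho_expo N)) = \<pi>"
    by (rule the_equality) (use assms perm_rho_inj in blast)+
  then show ?thesis using assms by (auto simp: alt_sign_def)
qed

lemma alt_sign_rho: "alt_sign N (rho_expo N) = 1"
  using alt_sign_perm[OF permutes_id, of N] by (simp add: perm_expo_id)

lemma alt_sign_nonzero:
  assumes "alt_sign N c \<noteq> 0"
  obtains \<pi> where "\<pi> permutes {1..N}" "c = perm_expo \<pi> (rho_expo N)"
  using assms by (auto simp: alt_sign_def split: if_splits)

lemma alt_sign_support:
  assumes "alt_sign N c \<noteq> 0"
  shows "inj_on (lookup c) {1..N}" "lookup c ` {1..N} = {0..<int N}" "i \<notin> {1..N} \<Longrightarrow> lookup c i = 0"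
proof -
  obtain \<pi> where \<pi>: "\<pi> permutes {1..N}" and c: "c = perm_expo \<pi> (rho_expo N)"
    using assms by (rule alt_sign_nonzero)
  have l: "lookup c i = (if i \<in> {1..N} then int (\<pi> i) - 1 else 0)" for i
    unfolding c lookup_perm_expo[OF permutes_inj[OF \<pi>]]
    using permutes_in_image[OF \<pi>, of i] by (cases "i \<in> {1..N}") (auto simp: lookup_rho)
  show "i \<notin> {1..N} \<Longrightarrow> lookup c i = 0" by (simp only: l if_False)
  show "inj_on (lookup c) {1..N}"
    using permutes_inj[OF \<pi>] by (auto simp: inj_on_def l)
  have "lookup c ` {1..N} = (\<lambda>j. int j - 1) ` \<pi> ` {1..N}"
    by (auto simp: l image_image)
  also have "\<dots> = (\<lambda>j. int j - 1) ` {1..N}"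
    by (simp only: permutes_image[OF \<pi>])
  also have "\<dots> = {0..<int N}"
  proof
    show "{0..<int N} \<subseteq> (\<lambda>j. int j - 1) ` {1..N}"
    proof
      fix x assume "x \<in> {0..<int N}"
      then show "x \<in> (\<lambda>j. int j - 1) ` {1..N}"
        by (intro image_eqI[of _ _ "nat (x + 1)"]) auto
    qed
  qed auto
  finally show "lookup c ` {1..N} = {0..<int N}" .
qed

lemma perm_rho_ex:
  assumes "inj_on (lookup c) {1..N}" "lookup c ` {1..N} = {0..<int N}"
    and "\<And>i. i \<notin> {1..N} \<Longrightarrow> lookup c i = 0"
  obtains \<pi> where "\<pi> permutes {1..N}" "c = perm_expo \<pi> (rho_expo N)"
proof -
  define \<pi> where "\<pi> i = (if i \<in> {1..N} then nat (lookup c i + 1) else i)" for i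
  have rng: "0 \<le> lookup c i \<and> lookup c i < int N" if "i \<in> {1..N}" for i
    using assms(2) that by (metis atLeastLessThan_iff imageI)
  have sub: "\<pi> ` {1..N} \<subseteq> {1..N}"
  proof
    fix y assume "y \<in> \<pi> ` {1..N}"
    then obtain i where i: "i \<in> {1..N}" "y = \<pi> i" by blast
    then show "y \<in> {1..N}" using rng[OF i(1)] by (simp add: \<pi>_def) linarith
  qed
  have inj: "inj_on \<pi> {1..N}"
  proof (rule inj_onI)
    fix i j assume ij: "i \<in> {1..N}" "j \<in> {1..N}" "\<pi> i = \<pi> j"
    then have "lookup c i = lookup c j"
      using rng[OF ij(1)] rng[OF ij(2)] by (simp add: \<pi>_def eq_nat_nat_iff)
    then show "i = j" using inj_onD[OF assms(1)] ij by blast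
  qed
  then have surj: "\<pi> ` {1..N} = {1..N}" using sub by (simp add: endo_inj_surj)
  have \<pi>: "\<pi> permutes {1..N}"
    by (rule bij_imp_permutes[OF bij_betw_imageI[OF inj surj]]) (simp only: \<pi>_def if_False)
  have "c = perm_expo \<pi> (rho_expo N)"
  proof (rule poly_mapping_eqI)
    fix i
    show "lookup c i = lookup (perm_expo \<pi> (rho_expo N)) i"
    proof (cases "i \<in> {1..N}")
      case True
      then have "\<pi> i \<in> {1..N}" using sub by blast
      then show ?thesis using True rng[OF True]
        by (simp add: lookup_perm_expo[OF permutes_inj[OF \<pi>]] lookup_rho \<pi>_def)
    next
      case False
      then have "\<pi> i = i" by (auto simp: \<pi>_def)
      then show ?thesis using False assms(3)[OF False]
        by (auto simp add: lookup_perm_expo[OF permutes_inj[OF \<pi>]] lookup_rho)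
    qed
  qed
  with \<pi> show thesis by (rule that)
qed

lemma sign_comp_transpose:
  assumes "\<pi> permutes {1..N::nat}" "a \<noteq> b"
  shows "sign (\<pi> \<circ> Transposition.transpose a b) = - sign \<pi>"
    and "sign (Transposition.transpose a b \<circ> \<pi>) = - sign \<pi>"
proof -
  have "permutation \<pi>" using assms(1) permutation_permutes by blast
  then show "sign (\<pi> \<circ> Transposition.transpose a b) = - sign \<pi>"
    and "sign (Transposition.transpose a b \<circ> \<pi>) = - sign \<pi>"
    using assms(2) by (simp_all add: sign_compose permutation_swap_id sign_swap_id)
qed

lemma alt_sign_transpose:
  assumes "a \<in> {1..N}" "b \<in> {1..N}" "a \<noteq> b"
  shows "alt_sign N (perm_expo (Transposition.transpose a b) c) = - alt_sign N c"
proof -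
  have tr: "Transposition.transpose a b permutes {1..N}"
    using assms by (simp add: permutes_swap_id)
  have main: "alt_sign N (perm_expo (Transposition.transpose a b) c) = - alt_sign N c"
    if nz: "alt_sign N c \<noteq> 0" for c
  proof -
    obtain \<pi> where \<pi>: "\<pi> permutes {1..N}" and c: "c = perm_expo \<pi> (rho_expo N)"
      using nz by (rule alt_sign_nonzero)
    have "perm_expo (Transposition.transpose a b) c =
        perm_expo (\<pi> \<circ> Transposition.transpose a b) (rho_expo N)"
      unfolding c by (rule map_key_compose) (use \<pi> permutes_inj in auto)
    moreover have "sign (\<pi> \<circ> Transposition.transpose a b) = - sign \<pi>"
      by (rule sign_comp_transpose(1)[OF \<pi> assms(3)])
    ultimately show ?thesis
      using alt_sign_perm[OF permutes_compose[OF tr \<pi>]] alt_sign_perm[OF \<pi>] by (simp add: c)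
  qed
  show ?thesis
  proof (cases "alt_sign N c = 0")
    case True
    have "perm_expo (Transposition.transpose a b) (perm_expo (Transposition.transpose a b) c) = c"
      by (rule poly_mapping_eqI) (simp add: lookup_perm_expo)
    then show ?thesis
      using True main[of "perm_expo (Transposition.transpose a b) c"] by fastforce
  qed (rule main)
qed

lemma perm_expo_transpose_fixed:
  "lookup c a = lookup c b \<Longrightarrow> perm_expo (Transposition.transpose a b) c = c"
  by (rule poly_mapping_eqI) (auto simp: lookup_perm_expo Transposition.transpose_def)

text \<open>The elements of \<open>S\<close> outside the segment are at least \<open>card S\<close>,
  and the equally many gaps inside it are smaller, so a single gap would make the sum too
  large.\<close>

lemma initial_segment_if_small_sum:
  fixes S :: "int set"
  assumes "finite S" "\<And>x. x \<in> S \<Longrightarrow> 0 \<le> x" "\<Sum>S \<le> \<Sum>{0..<int (card S)}"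
  shows "S = {0..<int (card S)}"
proof (rule ccontr)
  define I where "I = {0..<int (card S)}"
  have fI: "finite I" and cI: "card I = card S" by (simp_all add: I_def)
  assume "S \<noteq> {0..<int (card S)}"
  then have ne: "S \<noteq> I" by (simp add: I_def)
  have "card (S - I) + card (S \<inter> I) = card S" "card (I - S) + card (S \<inter> I) = card I"
    using assms(1) fI by (simp_all add: card_Diff_subset_Int card_mono Int_commute[of I S])
  then have card: "card (S - I) = card (I - S)" using cI by linarith
  have "S - I \<noteq> {}"
    using ne assms(1) fI cI by (metis Diff_eq_empty_iff card_subset_eq)
  then have pos: "card (S - I) > 0" using assms(1) by (simp add: card_gt_0_iff)
  have "(\<Sum>x\<in>S - I. x) \<ge> int (card (S - I)) * int (card S)"
    using assms(2) by (intro sum_bounded_below) (auto simp: I_def)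
  moreover have "(\<Sum>x\<in>I - S. x) \<le> int (card (I - S)) * (int (card S) - 1)"
    by (intro sum_bounded_above) (auto simp: I_def)
  moreover have "int (card (I - S)) * (int (card S) - 1) < int (card (S - I)) * int (card S)"
    using pos card by (simp add: algebra_simps)
  moreover have "\<Sum>S = (\<Sum>x\<in>S - I. x) + (\<Sum>x\<in>S \<inter> I. x)"
    using assms(1) sum.Int_Diff[of S "\<lambda>x. x" I] by simp
  moreover have "\<Sum>I = (\<Sum>x\<in>I - S. x) + (\<Sum>x\<in>S \<inter> I. x)"
    using fI sum.Int_Diff[of I "\<lambda>x. x" S] by (simp add: inf_commute)
  ultimately show False using assms(3) by (simp add: I_def)
qed

text \<open>Distinct nonnegative entries have their least possible sum exactly for the permutations
  of \<open>rho_expo\<close>, so a bound on the degree is enough to recognise them.\<close>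

lemma perm_rho_if_small_sum:
  assumes "\<And>i. i \<in> {1..N} \<Longrightarrow> 0 \<le> lookup c i" "inj_on (lookup c) {1..N}"
    and "\<And>i. i \<notin> {1..N} \<Longrightarrow> lookup c i = 0"
    and "(\<Sum>i=1..N. lookup c i) \<le> (\<Sum>i=1..N. int i - 1)"
  obtains \<pi> where "\<pi> permutes {1..N}" "c = perm_expo \<pi> (rho_expo N)"
proof -
  have card: "card (lookup c ` {1..N}) = N" using card_image[OF assms(2)] by simp
  have "(\<Sum>i=1..N. int i - 1) = \<Sum>{0..<int N}"
    by (rule sum.reindex_bij_witness[of _ "\<lambda>x. nat (x + 1)" "\<lambda>i. int i - 1"]) auto
  moreover have "\<Sum>(lookup c ` {1..N}) = (\<Sum>i=1..N. lookup c i)"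
    using sum.reindex[OF assms(2), of "\<lambda>x. x"] by (simp add: comp_def)
  ultimately have "lookup c ` {1..N} = {0..<int (card (lookup c ` {1..N}))}"
    using assms(1,4) by (intro initial_segment_if_small_sum) (auto simp only: card)
  then show thesis
    unfolding card by (rule perm_rho_ex[OF assms(2) _ assms(3)]) (use that in auto)
qed

lemma sum_lookup_perm_rho:
  assumes "alt_sign N c \<noteq> 0"
  shows "(\<Sum>i=1..N. lookup c i) = (\<Sum>i=1..N. int i - 1)"
proof -
  have "(\<Sum>i=1..N. lookup c i) = \<Sum>{0..<int N}"
    using sum.reindex[OF alt_sign_support(1)[OF assms], of "\<lambda>x. x"]
    unfolding alt_sign_support(2)[OF assms] by (simp add: comp_def)
  also have "\<dots> = (\<Sum>i=1..N. int i - 1)"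
    by (rule sum.reindex_bij_witness[of _ "\<lambda>i. int i - 1" "\<lambda>x. nat (x + 1)"]) auto
  finally show ?thesis .
qed

text \<open>Conjugation by the adjacent swap at \<open>b - 1\<close> shortens the distance; the
  signs of the two outer swaps cancel.\<close>

lemma omega_from_transpose:
  assumes "a \<in> {1..N}" "b \<in> {1..N}" "a < b"
  shows "omega_from N 1 (xmon (perm_expo (Transposition.transpose a b) c)) = - omega_from N 1 (xmon c)"
  using assms
proof (induction "b - a" arbitrary: b c)
  case (Suc k)
  show ?case
  proof (cases "b = Suc a")
    case True
    then show ?thesis using omega_from_swap[of 1 a N "xmon c"] Suc.prems by simp
  next
    case False
    define b' where "b' = b - 1"
    have b: "b = Suc b'" "a < b'" using False Suc.prems by (auto simp: b'_def)
    have eq: "perm_expo (Transposition.transpose a b) c =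
        swap_expo b' (perm_expo (Transposition.transpose a b') (swap_expo b' c))"
      using b by (intro poly_mapping_eqI) (auto simp: lookup_perm_expo Transposition.transpose_def)
    have IH: "omega_from N 1 (xmon (perm_expo (Transposition.transpose a b') e)) = - omega_from N 1 (xmon e)" for e
      by (rule Suc.hyps(1)) (use Suc b in auto)
    have sw: "omega_from N 1 (xmon (swap_expo b' e)) = - omega_from N 1 (xmon e)" for e
      using omega_from_swap[of 1 b' N "xmon e"] Suc.prems b by simp
    show ?thesis by (simp only: eq sw IH) simp
  qed
qed simp

lemma omega_from_perm:
  assumes "\<pi> permutes {1..N}"
  shows "omega_from N 1 (xmon (perm_expo \<pi> c)) = const (of_int (sign \<pi>)) * omega_from N 1 (xmon c)"
  using assms finite_atLeastAtMost
proof (induction \<pi> arbitrary: c rule: permutes_induct)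
  case id
  show ?case by (simp only: perm_expo_id sign_id) simp
next
  case (swap a b p)
  have p: "inj p" using swap permutes_inj by blast
  show ?case
  proof (cases "a = b")
    case True
    then show ?thesis using swap.IH by simp
  next
    case False
    have tr: "omega_from N 1 (xmon (perm_expo (Transposition.transpose a b) c)) = - omega_from N 1 (xmon c)"
      using omega_from_transpose[of a N b c] omega_from_transpose[of b N a c] swap.hyps False
      by (metis linorder_neqE_nat transpose_commute)
    have "sign (Transposition.transpose a b \<circ> p) = - sign p"
      by (rule sign_comp_transpose(2)[OF swap.hyps(4) False])
    then show ?thesis
      by (simp only: map_key_compose[OF p inj_transpose, symmetric] swap.IH tr) (simp add: const_minus)
  qed
qed

text \<open>The sign of the longest permutation, kept as a product over positions so that it cancels
  factor by factor against the signs in \<open>xbar\<close>.\<close>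

definition omega_sign :: "nat \<Rightarrow> qtfield" where
  "omega_sign N = (\<Prod>i=1..N. (-1) ^ (i - 1))"

text \<open>The state of one chain after it has acted down to index \<open>j\<close>: all exponents
  to the right of \<open>j\<close> have dropped by one. For the next operator the monomial is
  symmetric in the two variables concerned apart from one factor, the variable with the larger
  index, which is sent to -1.\<close>

lemma foldr_div_diff_rho:
  assumes "m \<le> j" "j \<le> N"
  shows "foldr div_diff [j..<N] (xmon (fexp {m..N} (\<lambda>i. int i - int m))) =
    const ((-1) ^ (N - j)) * xmon (fexp {m..N} (\<lambda>i. if i \<le> j then int i - int m else int i - int m - 1))"
  using assms(2,1)
proof (induction rule: inc_induct)
  case base
  have "fexp {m..N} (\<lambda>i. int i - int m) = fexp {m..N} (\<lambda>i. if i \<le> N then int i - int m else int i - int m - 1)"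
    by (rule poly_mapping_eqI) (simp add: lookup_fexp)
  then show ?case by simp
next
  case (step j)
  let ?e = "\<lambda>j. fexp {m..N} (\<lambda>i. if i \<le> j then int i - int m else int i - int m - 1)"
  have eq: "?e (Suc j) = ?e j + expo (Suc j) 1"
    by (rule poly_mapping_eqI) (use step in \<open>auto simp: lookup_fexp lookup_add lookup_single when_def\<close>)
  have sym: "swap_vars j (xmon (?e j)) = xmon (?e j)"
  proof -
    have "swap_expo j (?e j) = ?e j"
      by (rule poly_mapping_eqI) (use step in \<open>auto simp: lookup_swap_expo lookup_fexp Transposition.transpose_def\<close>)
    then show ?thesis by simp
  qed
  have "div_diff j (var (Suc j)) = - 1"
    by (rule div_diff_unique) (simp add: swap_vars_var)
  then have dd: "div_diff j (xmon (?e (Suc j))) = - xmon (?e j)"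
    unfolding eq xmon_add var_def[symmetric] using div_diff_sym_mult[OF sym] by simp
  have "foldr div_diff [j..<N] (xmon (fexp {m..N} (\<lambda>i. int i - int m))) =
      div_diff j (const ((-1) ^ (N - Suc j)) * xmon (?e (Suc j)))"
    using step by (simp add: upt_conv_Cons)
  also have "\<dots> = const ((-1) ^ (N - Suc j)) * - xmon (?e j)"
    by (simp add: div_diff_sym_mult dd)
  also have "\<dots> = const ((-1) ^ (N - j)) * xmon (?e j)"
  proof -
    have "N - j = Suc (N - Suc j)" using step.hyps by simp
    then show ?thesis by (simp add: const_minus)
  qed
  finally show ?case .
qed

lemma omega_from_rho_aux:
  assumes "1 \<le> m" "m \<le> N"
  shows "omega_from N m (xmon (fexp {m..N} (\<lambda>i. int i - int m))) = const (\<Prod>i=m..N. (-1) ^ (N - i))"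
  using assms(2,1)
proof (induction rule: inc_induct)
  case base
  have "fexp {N..N} (\<lambda>i. int i - int N) = 0"
    by (rule poly_mapping_eqI) (simp add: lookup_fexp)
  then show ?case by (simp add: omega_from_end)
next
  case (step m)
  have "fexp {m..N} (\<lambda>i. if i \<le> m then int i - int m else int i - int m - 1) =
      fexp {Suc m..N} (\<lambda>i. int i - int (Suc m))"
    by (rule poly_mapping_eqI) (auto simp: lookup_fexp)
  then have "omega_from N m (xmon (fexp {m..N} (\<lambda>i. int i - int m))) =
      const ((-1) ^ (N - m)) * omega_from N (Suc m) (xmon (fexp {Suc m..N} (\<lambda>i. int i - int (Suc m))))"
    using step by (simp add: omega_from_step foldr_div_diff_rho omega_from_const)
  also have "\<dots> = const (\<Prod>i=m..N. (-1) ^ (N - i))"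
    using step by (simp add: const_mult prod.atLeast_Suc_atMost)
  finally show ?case .
qed

lemma omega_from_rho: "omega_from N 1 (xmon (rho_expo N)) = const (omega_sign N)"
proof (cases "N = 0")
  case True
  then show ?thesis by (simp add: omega_from_end rho_expo_def fexp_def omega_sign_def)
next
  case False
  have "(\<Prod>i=1..N. (-1) ^ (N - i)) = omega_sign N"
    unfolding omega_sign_def
    by (rule prod.reindex_bij_witness[of _ "\<lambda>i. N + 1 - i" "\<lambda>i. N + 1 - i"]) auto
  then show ?thesis using omega_from_rho_aux[of 1 N] False by (simp add: rho_expo_def)
qed

text \<open>If the exponents are distinct, the degree forces a permutation of
  \<open>rho_expo\<close>. If two agree, their transposition fixes the monomial, while antisymmetry
  changes the sign of the value.\<close>

lemma omega_from_xmon: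
  assumes "\<And>i. i \<in> {1..N} \<Longrightarrow> 0 \<le> lookup c i" "\<And>i. i \<notin> {1..N} \<Longrightarrow> lookup c i = 0"
    and "(\<Sum>i=1..N. lookup c i) = (\<Sum>i=1..N. int i - 1)"
  shows "omega_from N 1 (xmon c) = const (of_int (alt_sign N c) * omega_sign N)"
proof (cases "inj_on (lookup c) {1..N}")
  case True
  obtain \<pi> where \<pi>: "\<pi> permutes {1..N}" and c: "c = perm_expo \<pi> (rho_expo N)"
    by (rule perm_rho_if_small_sum[OF assms(1) True assms(2)]) (use assms(3) in auto)
  show ?thesis unfolding c omega_from_perm[OF \<pi>] alt_sign_perm[OF \<pi>] omega_from_rho
    by (simp add: const_mult)
next
  case False
  then obtain a b where ab: "a \<in> {1..N}" "b \<in> {1..N}" "a < b" "lookup c a = lookup c b"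
    unfolding inj_on_def by (metis linorder_neqE_nat)
  note fixed = perm_expo_transpose_fixed[OF ab(4)]
  have "omega_from N 1 (xmon c) = - omega_from N 1 (xmon c)"
    using omega_from_transpose[OF ab(1-3), of c] fixed by simp
  then have "omega_from N 1 (xmon c) = 0" by (simp only: equal_neg_zero)
  moreover have "alt_sign N c = 0"
    using alt_sign_transpose[OF ab(1,2), of c] ab fixed by simp
  ultimately show ?thesis by simp
qed

section \<open>Raising and lowering operators\<close>

type_synonym state = "nat \<Rightarrow>\<^sub>0 int"

definition alternating :: "nat set \<Rightarrow> (state \<Rightarrow> qtfield) \<Rightarrow> bool" where
  "alternating I \<eta> \<longleftrightarrow>
     (\<forall>c. \<forall>a\<in>I. \<forall>b\<in>I. a \<noteq> b \<longrightarrow> \<eta> (perm_expo (Transposition.transpose a b) c) = - \<eta> c)"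

text \<open>The transpose of multiplication by the power sum of degree \<open>s\<close> in the
  variables of \<open>I\<close>, with the particles kept below \<open>M\<close>;
  \<open>lower\<close> does the same with inverse variables. The bound costs nothing on the
  functionals of interest (\<open>foldr_raise_beyond\<close>), but it spoils the commutation with
  \<open>lower\<close>.\<close>

definition raise :: "nat set \<Rightarrow> int \<Rightarrow> nat \<Rightarrow> (state \<Rightarrow> qtfield) \<Rightarrow> state \<Rightarrow> qtfield" where
  "raise I M s \<eta> c = (\<Sum>i\<in>I. if lookup c i + int s < M then \<eta> (c + expo i (int s)) else 0)"

definition lower :: "nat set \<Rightarrow> nat \<Rightarrow> (state \<Rightarrow> qtfield) \<Rightarrow> state \<Rightarrow> qtfield" where
  "lower I r \<eta> c = (\<Sum>i\<in>I. \<eta> (c - expo i (int r)))"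

lemma alternating_collision:
  assumes "alternating I \<eta>" "a \<in> I" "b \<in> I" "a \<noteq> b" "lookup c a = lookup c b"
  shows "\<eta> c = 0"
  using assms perm_expo_transpose_fixed[OF assms(5)] unfolding alternating_def
  by (metis equal_neg_zero)

lemma alternating_inj:
  assumes "alternating I \<eta>" "\<eta> c \<noteq> 0"
  shows "inj_on (lookup c) I"
  using alternating_collision[OF assms(1)] assms(2) by (meson inj_onI)

lemma transpose_bij_betw: "a \<in> I \<Longrightarrow> b \<in> I \<Longrightarrow> bij_betw (Transposition.transpose a b) I I"
  by simp

lemma perm_expo_transpose_expo:
  "perm_expo (Transposition.transpose a b) (expo i m) = expo (Transposition.transpose a b i) m"
  by (rule poly_mapping_eqI)
    (auto simp: lookup_perm_expo lookup_single when_def Transposition.transpose_def)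

lemma perm_expo_transpose_add:
  "perm_expo (Transposition.transpose a b) (c + e) =
     perm_expo (Transposition.transpose a b) c + perm_expo (Transposition.transpose a b) e"
  by (rule map_key_plus) simp

lemma perm_expo_transpose_diff:
  "perm_expo (Transposition.transpose a b) (c - e) =
     perm_expo (Transposition.transpose a b) c - perm_expo (Transposition.transpose a b) (e :: state)"
  by (rule poly_mapping_eqI) (simp add: lookup_perm_expo lookup_minus)

lemma alternating_raise:
  assumes "alternating I \<eta>"
  shows "alternating I (raise I M s \<eta>)"
  unfolding alternating_def
proof (intro allI ballI impI)
  fix c a b assume ab: "a \<in> I" "b \<in> I" "a \<noteq> b"
  let ?t = "Transposition.transpose a b"
  have "raise I M s \<eta> (perm_expo ?t c) =
      (\<Sum>i\<in>I. if lookup (perm_expo ?t c) (?t i) + int s < M then \<eta> (perm_expo ?t c + expo (?t i) (int s)) else 0)"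
    unfolding raise_def
    by (rule sum.reindex_bij_betw[OF transpose_bij_betw[OF ab(1,2)], symmetric])
  also have "\<dots> = (\<Sum>i\<in>I. - (if lookup c i + int s < M then \<eta> (c + expo i (int s)) else 0))"
  proof (rule sum.cong[OF refl])
    fix i
    have "perm_expo ?t c + expo (?t i) (int s) = perm_expo ?t (c + expo i (int s))"
      by (simp add: perm_expo_transpose_add perm_expo_transpose_expo)
    then show "(if lookup (perm_expo ?t c) (?t i) + int s < M then \<eta> (perm_expo ?t c + expo (?t i) (int s)) else 0) =
      - (if lookup c i + int s < M then \<eta> (c + expo i (int s)) else 0)"
      using assms ab by (simp add: alternating_def lookup_perm_expo)
  qed
  also have "\<dots> = - raise I M s \<eta> c" by (simp add: raise_def sum_negf)
  finally show "raise I M s \<eta> (perm_expo ?t c) = - raise I M s \<eta> c" .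
qed

lemma alternating_lower:
  assumes "alternating I \<eta>"
  shows "alternating I (lower I r \<eta>)"
  unfolding alternating_def
proof (intro allI ballI impI)
  fix c a b assume ab: "a \<in> I" "b \<in> I" "a \<noteq> b"
  let ?t = "Transposition.transpose a b"
  have "lower I r \<eta> (perm_expo ?t c) = (\<Sum>i\<in>I. \<eta> (perm_expo ?t c - expo (?t i) (int r)))"
    unfolding lower_def
    by (rule sum.reindex_bij_betw[OF transpose_bij_betw[OF ab(1,2)], symmetric])
  also have "\<dots> = (\<Sum>i\<in>I. - \<eta> (c - expo i (int r)))"
  proof (rule sum.cong[OF refl])
    fix i
    have "perm_expo ?t c - expo (?t i) (int r) = perm_expo ?t (c - expo i (int r))"
      by (simp add: perm_expo_transpose_diff perm_expo_transpose_expo)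
    then show "\<eta> (perm_expo ?t c - expo (?t i) (int r)) = - \<eta> (c - expo i (int r))"
      using assms ab by (simp add: alternating_def)
  qed
  also have "\<dots> = - lower I r \<eta> c" by (simp add: lower_def sum_negf)
  finally show "lower I r \<eta> (perm_expo ?t c) = - lower I r \<eta> c" .
qed

definition of_level :: "nat set \<Rightarrow> int \<Rightarrow> (state \<Rightarrow> qtfield) \<Rightarrow> bool" where
  "of_level I E \<eta> \<longleftrightarrow> (\<forall>c. \<eta> c \<noteq> 0 \<longrightarrow> (\<Sum>i\<in>I. lookup c i) = E)"

lemma sum_lookup_expo:
  assumes "finite I" "i \<in> I"
  shows "(\<Sum>j\<in>I. lookup (expo i m) j) = m"
  using assms by (simp add: lookup_single when_def)

text \<open>The level drops because the operator acts on functionals: it is the raised argument that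
  has to lie on the level of \<open>\<eta>\<close>.\<close>

lemma of_level_raise:
  assumes "of_level I E \<eta>" "finite I"
  shows "of_level I (E - int s) (raise I M s \<eta>)"
  unfolding of_level_def
proof (intro allI impI)
  fix c assume "raise I M s \<eta> c \<noteq> 0"
  then obtain i where i: "i \<in> I" "\<eta> (c + expo i (int s)) \<noteq> 0"
    unfolding raise_def by (rule sum.not_neutral_contains_not_neutral) (auto split: if_splits)
  then have "(\<Sum>j\<in>I. lookup (c + expo i (int s)) j) = E"
    using assms(1) unfolding of_level_def by blast
  then show "(\<Sum>i\<in>I. lookup c i) = E - int s"
    by (simp add: lookup_add sum.distrib sum_lookup_expo[OF assms(2) i(1)])
qed

lemma of_level_lower:
  assumes "of_level I E \<eta>" "finite I"
  shows "of_level I (E + int r) (lower I r \<eta>)"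
  unfolding of_level_def
proof (intro allI impI)
  fix c assume "lower I r \<eta> c \<noteq> 0"
  then obtain i where i: "i \<in> I" "\<eta> (c - expo i (int r)) \<noteq> 0"
    unfolding lower_def by (metis (no_types, lifting) sum.not_neutral_contains_not_neutral)
  then have "(\<Sum>j\<in>I. lookup (c - expo i (int r)) j) = E"
    using assms(1) unfolding of_level_def by blast
  then show "(\<Sum>i\<in>I. lookup c i) = E + int r"
    by (simp add: lookup_minus sum_subtractf sum_lookup_expo[OF assms(2) i(1)])
qed

lemma sum_le_top_segment:
  fixes S :: "int set"
  assumes "finite S" "\<And>x. x \<in> S \<Longrightarrow> x < M"
  shows "\<Sum>S \<le> \<Sum>{M - int (card S)..<M}"
  using assms
proof (induction S arbitrary: M rule: finite_linorder_max_induct)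
  case (insert b A)
  have "\<Sum>A \<le> \<Sum>{(M - 1) - int (card A)..<M - 1}"
    using insert.hyps insert.prems[of b] by (intro insert.IH) force
  moreover have "{M - int (card (insert b A))..<M} = insert (M - 1) {(M - 1) - int (card A)..<M - 1}"
    using insert.hyps by auto
  moreover have "b \<notin> A" using insert.hyps by blast
  ultimately show ?case using insert.hyps insert.prems[of b] by simp
qed simp

text \<open>A state of low level has all the top positions occupied: this is what makes the finitely many
  particles behave like a Dirac sea.\<close>

lemma top_occupied:
  assumes "finite I" "inj_on (lookup c) I" "\<And>i. i \<in> I \<Longrightarrow> lookup c i < M"
    and "(\<Sum>i\<in>I. lookup c i) \<ge> \<Sum>{M - int (card I)..<M} - e"
    and "M - int (card I) + e \<le> v" "v < M"
  shows "v \<in> lookup c ` I"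
proof (rule ccontr)
  define S where "S = lookup c ` I"
  assume "v \<notin> lookup c ` I"
  then have v: "v \<notin> S" by (simp add: S_def)
  have S: "finite S" "card S = card I" "\<Sum>S = (\<Sum>i\<in>I. lookup c i)"
    using assms(1) card_image[OF assms(2)] sum.reindex[OF assms(2), of "\<lambda>x. x"]
    by (simp_all add: S_def comp_def)
  \<comment> \<open>With the empty position \<open>v\<close> added there are
    \<open>card I + 1\<close> values below \<open>M\<close>. The bound for their sum grows only by
    \<open>M - card I - 1\<close>, which is less than \<open>v - e\<close>.\<close>
  have "\<Sum>(insert v S) \<le> \<Sum>{M - int (card (insert v S))..<M}"
    by (rule sum_le_top_segment) (use S assms(3,6) in \<open>auto simp: S_def\<close>)
  moreover have "{M - int (card (insert v S))..<M} = insert (M - int (card I) - 1) {M - int (card I)..<M}"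
    using S v by auto
  ultimately show False using S v assms(4,5) by simp
qed

text \<open>The two orders differ only where both operators move the same particle, and there only
  in the bound: \<open>win\<close> describes the particles that respect it after being lowered but
  not before. For \<open>r = s\<close> these fill the top \<open>s\<close> positions, all of them
  occupied, whence the factor \<open>s\<close>. For \<open>r \<noteq> s\<close> the move would
  vacate a top position, and \<open>\<eta>\<close> vanishes on the result.\<close>

lemma lower_raise:
  assumes fin: "finite I" and alt: "alternating I \<eta>" and lev: "of_level I E \<eta>"
    and E: "E \<ge> \<Sum>{M - int (card I)..<M} - e" "e + int s \<le> int (card I)"
    and r: "r > 0"
    and c: "\<And>i. i \<in> I \<Longrightarrow> lookup c i < M"
  shows "lower I r (raise I M s \<eta>) c =
    raise I M s (lower I r \<eta>) c + (if r = s then of_nat s * \<eta> c else 0)"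
proof (cases "inj_on (lookup c) I")
  case False
  then have "\<eta> c = 0" "lower I r (raise I M s \<eta>) c = 0" "raise I M s (lower I r \<eta>) c = 0"
    using alternating_inj alt alternating_raise alternating_lower by blast+
  then show ?thesis by simp
next
  case inj: True
  define X where "X i j = \<eta> (c + expo j (int s) - expo i (int r))" for i j
  define win where "win i \<longleftrightarrow> M - int s \<le> lookup c i \<and> lookup c i < M - int s + int r" for i
  have "lower I r (raise I M s \<eta>) c =
      (\<Sum>i\<in>I. \<Sum>j\<in>I. if lookup c j - (if i = j then int r else 0) + int s < M then X i j else 0)"
    unfolding lower_def raise_def X_def
    by (intro sum.cong refl if_cong)
      (auto simp: lookup_minus lookup_single algebra_simps)
  also have "\<dots> = (\<Sum>i\<in>I. \<Sum>j\<in>I. (if lookup c j + int s < M then X i j else 0) +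
      (if i = j then (if win i then X i i else 0) else 0))"
    by (intro sum.cong refl) (use r in \<open>auto simp: win_def\<close>)
  also have "\<dots> = (\<Sum>i\<in>I. \<Sum>j\<in>I. if lookup c j + int s < M then X i j else 0) +
      (\<Sum>i\<in>I. if win i then X i i else 0)"
    using fin by (simp add: sum.distrib)
  also have "(\<Sum>i\<in>I. \<Sum>j\<in>I. if lookup c j + int s < M then X i j else 0) = raise I M s (lower I r \<eta>) c"
    unfolding raise_def lower_def X_def by (subst sum.swap) (intro sum.cong refl, auto)
  also have "(\<Sum>i\<in>I. if win i then X i i else 0) = (if r = s then of_nat s * \<eta> c else 0)"
  proof (cases "r = s")
    case True
    have "(\<Sum>i\<in>I. if win i then X i i else 0) = (\<Sum>i\<in>{i\<in>I. win i}. \<eta> c)"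
      unfolding sum.inter_filter[OF fin] by (intro sum.cong refl if_cong) (simp_all add: X_def True)
    also have "\<dots> = of_nat (card {i\<in>I. win i}) * \<eta> c" by simp
    also have "\<dots> = of_nat s * \<eta> c"
    proof (cases "\<eta> c = 0")
      case False
      then have "(\<Sum>i\<in>I. lookup c i) = E" using lev by (simp add: of_level_def)
      then have occ: "v \<in> lookup c ` I" if "M - int s \<le> v" "v < M" for v
        using top_occupied[OF fin inj c, where e = e and v = v] E that by simp
      have "lookup c ` {i\<in>I. win i} = {M - int s..<M}"
      proof
        show "{M - int s..<M} \<subseteq> lookup c ` {i\<in>I. win i}"
          using occ True by (fastforce simp: win_def)
      qed (use True in \<open>auto simp: win_def\<close>)
      then have "card (lookup c ` {i\<in>I. win i}) = s" by simp
      moreover have "card (lookup c ` {i\<in>I. win i}) = card {i\<in>I. win i}"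
        by (rule card_image) (rule inj_on_subset[OF inj], auto)
      ultimately show ?thesis by simp
    qed simp
    finally show ?thesis using True by simp
  next
    case False
    have "X i i = 0" if i: "i \<in> I" "win i" for i
    proof (rule ccontr)
      define c' where "c' = c + expo i (int s) - expo i (int r)"
      have l: "lookup c' j = (if j = i then lookup c i + int s - int r else lookup c j)" for j
        by (simp add: c'_def lookup_add lookup_minus lookup_single)
      assume "X i i \<noteq> 0"
      then have nz: "\<eta> c' \<noteq> 0" by (simp add: X_def c'_def)
      then have lev': "(\<Sum>i\<in>I. lookup c' i) = E" using lev by (simp add: of_level_def)
      have "lookup c i \<in> lookup c' ` I"
        by (rule top_occupied[OF fin alternating_inj[OF alt nz], where e = e and M = M])
          (use i c E lev' in \<open>auto simp: l win_def\<close>)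
      then obtain j where j: "j \<in> I" "lookup c' j = lookup c i" by auto
      then have "j \<noteq> i" using False by (auto simp: l)
      then have "lookup c j = lookup c i" using j by (simp add: l)
      then show False using inj_onD[OF inj] \<open>j \<noteq> i\<close> j i by blast
    qed
    then have "(\<Sum>i\<in>I. if win i then X i i else 0) = 0" by (intro sum.neutral) auto
    then show ?thesis using False by simp
  qed
  finally show ?thesis .
qed

lemma lower_commute: "lower I r (lower I s \<eta>) = lower I s (lower I r \<eta>)"
  unfolding lower_def fun_eq_iff by (subst sum.swap) (simp add: algebra_simps)

lemma foldr_lower_remove1:
  "s \<in> set \<pi> \<Longrightarrow> lower I s (foldr (lower I) (remove1 s \<pi>) \<eta>) = foldr (lower I) \<pi> \<eta>"
  by (induction \<pi>) (auto simp: lower_commute[of I s])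

lemma alternating_foldr_lower: "alternating I \<eta> \<Longrightarrow> alternating I (foldr (lower I) \<pi> \<eta>)"
  by (induction \<pi>) (simp_all add: alternating_lower)

lemma of_level_foldr_lower:
  assumes "of_level I E \<eta>" "finite I"
  shows "of_level I (E + int (sum_list \<pi>)) (foldr (lower I) \<pi> \<eta>)"
proof (induction \<pi>)
  case (Cons r \<pi>)
  from of_level_lower[OF this assms(2), of r] show ?case by (simp add: algebra_simps)
qed (simp add: assms)

text \<open>Commutation with the raising operator acts on a product of lowerings as a derivation:
  every occurrence of \<open>s\<close> in \<open>\<pi>\<close> is deleted once, with factor
  \<open>s\<close>. Lowering only increases the level, so the bound on \<open>E\<close> persists
  along \<open>\<pi>\<close>.\<close>

lemma foldr_lower_raise:
  assumes fin: "finite I" and alt: "alternating I \<eta>" and lev: "of_level I E \<eta>"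
    and E: "E \<ge> \<Sum>{M - int (card I)..<M} - e" "e + int s \<le> int (card I)"
    and \<pi>: "0 \<notin> set \<pi>"
    and c: "\<And>i. i \<in> I \<Longrightarrow> lookup c i < M"
  shows "foldr (lower I) \<pi> (raise I M s \<eta>) c = raise I M s (foldr (lower I) \<pi> \<eta>) c +
    of_nat (s * count_list \<pi> s) * foldr (lower I) (remove1 s \<pi>) \<eta> c"
  using \<pi> c
proof (induction \<pi> arbitrary: c)
  case (Cons r \<pi>)
  let ?A = "\<lambda>\<pi>. foldr (lower I) \<pi> \<eta>"
  have "foldr (lower I) (r # \<pi>) (raise I M s \<eta>) c = lower I r (foldr (lower I) \<pi> (raise I M s \<eta>)) c"
    by simp
  also have "\<dots> = lower I r (\<lambda>c. raise I M s (?A \<pi>) c + of_nat (s * count_list \<pi> s) * ?A (remove1 s \<pi>) c) c"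
  proof -
    have "foldr (lower I) \<pi> (raise I M s \<eta>) (c - expo i (int r)) =
        raise I M s (?A \<pi>) (c - expo i (int r)) +
        of_nat (s * count_list \<pi> s) * ?A (remove1 s \<pi>) (c - expo i (int r))" for i
    proof (rule Cons.IH)
      fix j assume "j \<in> I"
      then show "lookup (c - expo i (int r)) j < M"
        using Cons.prems(2)[of j] by (auto simp: lookup_minus lookup_single when_def)
    qed (use Cons.prems in auto)
    then show ?thesis by (simp add: lower_def)
  qed
  also have "\<dots> = lower I r (raise I M s (?A \<pi>)) c + of_nat (s * count_list \<pi> s) * lower I r (?A (remove1 s \<pi>)) c"
    by (simp add: lower_def sum.distrib sum_distrib_left)
  also have "lower I r (raise I M s (?A \<pi>)) c =
      raise I M s (lower I r (?A \<pi>)) c + (if r = s then of_nat s * ?A \<pi> c else 0)"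
  proof (rule lower_raise[OF fin alternating_foldr_lower[OF alt] of_level_foldr_lower[OF lev fin]])
    show "E + int (sum_list \<pi>) \<ge> \<Sum>{M - int (card I)..<M} - e" using E by simp
  qed (use Cons.prems E in auto)
  also have "raise I M s (lower I r (?A \<pi>)) c + (if r = s then of_nat s * ?A \<pi> c else 0) +
      of_nat (s * count_list \<pi> s) * lower I r (?A (remove1 s \<pi>)) c =
      raise I M s (?A (r # \<pi>)) c + of_nat (s * count_list (r # \<pi>) s) * ?A (remove1 s (r # \<pi>)) c"
  proof (cases "r = s")
    case True
    have "of_nat (s * count_list \<pi> s) * lower I s (?A (remove1 s \<pi>)) c = of_nat (s * count_list \<pi> s) * ?A \<pi> c"
      by (cases "s \<in> set \<pi>") (simp_all add: foldr_lower_remove1)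
    then show ?thesis using True by (simp add: algebra_simps)
  qed auto
  finally show ?case .
qed simp

section \<open>Vacuum expectations\<close>

definition block :: "nat \<Rightarrow> nat set" where
  "block n = {n + 1..2 * n}"

lemma finite_block [simp]: "finite (block n)" and card_block [simp]: "card (block n) = n"
  by (simp_all add: block_def)

text \<open>The first \<open>n\<close> positions are frozen in the ground state; only the block \<open>{n + 1..2 * n}\<close> moves.\<close>

definition vac :: "nat \<Rightarrow> state \<Rightarrow> qtfield" where
  "vac n c = (if \<forall>i. i \<notin> block n \<longrightarrow> lookup c i = lookup (rho_expo (2 * n)) i
     then of_int (alt_sign (2 * n) c) else 0)"

lemma vac_rho: "vac n (rho_expo (2 * n)) = 1"
  by (simp add: vac_def alt_sign_rho)

lemma alternating_vac: "alternating (block n) (vac n)"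
  unfolding alternating_def
proof (intro allI ballI impI)
  fix c a b assume ab: "a \<in> block n" "b \<in> block n" "a \<noteq> b"
  have "lookup (perm_expo (Transposition.transpose a b) c) i = lookup c i" if "i \<notin> block n" for i
    using that ab by (auto simp: lookup_perm_expo Transposition.transpose_def)
  then show "vac n (perm_expo (Transposition.transpose a b) c) = - vac n c"
    using alt_sign_transpose[of a "2 * n" b c] ab by (auto simp: vac_def block_def)
qed

abbreviation ground :: "nat \<Rightarrow> int" where
  "ground n \<equiv> \<Sum>{2 * int n - int (card (block n))..<2 * int n}"

lemma sum_rho_block: "(\<Sum>i\<in>block n. lookup (rho_expo (2 * n)) i) = ground n"
  by (rule sum.reindex_bij_witness[of _ "\<lambda>x. nat (x + 1)" "\<lambda>i. int i - 1"])
    (auto simp: block_def lookup_rho)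

lemma of_level_vac: "of_level (block n) (ground n) (vac n)"
  unfolding of_level_def
proof (intro allI impI)
  fix c assume nz: "vac n c \<noteq> 0"
  then have out: "lookup c i = lookup (rho_expo (2 * n)) i" if "i \<notin> block n" for i
    using that by (auto simp: vac_def split: if_splits)
  from nz have "alt_sign (2 * n) c \<noteq> 0" by (auto simp: vac_def split: if_splits)
  from sum_lookup_perm_rho[OF this] have eq: "(\<Sum>i=1..2*n. lookup c i) = (\<Sum>i=1..2*n. lookup (rho_expo (2 * n)) i)"
    by (simp add: lookup_rho)
  have split: "(\<Sum>i=1..2*n. f i) = (\<Sum>i=1..n. f i) + (\<Sum>i\<in>block n. f i)" for f :: "nat \<Rightarrow> int"
    unfolding block_def by (subst sum.union_disjoint[symmetric]) (auto intro!: sum.cong)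
  have "(\<Sum>i=1..n. lookup c i) = (\<Sum>i=1..n. lookup (rho_expo (2 * n)) i)"
    by (rule sum.cong) (auto simp: out block_def)
  then have "(\<Sum>i\<in>block n. lookup c i) = (\<Sum>i\<in>block n. lookup (rho_expo (2 * n)) i)"
    using eq unfolding split by simp
  then show "(\<Sum>i\<in>block n. lookup c i) = ground n" by (simp only: sum_rho_block)
qed

abbreviation raise_block :: "nat \<Rightarrow> nat \<Rightarrow> (state \<Rightarrow> qtfield) \<Rightarrow> state \<Rightarrow> qtfield" where
  "raise_block n \<equiv> raise (block n) (2 * int n)"

abbreviation raised_vac :: "nat \<Rightarrow> nat list \<Rightarrow> state \<Rightarrow> qtfield" where
  "raised_vac n \<sigma> \<equiv> foldr (raise_block n) \<sigma> (vac n)"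

abbreviation lowers :: "nat \<Rightarrow> nat list \<Rightarrow> (state \<Rightarrow> qtfield) \<Rightarrow> state \<Rightarrow> qtfield" where
  "lowers n \<equiv> foldr (lower (block n))"

lemma alternating_raised_vac: "alternating (block n) (raised_vac n \<sigma>)"
  by (induction \<sigma>) (simp_all add: alternating_vac alternating_raise)

lemma of_level_raised_vac: "of_level (block n) (ground n - int (sum_list \<sigma>)) (raised_vac n \<sigma>)"
proof (induction \<sigma>)
  case Nil
  then show ?case using of_level_vac by simp
next
  case (Cons s \<sigma>)
  from of_level_raise[OF this, of s "2 * int n"] show ?case by (simp add: algebra_simps)
qed

text \<open>By \<open>pairing_eq\<close> this is \<open>z_\<sigma>\<close> when both lists have the
  same parts and 0 otherwise. The recursive form is the one that arises when the raising operators
  are commuted away one at a time.\<close>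

fun pairing :: "nat list \<Rightarrow> nat list \<Rightarrow> nat" where
  "pairing [] \<pi> = (if \<pi> = [] then 1 else 0)"
| "pairing (s # \<sigma>) \<pi> = s * count_list \<pi> s * pairing \<sigma> (remove1 s \<pi>)"

text \<open>In the ground state the block is packed against the bound: a raised particle meets an
  occupied position or leaves the range.\<close>

lemma raise_block_rho:
  assumes "alternating (block n) \<eta>" "s > 0"
  shows "raise_block n s \<eta> (rho_expo (2 * n)) = 0"
  unfolding raise_def
proof (intro sum.neutral ballI)
  fix i assume i: "i \<in> block n"
  show "(if lookup (rho_expo (2 * n)) i + int s < 2 * int n
      then \<eta> (rho_expo (2 * n) + expo i (int s)) else 0) = 0"
  proof (cases "i + s \<le> 2 * n")
    case True
    have "\<eta> (rho_expo (2 * n) + expo i (int s)) = 0"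
      by (rule alternating_collision[OF assms(1) i, of "i + s"])
        (use i True assms(2) in \<open>auto simp: block_def lookup_rho lookup_add lookup_single\<close>)
    then show ?thesis by simp
  qed (use i in \<open>auto simp: lookup_rho block_def\<close>)
qed

lemma rho_below: "i \<in> block n \<Longrightarrow> lookup (rho_expo (2 * n)) i < 2 * int n"
  by (auto simp: lookup_rho block_def)

text \<open>By comparison of levels: the functional lives strictly above the ground level, the
  argument at or below it, unless all degrees vanish.\<close>

lemma lowers_vac_rho:
  assumes "int k + int (sum_list \<pi>) \<noteq> 0" "i \<in> block n"
  shows "lowers n \<pi> (vac n) (rho_expo (2 * n) - expo i (int k)) = 0"
proof (rule ccontr)
  let ?c = "rho_expo (2 * n) - expo i (int k)"
  assume "lowers n \<pi> (vac n) ?c \<noteq> 0"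
  with of_level_foldr_lower[OF of_level_vac finite_block, of n \<pi>]
  have "(\<Sum>j\<in>block n. lookup ?c j) = ground n + int (sum_list \<pi>)"
    unfolding of_level_def by blast
  moreover have "(\<Sum>j\<in>block n. lookup ?c j) = ground n - int k"
    using sum_lookup_expo[OF finite_block assms(2)]
    by (simp only: lookup_minus sum_subtractf sum_rho_block)
  ultimately show False using assms(1) by linarith
qed

lemma lowers_raised_vac_step:
  assumes "0 \<notin> set \<pi>" "sum_list (s # \<sigma>) \<le> n" "\<And>i. i \<in> block n \<Longrightarrow> lookup c i < 2 * int n"
  shows "lowers n \<pi> (raised_vac n (s # \<sigma>)) c = raise_block n s (lowers n \<pi> (raised_vac n \<sigma>)) c +
    of_nat (s * count_list \<pi> s) * lowers n (remove1 s \<pi>) (raised_vac n \<sigma>) c"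
  using foldr_lower_raise[OF finite_block alternating_raised_vac of_level_raised_vac, where \<sigma>1 = \<sigma>
      and M = "2 * int n" and e = "int (sum_list \<sigma>)" and s = s and \<pi> = \<pi> and c = c] assms
  by simp

lemma set_remove1_pos: "0 \<notin> set \<pi> \<Longrightarrow> 0 \<notin> set (remove1 s \<pi>)"
  using set_remove1_subset[of s \<pi>] by blast

text \<open>Wick's theorem: a raising operator moved to the outside is killed at
  \<open>rho_expo\<close>, so only its contractions with \<open>\<pi>\<close> remain. The bound on
  \<open>sum_list \<sigma>\<close> keeps enough of the sea filled for the commutation
  relation.\<close>

lemma lowers_raised_vac:
  assumes "0 \<notin> set \<sigma>" "0 \<notin> set \<pi>" "sum_list \<sigma> \<le> n"
  shows "lowers n \<pi> (raised_vac n \<sigma>) (rho_expo (2 * n)) = of_nat (pairing \<sigma> \<pi>)"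
  using assms
proof (induction \<sigma> arbitrary: \<pi>)
  case Nil
  show ?case
  proof (cases "\<pi>")
    case Nil
    then show ?thesis by (simp add: vac_rho)
  next
    case (Cons r \<pi>')
    have "lowers n \<pi> (vac n) (rho_expo (2 * n)) = 0"
    proof (cases "n = 0")
      case True
      then show ?thesis using Cons by (simp add: lower_def block_def)
    next
      case False
      then have "2 * n \<in> block n" by (simp add: block_def)
      with lowers_vac_rho[of 0 \<pi> "2 * n" n] show ?thesis using Nil.prems Cons by simp
    qed
    then show ?thesis using Cons by simp
  qed
next
  case (Cons s \<sigma>)
  have "raise_block n s (lowers n \<pi> (raised_vac n \<sigma>)) (rho_expo (2 * n)) = 0"
    by (rule raise_block_rho[OF alternating_foldr_lower[OF alternating_raised_vac]]) (use Cons.prems in auto)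
  then show ?case
    using lowers_raised_vac_step[of \<pi> s \<sigma> n "rho_expo (2 * n)"] Cons rho_below set_remove1_pos
    by simp
qed

text \<open>Block position \<open>n + i\<close> carries \<open>q_par ^ (n - i)\<close>, the
  coefficient belonging to coordinate \<open>i\<close> in \<open>tq_size\<close>. The powers of t
  are treated separately, by \<open>lin_weighted_lower\<close>.\<close>

definition weighted_lower :: "nat \<Rightarrow> nat \<Rightarrow> (state \<Rightarrow> qtfield) \<Rightarrow> qtfield" where
  "weighted_lower n k \<eta> = (\<Sum>i\<in>block n. q_par ^ (2 * n - i) * \<eta> (rho_expo (2 * n) - expo i (int k)))"

lemma q_par_nonzero: "q_par \<noteq> 0" and t_par_nonzero: "t_par \<noteq> 0"
  by (simp_all add: q_par_def t_par_def Zero_fract_def eq_fract)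

lemma q_par_power: "q_par ^ k = Fract [:monom 1 k:] 1"
proof (induction k)
  case 0
  then show ?case by (simp add: One_fract_def one_pCons)
next
  case (Suc k)
  then show ?case by (simp add: q_par_def monom_Suc)
qed

lemma t_par_power: "t_par ^ k = Fract (monom 1 k) 1"
  by (induction k) (simp_all add: t_par_def One_fract_def monom_Suc)

lemma q_par_power_neq_1: "k > 0 \<Longrightarrow> q_par ^ k \<noteq> 1"
proof
  assume "k > 0" "q_par ^ k = 1"
  then have "monom (1::rat) k = 1" by (simp add: q_par_power One_fract_def eq_fract one_pCons)
  then have "degree (monom (1::rat) k) = 0" by simp
  then show False using \<open>k > 0\<close> by (simp add: degree_monom_eq)
qed

lemma t_par_power_neq_1: "k > 0 \<Longrightarrow> t_par ^ k \<noteq> 1"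
proof
  assume "k > 0" "t_par ^ k = 1"
  then have "monom (1::rat poly) k = 1" by (simp add: t_par_power One_fract_def eq_fract)
  then have "degree (monom (1::rat poly) k) = 0" by simp
  then show False using \<open>k > 0\<close> by (simp add: degree_monom_eq)
qed

section \<open>Commuting raising operators past the q-weighted lowering operator\<close>

abbreviation vq :: "nat \<Rightarrow> qtfield" where
  "vq s \<equiv> 1 - inverse q_par ^ s"

text \<open>
  With this constant the term produced by commuting \<open>weighted_lower n s\<close> past a raising operator of
  the same degree fits the pattern of the other degrees.
\<close>

definition resid :: "nat \<Rightarrow> qtfield" where
  "resid n = - (q_par ^ n) / (1 - q_par)"

text \<open>Formally \<open>resid n\<close> is minus the tail q^n + q^(n+1) + ... of the geometric
  series. Multiplication by \<open>inverse q_par ^ s\<close> makes the tail start at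
  \<open>n - s\<close>, so the difference is the finite piece between the two starting
  points.\<close>

lemma vq_resid:
  assumes "s \<le> n"
  shows "vq s * resid n = (\<Sum>i<n. q_par ^ i) - (\<Sum>i<n - s. q_par ^ i)"
proof -
  have q1: "q_par - 1 \<noteq> 0" using q_par_power_neq_1[of 1] by simp
  have geo: "(\<Sum>i<k. q_par ^ i) = (q_par ^ k - 1) / (q_par - 1)" for k
    using geometric_sum[of q_par k] q1 by simp
  have "q_par ^ n = q_par ^ (n - s) * q_par ^ s" using assms by (simp flip: power_add)
  then have "inverse q_par ^ s * q_par ^ n = q_par ^ (n - s)"
    using q_par_nonzero by (simp add: power_inverse)
  then have "vq s * q_par ^ n = q_par ^ n - q_par ^ (n - s)" by (simp add: algebra_simps)
  moreover have "vq s * resid n = vq s * q_par ^ n / (q_par - 1)"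
    unfolding resid_def using q1 by (simp add: divide_simps) (simp add: algebra_simps)
  ultimately show ?thesis unfolding geo by (simp add: diff_divide_distrib)
qed

lemma sum_block_reindex: "(\<Sum>i\<in>block n. f (2 * n - i)) = (\<Sum>i<n. f i)"
  by (rule sum.reindex_bij_witness[of _ "\<lambda>i. 2 * n - i" "\<lambda>i. 2 * n - i"]) (auto simp: block_def)

text \<open>For distinct \<open>i\<close> and \<open>j\<close> the raised particle \<open>j\<close>
  hits an occupied position, except when \<open>i = j + s\<close> has just vacated it. Exchanging
  the two particles then gives the state in which \<open>j\<close> alone moves, at the cost of a
  sign; hence the second weight, taken at \<open>j + s\<close>.\<close>

lemma weighted_lower_raise_expand:
  assumes alt: "alternating (block n) \<eta>" and "s > 0"
  shows "weighted_lower n k (raise_block n s \<eta>) =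
    (\<Sum>j\<in>block n. ((if j + s \<le> 2 * n + k then q_par ^ (2 * n - j) else 0) -
        (if j + s \<le> 2 * n then q_par ^ (2 * n - (j + s)) else 0)) *
      \<eta> (rho_expo (2 * n) + expo j (int s) - expo j (int k)))"
proof -
  define Z where "Z j = \<eta> (rho_expo (2 * n) + expo j (int s) - expo j (int k))" for j
  define Y where "Y i j = \<eta> (rho_expo (2 * n) - expo i (int k) + expo j (int s))" for i j
  define w where "w i = q_par ^ (2 * n - i)" for i
  have diag: "Y j j = Z j" for j by (simp add: Y_def Z_def algebra_simps)
  have off: "Y i j = (if i = j + s then - Z j else 0)"
    if ij: "i \<in> block n" "j \<in> block n" "i \<noteq> j" "j + s \<le> 2 * n" for i j
  proof -
    have js: "j + s \<in> block n" using ij by (auto simp: block_def)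
    show ?thesis
    proof (cases "i = j + s")
      case True
      have "rho_expo (2 * n) - expo i (int k) + expo j (int s) =
          perm_expo (Transposition.transpose j i) (rho_expo (2 * n) + expo j (int s) - expo j (int k))"
        by (rule poly_mapping_eqI)
          (use True ij in \<open>auto simp: lookup_perm_expo Transposition.transpose_def lookup_add
            lookup_minus lookup_single when_def lookup_rho block_def\<close>)
      then show ?thesis
        using True alt ij by (simp add: Y_def Z_def alternating_def)
    next
      case False
      have "Y i j = 0" unfolding Y_def
        by (rule alternating_collision[OF alt ij(2) js])
          (use False ij js assms(2) in \<open>auto simp: lookup_add lookup_minus lookup_single when_def
            lookup_rho block_def\<close>)
      then show ?thesis using False by simp
    qed
  qed
  have "weighted_lower n k (raise_block n s \<eta>) = (\<Sum>i\<in>block n. \<Sum>j\<in>block n.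
      w i * (if lookup (rho_expo (2 * n) - expo i (int k)) j + int s < 2 * int n then Y i j else 0))"
    by (simp only: weighted_lower_def raise_def sum_distrib_left w_def Y_def)
  also have "\<dots> = (\<Sum>i\<in>block n. \<Sum>j\<in>block n.
      (if i = j then (if j + s \<le> 2 * n + k then w j * Z j else 0) else 0) +
      (if i = j + s then (if j + s \<le> 2 * n then - (w (j + s) * Z j) else 0) else 0))"
  proof (intro sum.cong refl)
    fix i j assume ij: "i \<in> block n" "j \<in> block n"
    have l: "lookup (rho_expo (2 * n) - expo i (int k)) j = int j - 1 - (if i = j then int k else 0)"
      using ij by (auto simp: lookup_minus lookup_rho lookup_single block_def)
    show "w i * (if lookup (rho_expo (2 * n) - expo i (int k)) j + int s < 2 * int n then Y i j else 0) =
      (if i = j then (if j + s \<le> 2 * n + k then w j * Z j else 0) else 0) +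
      (if i = j + s then (if j + s \<le> 2 * n then - (w (j + s) * Z j) else 0) else 0)"
      unfolding l using off[OF ij] diag \<open>s > 0\<close> by auto
  qed
  also have "\<dots> = (\<Sum>j\<in>block n. (if j + s \<le> 2 * n + k then w j * Z j else 0) +
      (if j + s \<le> 2 * n then - (w (j + s) * Z j) else 0))"
    by (subst sum.swap, intro sum.cong refl) (auto simp: sum.distrib block_def)
  also have "\<dots> = (\<Sum>j\<in>block n. ((if j + s \<le> 2 * n + k then w j else 0) -
      (if j + s \<le> 2 * n then w (j + s) else 0)) * Z j)"
    by (intro sum.cong refl) (simp add: algebra_simps)
  finally show ?thesis by (simp only: Z_def w_def)
qed

text \<open>The two weights have ratio \<open>inverse q_par ^ s\<close>, which yields
  \<open>vq s\<close> away from the upper boundary. For \<open>k < s\<close> the net motion is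
  upwards into an occupied position; for \<open>s < k\<close> the boundary particles fall onto an
  occupied block position, so the boundary is invisible. Only for \<open>k = s\<close>, where
  nothing moves, does it matter, and there \<open>vq_resid\<close> absorbs it.\<close>

lemma weighted_lower_raise:
  assumes alt: "alternating (block n) \<eta>" and s: "s > 0" and k: "0 < k" "k \<le> n"
  shows "weighted_lower n k (raise_block n s \<eta>) = (if k < s then 0 else
    if k = s then vq s * (resid n * \<eta> (rho_expo (2 * n))) else vq s * weighted_lower n (k - s) \<eta>)"
proof -
  define Z where "Z j = \<eta> (rho_expo (2 * n) + expo j (int s) - expo j (int k))" for j
  define w where "w i = q_par ^ (2 * n - i)" for i
  have w_shift: "w (j + s) = inverse q_par ^ s * w j" if "j + s \<le> 2 * n" for j
  proof -
    have "w j = q_par ^ s * w (j + s)" using that by (simp add: w_def flip: power_add)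
    then show ?thesis using q_par_nonzero by (simp add: power_inverse)
  qed
  have expand: "weighted_lower n k (raise_block n s \<eta>) =
      (\<Sum>j\<in>block n. ((if j + s \<le> 2 * n + k then w j else 0) - (if j + s \<le> 2 * n then w (j + s) else 0)) * Z j)"
    by (simp only: weighted_lower_raise_expand[OF alt s] Z_def w_def)
  consider "k < s" | "k = s" | "s < k" by linarith
  then show ?thesis
  proof cases
    case 1
    have "((if j + s \<le> 2 * n + k then w j else 0) - (if j + s \<le> 2 * n then w (j + s) else 0)) * Z j = 0"
      if j: "j \<in> block n" for j
    proof (cases "j + s \<le> 2 * n + k")
      case True
      have "j + (s - k) \<in> block n" using j True 1 by (auto simp: block_def)
      then have "Z j = 0" unfolding Z_def
        by (rule alternating_collision[OF alt j])
          (use 1 j True in \<open>auto simp: lookup_add lookup_minus lookup_single when_def lookup_rho block_def\<close>)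
      then show ?thesis by simp
    qed (use 1 in auto)
    then have "weighted_lower n k (raise_block n s \<eta>) = 0"
      unfolding expand by (rule sum.neutral[OF ballI])
    then show ?thesis using 1 by simp
  next
    case 2
    have Z: "Z j = \<eta> (rho_expo (2 * n))" for j by (simp add: Z_def 2)
    have "(\<Sum>j\<in>block n. ((if j + s \<le> 2 * n + k then w j else 0) - (if j + s \<le> 2 * n then w (j + s) else 0))) =
        (\<Sum>j\<in>block n. w j) - (\<Sum>j\<in>block n. if j + s \<le> 2 * n then w (j + s) else 0)"
      unfolding sum_subtractf by (intro arg_cong2[of _ _ _ _ "(-)"] sum.cong) (auto simp: 2 block_def)
    also have "(\<Sum>j\<in>block n. w j) = (\<Sum>i<n. q_par ^ i)"
      unfolding w_def by (rule sum_block_reindex)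
    also have "(\<Sum>j\<in>block n. if j + s \<le> 2 * n then w (j + s) else 0) =
        (\<Sum>j\<in>{j\<in>block n. j + s \<le> 2 * n}. w (j + s))"
      by (simp add: sum.inter_filter)
    also have "\<dots> = (\<Sum>i<n - s. q_par ^ i)"
      unfolding w_def
      by (rule sum.reindex_bij_witness[of _ "\<lambda>i. 2 * n - s - i" "\<lambda>j. 2 * n - s - j"])
        (use k 2 in \<open>auto simp: block_def add.commute\<close>)
    finally show ?thesis
      using vq_resid[of s n] 2 k unfolding expand Z
      by (simp flip: sum_distrib_right)
  next
    case 3
    have "((if j + s \<le> 2 * n + k then w j else 0) - (if j + s \<le> 2 * n then w (j + s) else 0)) * Z j =
        vq s * (w j * \<eta> (rho_expo (2 * n) - expo j (int (k - s))))"
      if j: "j \<in> block n" for j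
    proof -
      have Z: "Z j = \<eta> (rho_expo (2 * n) - expo j (int (k - s)))"
      proof -
        have "rho_expo (2 * n) + expo j (int s) - expo j (int k) = rho_expo (2 * n) - expo j (int (k - s))"
          by (rule poly_mapping_eqI) (use 3 in \<open>auto simp: lookup_add lookup_minus lookup_single when_def\<close>)
        then show ?thesis by (simp only: Z_def)
      qed
      have c1: "j + s \<le> 2 * n + k" using j 3 by (auto simp: block_def)
      show ?thesis
      proof (cases "j + s \<le> 2 * n")
        case True
        then show ?thesis using c1 w_shift[OF True] by (simp add: Z algebra_simps)
      next
        case False
        have "j - (k - s) \<in> block n" using j False 3 k by (auto simp: block_def)
        then have "\<eta> (rho_expo (2 * n) - expo j (int (k - s))) = 0"
          by (rule alternating_collision[OF alt j])
            (use 3 j False k in \<open>auto simp: lookup_add lookup_minus lookup_single when_def lookup_rho block_def\<close>)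
        then show ?thesis using Z by simp
      qed
    qed
    then show ?thesis using 3 unfolding expand
      by (simp add: weighted_lower_def w_def sum_distrib_left)
  qed
qed

text \<open>All sublists with their complements, counted with multiplicity: the terms of an expanded
  product of binomials.\<close>

fun splits :: "'a list \<Rightarrow> ('a list \<times> 'a list) list" where
  "splits [] = [([], [])]"
| "splits (x # xs) = map (\<lambda>(a, b). (x # a, b)) (splits xs) @ map (\<lambda>(a, b). (a, x # b)) (splits xs)"

text \<open>The parts in \<open>a\<close> are absorbed by the weighted lowering operator, each with
  a factor \<open>vq\<close>; those in \<open>b\<close> are contracted with
  \<open>\<pi>\<close>.\<close>

definition split_pairing :: "nat list \<Rightarrow> nat list \<Rightarrow> nat \<Rightarrow> qtfield" where
  "split_pairing \<sigma> \<pi> k = (\<Sum>(a, b)\<leftarrow>splits \<sigma>.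
     if sum_list a = k then (\<Prod>s\<leftarrow>a. vq s) * of_nat (pairing b \<pi>) else 0)"

lemma split_pairing_Nil: "split_pairing [] \<pi> k = (if k = 0 \<and> \<pi> = [] then 1 else 0)"
  by (auto simp: split_pairing_def)

lemma split_pairing_Cons:
  "split_pairing (s # \<sigma>) \<pi> k = (if s \<le> k then vq s * split_pairing \<sigma> \<pi> (k - s) else 0) +
     of_nat (s * count_list \<pi> s) * split_pairing \<sigma> (remove1 s \<pi>) k"
proof -
  have 1: "(\<Sum>(a, b)\<leftarrow>map (\<lambda>(a, b). (s # a, b)) xs.
        if sum_list a = k then (\<Prod>s\<leftarrow>a. vq s) * of_nat (pairing b \<pi>) else 0) =
      (if s \<le> k then vq s * (\<Sum>(a, b)\<leftarrow>xs. if sum_list a = k - s then (\<Prod>s\<leftarrow>a. vq s) * of_nat (pairing b \<pi>) else 0) else 0)"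
    for xs :: "(nat list \<times> nat list) list"
    by (induction xs) (auto simp: algebra_simps)
  have 2: "(\<Sum>(a, b)\<leftarrow>map (\<lambda>(a, b). (a, s # b)) xs.
        if sum_list a = k then (\<Prod>s\<leftarrow>a. vq s) * of_nat (pairing b \<pi>) else 0) =
      of_nat (s * count_list \<pi> s) * (\<Sum>(a, b)\<leftarrow>xs. if sum_list a = k then (\<Prod>s\<leftarrow>a. vq s) * of_nat (pairing b (remove1 s \<pi>)) else 0)"
    for xs :: "(nat list \<times> nat list) list"
    by (induction xs) (auto simp: algebra_simps)
  show ?thesis
    unfolding split_pairing_def splits.simps map_append sum_list_append 1 2 ..
qed

text \<open>In degree 0 the true weighted sum has the coefficient 1 + q + ... + q^(n-1). Here
  \<open>resid n\<close> takes its place, so that the recursion is uniform in \<open>k\<close>;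
  \<open>wform_power_sum\<close> puts the difference back.\<close>

definition weighted_expect :: "nat \<Rightarrow> nat \<Rightarrow> nat list \<Rightarrow> nat list \<Rightarrow> qtfield" where
  "weighted_expect n k \<pi> \<sigma> = (if k = 0 then resid n * lowers n \<pi> (raised_vac n \<sigma>) (rho_expo (2 * n))
     else weighted_lower n k (lowers n \<pi> (raised_vac n \<sigma>)))"

lemma weighted_expect_eq:
  assumes "0 \<notin> set \<sigma>" "0 \<notin> set \<pi>" "sum_list \<sigma> \<le> n" "k \<le> n"
  shows "weighted_expect n k \<pi> \<sigma> = resid n * split_pairing \<sigma> \<pi> k"
  using assms
proof (induction \<sigma> arbitrary: \<pi> k)
  case Nil
  show ?case
  proof (cases "k = 0")
    case True
    then show ?thesis using lowers_raised_vac[of "[]" \<pi> n] Nil.prems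
      by (simp add: weighted_expect_def split_pairing_Nil)
  next
    case False
    then show ?thesis using lowers_vac_rho[of k \<pi> _ n]
      by (simp add: weighted_expect_def split_pairing_Nil weighted_lower_def)
  qed
next
  case (Cons s \<sigma>)
  then have s: "s > 0" "sum_list \<sigma> \<le> n" "0 \<notin> set \<sigma>" by auto
  note pos = set_remove1_pos[OF Cons.prems(2)]
  have "weighted_expect n k \<pi> (s # \<sigma>) = (if s \<le> k then vq s * weighted_expect n (k - s) \<pi> \<sigma> else 0) +
      of_nat (s * count_list \<pi> s) * weighted_expect n k (remove1 s \<pi>) \<sigma>"
  proof (cases "k = 0")
    case True
    have "lowers n \<pi> (raised_vac n (s # \<sigma>)) (rho_expo (2 * n)) =
        of_nat (s * count_list \<pi> s) * lowers n (remove1 s \<pi>) (raised_vac n \<sigma>) (rho_expo (2 * n))"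
      using lowers_raised_vac[of "s # \<sigma>" \<pi> n] lowers_raised_vac[of \<sigma> "remove1 s \<pi>" n] Cons.prems s pos
      by simp
    then show ?thesis using True s(1) by (simp add: weighted_expect_def del: foldr_Cons)
  next
    case False
    have "weighted_lower n k (lowers n \<pi> (raised_vac n (s # \<sigma>))) =
        weighted_lower n k (raise_block n s (lowers n \<pi> (raised_vac n \<sigma>))) +
        of_nat (s * count_list \<pi> s) * weighted_lower n k (lowers n (remove1 s \<pi>) (raised_vac n \<sigma>))"
    proof -
      have "lowers n \<pi> (raised_vac n (s # \<sigma>)) (rho_expo (2 * n) - expo i (int k)) =
          raise_block n s (lowers n \<pi> (raised_vac n \<sigma>)) (rho_expo (2 * n) - expo i (int k)) +
          of_nat (s * count_list \<pi> s) * lowers n (remove1 s \<pi>) (raised_vac n \<sigma>) (rho_expo (2 * n) - expo i (int k))" for i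
      proof (rule lowers_raised_vac_step)
        fix j assume "j \<in> block n"
        then show "lookup (rho_expo (2 * n) - expo i (int k)) j < 2 * int n"
          using rho_below[of j n] by (auto simp: lookup_minus lookup_single when_def)
      qed (use Cons.prems in auto)
      then show ?thesis
        unfolding weighted_lower_def by (simp only: sum.distrib sum_distrib_left distrib_left mult.left_commute)
    qed
    moreover have "weighted_lower n k (raise_block n s (lowers n \<pi> (raised_vac n \<sigma>))) =
        (if s \<le> k then vq s * weighted_expect n (k - s) \<pi> \<sigma> else 0)"
      using weighted_lower_raise[OF alternating_foldr_lower[OF alternating_raised_vac], of s k n \<pi> \<sigma>]
        s(1) False Cons.prems(4) by (auto simp: weighted_expect_def)
    ultimately show ?thesis using False by (simp add: weighted_expect_def del: foldr_Cons)
  qed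
  also have "\<dots> = resid n * split_pairing (s # \<sigma>) \<pi> k"
    using Cons.IH[of \<pi> "k - s"] Cons.IH[of "remove1 s \<pi>" k] Cons.prems s pos
    by (simp add: split_pairing_Cons algebra_simps)
  finally show ?case .
qed

section \<open>Power sums\<close>

lemma power_sum_Nil: "power_sum n [] = 1"
  and power_sum_Cons: "power_sum n (r # \<rho>) = (\<Sum>i=1..n. var i ^ r) * power_sum n \<rho>"
  by (simp_all add: power_sum_def)

lemma lin_one: "lin \<Phi> 1 = \<Phi> 0"
  by (simp flip: single_one)

lemma lin_power_sum_Cons:
  "lin \<Phi> (power_sum n (r # \<rho>)) = (\<Sum>i=1..n. lin (\<lambda>k. \<Phi> (expo i (int r) + k)) (power_sum n \<rho>))"
  by (simp add: power_sum_Cons sum_distrib_right lin_sum var_power lin_mon_mult)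

abbreviation altq :: "nat \<Rightarrow> state \<Rightarrow> qtfield" where
  "altq n c \<equiv> of_int (alt_sign (2 * n) c)"

lemma alternating_altq: "alternating {1..2 * n} (altq n)"
  unfolding alternating_def using alt_sign_transpose by auto

text \<open>A power sum in all variables is symmetric and comes out of the divided differences,
  leaving a monomial of too low a degree. On exponents: distinct nonnegative entries cannot have a
  sum that is \<open>s\<close> below that of \<open>rho_expo\<close>.\<close>

lemma raise_altq_eq_0:
  assumes s: "s > 0" and c: "\<And>i. i \<in> {1..2 * n} \<Longrightarrow> 0 \<le> lookup c i"
  shows "raise {1..2 * n} M s (altq n) c = 0"
proof (cases "inj_on (lookup c) {1..2 * n}")
  case False
  then show ?thesis using alternating_inj[OF alternating_raise[OF alternating_altq]] by blast
next
  case inj: True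
  show ?thesis unfolding raise_def
  proof (intro sum.neutral ballI)
    fix i assume i: "i \<in> {1..2 * n}"
    have "alt_sign (2 * n) (c + expo i (int s)) = 0"
    proof (rule ccontr)
      assume nz: "alt_sign (2 * n) (c + expo i (int s)) \<noteq> 0"
      have sum: "(\<Sum>j=1..2*n. lookup c j) + int s = (\<Sum>j=1..2*n. int j - 1)"
        using sum_lookup_perm_rho[OF nz] sum_lookup_expo[OF _ i, of "int s"]
        by (simp add: lookup_add sum.distrib)
      have "lookup c j = 0" if j: "j \<notin> {1..2 * n}" for j
      proof -
        have "j \<noteq> i" using i j by blast
        then show ?thesis using alt_sign_support(3)[OF nz j] by (simp add: lookup_add lookup_single)
      qed
      then obtain \<pi> where "\<pi> permutes {1..2 * n}" "c = perm_expo \<pi> (rho_expo (2 * n))"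
        using perm_rho_if_small_sum[OF c inj] sum by auto
      then have "alt_sign (2 * n) c \<noteq> 0" using alt_sign_perm by simp
      from sum_lookup_perm_rho[OF this] sum s show False by simp
    qed
    then show "(if lookup c i + int s < M then altq n (c + expo i (int s)) else 0) = 0" by simp
  qed
qed

text \<open>If both operators hit the same particle, the two bounds together amount to the one on
  its final position, as the shifts are nonnegative.\<close>

lemma raise_commute: "raise I M s (raise J M s' \<eta>) = raise J M s' (raise I M s \<eta>)"
proof
  fix c
  have "raise I M s (raise J M s' \<eta>) c = (\<Sum>i\<in>I. \<Sum>j\<in>J.
      if lookup c i + int s < M \<and> lookup (c + expo i (int s)) j + int s' < M
      then \<eta> (c + expo i (int s) + expo j (int s')) else 0)"
    by (auto simp: raise_def intro!: sum.cong)
  also have "\<dots> = (\<Sum>i\<in>I. \<Sum>j\<in>J.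
      if lookup c j + int s' < M \<and> lookup (c + expo j (int s')) i + int s < M
      then \<eta> (c + expo j (int s') + expo i (int s)) else 0)"
    by (intro sum.cong refl if_cong) (auto simp: lookup_add lookup_single when_def algebra_simps)
  also have "\<dots> = raise J M s' (raise I M s \<eta>) c"
    by (subst sum.swap) (auto simp: raise_def intro!: sum.cong)
  finally show "raise I M s (raise J M s' \<eta>) c = raise J M s' (raise I M s \<eta>) c" .
qed

lemma foldr_raise_commute:
  "foldr (raise I M) \<sigma> (raise J M s \<eta>) = raise J M s (foldr (raise I M) \<sigma> \<eta>)"
  by (induction \<sigma>) (simp_all add: raise_commute[of I])

lemma raise_cong:
  "(\<And>i. i \<in> I \<Longrightarrow> \<eta> (c + expo i (int s)) = \<eta>' (c + expo i (int s))) \<Longrightarrow>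
    raise I M s \<eta> c = raise I M s \<eta>' c"
  unfolding raise_def by (intro sum.cong refl if_cong)

lemma lower_cong:
  "(\<And>i. i \<in> I \<Longrightarrow> \<eta> (c - expo i (int s)) = \<eta>' (c - expo i (int s))) \<Longrightarrow>
    lower I s \<eta> c = lower I s \<eta>' c"
  unfolding lower_def by (rule sum.cong[OF refl])

lemma foldr_raise_cong:
  assumes "\<And>c. (\<And>i. i \<in> A \<Longrightarrow> 0 \<le> lookup c i) \<Longrightarrow> \<eta> c = \<eta>' c" "\<And>i. i \<in> A \<Longrightarrow> 0 \<le> lookup c i"
  shows "foldr (raise I M) \<sigma> \<eta> c = foldr (raise I M) \<sigma> \<eta>' c"
  using assms(2)
proof (induction \<sigma> arbitrary: c)
  case (Cons s \<sigma>)
  have "foldr (raise I M) \<sigma> \<eta> (c + expo i (int s)) = foldr (raise I M) \<sigma> \<eta>' (c + expo i (int s))" for i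
    by (rule Cons.IH) (use Cons.prems in \<open>auto simp: lookup_add lookup_single when_def\<close>)
  then show ?case by (auto intro!: raise_cong)
qed (simp add: assms(1))

lemma raise_mult: "raise I M s (\<lambda>c. x * \<eta> c) c = x * raise I M s \<eta> c"
  unfolding raise_def sum_distrib_left by (rule sum.cong) auto

lemma raise_zero: "raise I M s (\<lambda>c. 0) = (\<lambda>c. 0)"
  by (simp add: raise_def fun_eq_iff)

lemma foldr_raise_zero: "foldr (raise I M) \<sigma> (\<lambda>c. 0) = (\<lambda>c. 0)"
  by (induction \<sigma>) (simp_all add: raise_zero)

text \<open>Raising over all positions gives zero, so raising over the first half is minus raising
  over the second. Commutativity brings the operator over all positions next to
  \<open>altq n\<close>, where \<open>raise_altq_eq_0\<close> applies.\<close>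

lemma foldr_raise_flip:
  assumes "0 \<notin> set \<sigma>" "\<And>i. i \<in> {1..2 * n} \<Longrightarrow> 0 \<le> lookup c i"
  shows "foldr (raise {1..n} M) \<sigma> (altq n) c =
    (-1) ^ length \<sigma> * foldr (raise (block n) M) \<sigma> (altq n) c"
  using assms
proof (induction \<sigma> arbitrary: c)
  case (Cons s \<sigma>)
  let ?X = "foldr (raise {1..n} M) \<sigma> (altq n)"
  have split: "raise {1..2 * n} M s \<eta> c = raise {1..n} M s \<eta> c + raise (block n) M s \<eta> c" for \<eta>
    unfolding raise_def block_def
    by (subst sum.union_disjoint[symmetric]) (auto intro!: sum.cong)
  have "raise {1..2 * n} M s ?X c = foldr (raise {1..n} M) \<sigma> (raise {1..2 * n} M s (altq n)) c"
    by (simp only: foldr_raise_commute)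
  also have "\<dots> = foldr (raise {1..n} M) \<sigma> (\<lambda>c. 0) c"
    by (rule foldr_raise_cong[where A = "{1..2 * n}"]) (use Cons.prems raise_altq_eq_0 in auto)
  finally have "raise {1..n} M s ?X c = - raise (block n) M s ?X c"
    using split[of ?X] by (simp add: foldr_raise_zero eq_neg_iff_add_eq_0)
  also have "raise (block n) M s ?X c =
      raise (block n) M s (\<lambda>c. (-1) ^ length \<sigma> * foldr (raise (block n) M) \<sigma> (altq n) c) c"
  proof (rule raise_cong)
    fix i
    show "?X (c + expo i (int s)) = (-1) ^ length \<sigma> * foldr (raise (block n) M) \<sigma> (altq n) (c + expo i (int s))"
      by (rule Cons.IH) (use Cons.prems in \<open>auto simp: lookup_add lookup_single when_def\<close>)
  qed
  also have "\<dots> = (-1) ^ length \<sigma> * raise (block n) M s (foldr (raise (block n) M) \<sigma> (altq n)) c"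
    by (rule raise_mult)
  finally show ?case by simp
qed simp

text \<open>Raising never decreases an exponent, and \<open>alt_sign\<close> vanishes once an
  exponent is \<open>2 * n\<close> or more.\<close>

lemma foldr_raise_beyond:
  assumes "i \<in> {1..2 * n}" "lookup c i \<ge> 2 * int n"
  shows "foldr (raise I M) \<sigma> (altq n) c = 0"
  using assms(2)
proof (induction \<sigma> arbitrary: c)
  case Nil
  have "alt_sign (2 * n) c = 0"
  proof (rule ccontr)
    assume "alt_sign (2 * n) c \<noteq> 0"
    from alt_sign_support(2)[OF this] have "lookup c i \<in> {0..<int (2 * n)}" using assms(1) by blast
    then show False using Nil by simp
  qed
  then show ?case by simp
next
  case (Cons s \<sigma>)
  have "foldr (raise I M) \<sigma> (altq n) (c + expo j (int s)) = 0" for j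
    by (rule Cons.IH) (use Cons.prems in \<open>auto simp: lookup_add lookup_single when_def\<close>)
  then have "raise I M s (foldr (raise I M) \<sigma> (altq n)) c = raise I M s (\<lambda>c. 0) c"
    by (intro raise_cong)
  then show ?case by (simp add: raise_zero)
qed

text \<open>For nonnegative exponents in the degree of \<open>rho_expo\<close> this is the maximal
  divided difference of \<open>xmon c * f\<close>, up to \<open>omega_sign (2 * n)\<close>.\<close>

definition alt_kernel :: "nat \<Rightarrow> laurent \<Rightarrow> state \<Rightarrow> qtfield" where
  "alt_kernel n f c = lin (\<lambda>\<beta>. altq n (c + \<beta>)) f"

lemma alt_kernel_power_sum_raise:
  "alt_kernel n (power_sum n \<sigma>) c = foldr (raise {1..n} (2 * int n)) \<sigma> (altq n) c"
proof (induction \<sigma> arbitrary: c)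
  case Nil
  then show ?case by (simp add: alt_kernel_def power_sum_Nil lin_one)
next
  case (Cons s \<sigma>)
  have "alt_kernel n (power_sum n (s # \<sigma>)) c = (\<Sum>i=1..n. alt_kernel n (power_sum n \<sigma>) (c + expo i (int s)))"
    by (simp add: alt_kernel_def lin_power_sum_Cons add.assoc)
  also have "\<dots> = (\<Sum>i=1..n. if lookup c i + int s < 2 * int n
      then foldr (raise {1..n} (2 * int n)) \<sigma> (altq n) (c + expo i (int s)) else 0)"
    unfolding Cons.IH
  proof (intro sum.cong refl)
    fix i assume i: "i \<in> {1..n}"
    show "foldr (raise {1..n} (2 * int n)) \<sigma> (altq n) (c + expo i (int s)) =
      (if lookup c i + int s < 2 * int n then foldr (raise {1..n} (2 * int n)) \<sigma> (altq n) (c + expo i (int s)) else 0)"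
      using foldr_raise_beyond[of i n "c + expo i (int s)" "{1..n}" "2 * int n" \<sigma>] i
      by (auto simp: lookup_add)
  qed
  also have "\<dots> = foldr (raise {1..n} (2 * int n)) (s # \<sigma>) (altq n) c"
    unfolding foldr_Cons comp_apply by (rule raise_def[symmetric])
  finally show ?case .
qed

definition good_state :: "nat \<Rightarrow> nat \<Rightarrow> state \<Rightarrow> bool" where
  "good_state n m c \<longleftrightarrow> (\<forall>i. i \<notin> block n \<longrightarrow> lookup c i = lookup (rho_expo (2 * n)) i) \<and>
     (\<forall>i\<in>block n. int m \<le> lookup c i)"

lemma foldr_raise_altq_vac:
  assumes "good_state n 0 c"
  shows "foldr (raise_block n) \<sigma> (altq n) c = raised_vac n \<sigma> c"
  using assms
proof (induction \<sigma> arbitrary: c)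
  case Nil
  then show ?case by (simp add: vac_def good_state_def)
next
  case (Cons s \<sigma>)
  have "good_state n 0 (c + expo i (int s))" if "i \<in> block n" for i
    using Cons.prems that by (auto simp: good_state_def lookup_add lookup_single when_def)
  then show ?case unfolding foldr_Cons comp_apply by (intro raise_cong Cons.IH)
qed

lemma alt_kernel_power_sum:
  assumes "0 \<notin> set \<sigma>" "good_state n 0 c"
  shows "alt_kernel n (power_sum n \<sigma>) c = (-1) ^ length \<sigma> * raised_vac n \<sigma> c"
proof -
  have "0 \<le> lookup c i" if "i \<in> {1..2 * n}" for i
    using assms(2) that by (cases "i \<in> block n") (auto simp: good_state_def lookup_rho)
  from foldr_raise_flip[OF assms(1) this] show ?thesis
    by (simp add: alt_kernel_power_sum_raise foldr_raise_altq_vac[OF assms(2)])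
qed

lemma lowers_cong:
  assumes "\<And>c. good_state n 0 c \<Longrightarrow> \<eta> c = \<eta>' c" "good_state n (sum_list \<pi>) c"
  shows "lowers n \<pi> \<eta> c = lowers n \<pi> \<eta>' c"
  using assms(2)
proof (induction \<pi> arbitrary: c)
  case (Cons r \<pi>)
  have "good_state n (sum_list \<pi>) (c - expo i (int r))" if "i \<in> block n" for i
    using Cons.prems that by (force simp: good_state_def lookup_minus lookup_single when_def)
  then show ?case unfolding foldr_Cons comp_apply by (intro lower_cong Cons.IH)
qed (simp add: assms(1))

section \<open>Power sums in the left argument and the weights of \<open>tq_size\<close>\<close>

definition shift :: "nat \<Rightarrow> state \<Rightarrow> state" where
  "shift n \<alpha> = fexp (block n) (\<lambda>i. lookup \<alpha> (i - n))"

lemma lookup_shift: "lookup (shift n \<alpha>) i = (if i \<in> block n then lookup \<alpha> (i - n) else 0)"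
  by (simp add: shift_def lookup_fexp)

lemma shift_0: "shift n 0 = 0"
  by (rule poly_mapping_eqI) (simp add: lookup_shift)

lemma shift_add: "shift n (\<alpha> + \<beta>) = shift n \<alpha> + shift n \<beta>"
  by (rule poly_mapping_eqI) (simp add: lookup_shift lookup_add)

lemma shift_expo: "j \<in> {1..n} \<Longrightarrow> shift n (expo j m) = expo (n + j) m"
  by (rule poly_mapping_eqI) (auto simp: lookup_shift lookup_single when_def block_def)

lemma lower_block_reindex: "lower (block n) r \<eta> c = (\<Sum>j=1..n. \<eta> (c - expo (n + j) (int r)))"
  unfolding lower_def
  by (rule sum.reindex_bij_witness[of _ "\<lambda>j. n + j" "\<lambda>i. i - n"]) (auto simp: block_def)

lemma lin_lower: "lin (\<lambda>\<alpha>. \<Psi> (c - shift n \<alpha>)) (power_sum n \<rho>) = lowers n \<rho> \<Psi> c"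
proof (induction \<rho> arbitrary: c)
  case Nil
  then show ?case by (simp add: power_sum_Nil lin_one shift_0)
next
  case (Cons r \<rho>)
  then show ?case
    by (simp add: lin_power_sum_Cons shift_add shift_expo lower_block_reindex diff_diff_eq[symmetric])
qed

abbreviation ut :: "nat \<Rightarrow> qtfield" where
  "ut s \<equiv> t_par ^ s - 1"

text \<open>The weight is the substitution x_i -> t x_i, which replaces each factor p_r by p_r +
  (t^r - 1) x_i^r. The list \<open>a\<close> collects the factors in which the second summand is
  chosen.\<close>

lemma lin_weighted_lower:
  assumes i: "i \<in> {1..n}"
  shows "lin (\<lambda>\<alpha>. t_par powi lookup \<alpha> i * \<Psi> (c - shift n \<alpha>)) (power_sum n \<rho>) =
    (\<Sum>(a, b)\<leftarrow>splits \<rho>. (\<Prod>s\<leftarrow>a. ut s) * lowers n b \<Psi> (c - expo (n + i) (int (sum_list a))))"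
proof (induction \<rho> arbitrary: c)
  case Nil
  then show ?case by (simp add: power_sum_Nil lin_one shift_0)
next
  case (Cons r \<rho>)
  define T where "T j = (if i = j then t_par ^ r else 1)" for j
  have "lin (\<lambda>\<alpha>. t_par powi lookup \<alpha> i * \<Psi> (c - shift n \<alpha>)) (power_sum n (r # \<rho>)) =
      (\<Sum>j=1..n. lin (\<lambda>\<alpha>. T j * (t_par powi lookup \<alpha> i * \<Psi> (c - expo (n + j) (int r) - shift n \<alpha>))) (power_sum n \<rho>))"
    unfolding lin_power_sum_Cons
  proof (intro sum.cong refl arg_cong2[of _ _ _ _ lin] ext)
    fix j \<alpha> assume j: "j \<in> {1..n}"
    have "t_par powi (lookup (expo j (int r) + \<alpha>) i) = T j * t_par powi lookup \<alpha> i"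
      using t_par_nonzero by (auto simp: lookup_add lookup_single when_def T_def power_int_add)
    then show "t_par powi lookup (expo j (int r) + \<alpha>) i * \<Psi> (c - shift n (expo j (int r) + \<alpha>)) =
        T j * (t_par powi lookup \<alpha> i * \<Psi> (c - expo (n + j) (int r) - shift n \<alpha>))"
      using j by (simp add: shift_add shift_expo diff_diff_eq)
  qed
  also have "\<dots> = (\<Sum>j=1..n. T j * (\<Sum>(a, b)\<leftarrow>splits \<rho>. (\<Prod>s\<leftarrow>a. ut s) *
      lowers n b \<Psi> (c - expo (n + j) (int r) - expo (n + i) (int (sum_list a)))))"
    by (simp only: lin_fun_mult Cons.IH)
  also have "\<dots> = (\<Sum>(a, b)\<leftarrow>splits (r # \<rho>). (\<Prod>s\<leftarrow>a. ut s) * lowers n b \<Psi> (c - expo (n + i) (int (sum_list a))))"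
  proof -
    have term_eq: "(\<Sum>j=1..n. T j * F (c - expo (n + j) (int r) - expo (n + i) m)) =
        ut r * F (c - expo (n + i) (int r + m)) + lower (block n) r F (c - expo (n + i) m)" for F :: "state \<Rightarrow> qtfield" and m
    proof -
      have "T j * F (c - expo (n + j) (int r) - expo (n + i) m) =
          (if i = j then ut r * F (c - expo (n + i) (int r + m)) else 0) +
          F (c - expo (n + i) m - expo (n + j) (int r))" for j
        by (simp add: T_def single_add algebra_simps)
      then show ?thesis using i
        by (simp only: sum.distrib lower_block_reindex) simp
    qed
    have "(\<Sum>j=1..n. T j * (\<Sum>(a, b)\<leftarrow>xs. (\<Prod>s\<leftarrow>a. ut s) *
        lowers n b \<Psi> (c - expo (n + j) (int r) - expo (n + i) (int (sum_list a))))) =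
      (\<Sum>(a, b)\<leftarrow>map (\<lambda>(a, b). (r # a, b)) xs @ map (\<lambda>(a, b). (a, r # b)) xs.
        (\<Prod>s\<leftarrow>a. ut s) * lowers n b \<Psi> (c - expo (n + i) (int (sum_list a))))"
      for xs :: "(nat list \<times> nat list) list"
    proof (induction xs)
      case (Cons x xs)
      obtain a b where x: "x = (a, b)" by (cases x)
      have "(\<Sum>j=1..n. T j * ((\<Prod>s\<leftarrow>a. ut s) * lowers n b \<Psi> (c - expo (n + j) (int r) - expo (n + i) (int (sum_list a))))) =
          (\<Prod>s\<leftarrow>a. ut s) * (ut r * lowers n b \<Psi> (c - expo (n + i) (int r + int (sum_list a))) +
            lower (block n) r (lowers n b \<Psi>) (c - expo (n + i) (int (sum_list a))))"
        unfolding term_eq[symmetric] sum_distrib_left by (simp only: mult.left_commute)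
      then show ?case using Cons
        by (simp add: x distrib_left sum.distrib algebra_simps)
    qed simp
    then show ?thesis by simp
  qed
  finally show ?case .
qed

lemma splits_sum_list:
  "(a, b) \<in> set (splits \<rho>) \<Longrightarrow> sum_list a + sum_list b = (sum_list \<rho> :: nat)"
  by (induction \<rho> arbitrary: a b) fastforce+

lemma splits_set: "(a, b) \<in> set (splits \<rho>) \<Longrightarrow> set a \<subseteq> set \<rho> \<and> set b \<subseteq> set \<rho>"
  by (induction \<rho> arbitrary: a b) fastforce+

lemma splits_sum_0:
  assumes "0 \<notin> set (\<rho> :: nat list)"
  shows "(\<Sum>(a, b)\<leftarrow>splits \<rho>. if sum_list a = 0 then g a b else 0) = (g [] \<rho> :: 'a :: comm_monoid_add)"
  using assms
proof (induction \<rho> arbitrary: g)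
  case (Cons r \<rho>)
  have r: "r \<noteq> 0" using Cons.prems by auto
  have "(\<Sum>(a, b)\<leftarrow>map (\<lambda>(a, b). (r # a, b)) xs. if sum_list a = 0 then g a b else 0) = 0" for xs
    by (induction xs) (auto simp: r)
  moreover have "(\<Sum>(a, b)\<leftarrow>map (\<lambda>(a, b). (a, r # b)) xs. if sum_list a = 0 then g a b else 0) =
      (\<Sum>(a, b)\<leftarrow>xs. if sum_list a = 0 then g a (r # b) else 0)" for xs
    by (induction xs) auto
  ultimately show ?case using Cons by simp
qed simp

text \<open>
  Up to sign, \<open>form\<close> is the Hall pairing \<open>\<langle>g, \<omega> f\<rangle>\<close> and \<open>wform\<close> is \<open>\<langle>D g, \<omega> f\<rangle>\<close>.
\<close>

definition form :: "nat \<Rightarrow> laurent \<Rightarrow> laurent \<Rightarrow> qtfield" where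
  "form n g f = lin (\<lambda>\<alpha>. alt_kernel n f (rho_expo (2 * n) - shift n \<alpha>)) g"

definition wform :: "nat \<Rightarrow> laurent \<Rightarrow> laurent \<Rightarrow> qtfield" where
  "wform n g f = (\<Sum>i=1..n. q_par ^ (n - i) *
     lin (\<lambda>\<alpha>. t_par powi lookup \<alpha> i * alt_kernel n f (rho_expo (2 * n) - shift n \<alpha>)) g)"

lemma good_state_rho: "i \<in> {1..n} \<Longrightarrow> k \<le> n \<Longrightarrow> good_state n (n - k) (rho_expo (2 * n) - expo (n + i) (int k))"
  by (auto simp: good_state_def lookup_minus lookup_rho lookup_single when_def block_def)

lemma good_state_mono: "good_state n m c \<Longrightarrow> m' \<le> m \<Longrightarrow> good_state n m' c"
  by (force simp: good_state_def)

lemma lowers_mult: "lowers n \<pi> (\<lambda>c. x * \<eta> c) c = x * lowers n \<pi> \<eta> c"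
  by (induction \<pi> arbitrary: c) (simp_all add: lower_def sum_distrib_left)

lemma form_power_sum:
  assumes "0 \<notin> set \<rho>" "0 \<notin> set \<sigma>" "sum_list \<rho> \<le> n" "sum_list \<sigma> \<le> n"
  shows "form n (power_sum n \<rho>) (power_sum n \<sigma>) = (-1) ^ length \<sigma> * of_nat (pairing \<sigma> \<rho>)"
proof -
  have "good_state n n (rho_expo (2 * n))"
    by (auto simp: good_state_def lookup_rho block_def)
  then have g: "good_state n (sum_list \<rho>) (rho_expo (2 * n))"
    using assms(3) by (rule good_state_mono)
  have "form n (power_sum n \<rho>) (power_sum n \<sigma>) = lowers n \<rho> (alt_kernel n (power_sum n \<sigma>)) (rho_expo (2 * n))"
    by (simp add: form_def lin_lower)
  also have "\<dots> = lowers n \<rho> (\<lambda>c. (-1) ^ length \<sigma> * raised_vac n \<sigma> c) (rho_expo (2 * n))"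
    by (rule lowers_cong[OF _ g]) (rule alt_kernel_power_sum[OF assms(2)])
  finally show ?thesis using lowers_raised_vac[OF assms(2,1,4)] by (simp add: lowers_mult)
qed

definition qsum :: "nat \<Rightarrow> qtfield" where
  "qsum n = (\<Sum>i<n. q_par ^ i)"

lemma sum_list_sum_swap:
  "(\<Sum>i\<in>A. w i * (\<Sum>(a, b)\<leftarrow>xs. h a b i)) = (\<Sum>(a, b)\<leftarrow>xs. \<Sum>i\<in>A. w i * (h a b i :: 'a :: comm_semiring_0))"
  by (induction xs) (auto simp: distrib_left sum.distrib)

lemma sum_list_pair_linear:
  "(\<Sum>(a, b)\<leftarrow>xs. x * f a b + x * (y * g a b)) =
    x * (\<Sum>(a, b)\<leftarrow>xs. f a b) + x * (y * (\<Sum>(a, b)\<leftarrow>xs. (g a b :: 'a :: comm_ring)))"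
  by (induction xs) (auto simp: algebra_simps)

text \<open>The substitution in t expands over the splits of \<open>\<rho>\<close>, the commutation
  with the q-weights over those of \<open>\<sigma>\<close>. The coefficient
  \<open>qsum n - resid n\<close> of the plain pairing equals 1/(1 - q), whatever \<open>n\<close>
  is.\<close>

lemma wform_power_sum:
  assumes "0 \<notin> set \<rho>" "0 \<notin> set \<sigma>" "sum_list \<rho> \<le> n" "sum_list \<sigma> \<le> n"
  shows "wform n (power_sum n \<rho>) (power_sum n \<sigma>) = (-1) ^ length \<sigma> *
    ((qsum n - resid n) * of_nat (pairing \<sigma> \<rho>) +
     resid n * (\<Sum>(a, b)\<leftarrow>splits \<rho>. (\<Prod>s\<leftarrow>a. ut s) * split_pairing \<sigma> b (sum_list a)))"
proof -
  let ?e = "(-1) ^ length \<sigma> :: qtfield"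
  have "wform n (power_sum n \<rho>) (power_sum n \<sigma>) = (\<Sum>i=1..n. q_par ^ (n - i) *
      (\<Sum>(a, b)\<leftarrow>splits \<rho>. (\<Prod>s\<leftarrow>a. ut s) *
        lowers n b (alt_kernel n (power_sum n \<sigma>)) (rho_expo (2 * n) - expo (n + i) (int (sum_list a)))))"
    unfolding wform_def by (intro sum.cong refl arg_cong2[of _ _ _ _ "(*)"] lin_weighted_lower)
  also have "\<dots> = (\<Sum>(a, b)\<leftarrow>splits \<rho>. \<Sum>i=1..n. q_par ^ (n - i) * ((\<Prod>s\<leftarrow>a. ut s) *
      lowers n b (alt_kernel n (power_sum n \<sigma>)) (rho_expo (2 * n) - expo (n + i) (int (sum_list a)))))"
    by (rule sum_list_sum_swap)
  also have "\<dots> = (\<Sum>(a, b)\<leftarrow>splits \<rho>. ?e * (if sum_list a = 0 then (\<Prod>s\<leftarrow>a. ut s) * ((qsum n - resid n) * of_nat (pairing \<sigma> b)) else 0) +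
      ?e * (resid n * ((\<Prod>s\<leftarrow>a. ut s) * split_pairing \<sigma> b (sum_list a))))"
  proof (intro arg_cong[of _ _ sum_list] map_cong refl, clarify)
    fix a b assume ab: "(a, b) \<in> set (splits \<rho>)"
    let ?u = "\<Prod>s\<leftarrow>a. ut s" and ?k = "sum_list a"
    have k: "?k + sum_list b \<le> n" "?k \<le> n" using splits_sum_list[OF ab] assms(3) by auto
    have b: "0 \<notin> set b" using splits_set[OF ab] assms(1) by auto
    have low: "lowers n b (alt_kernel n (power_sum n \<sigma>)) (rho_expo (2 * n) - expo (n + i) (int ?k)) =
        ?e * lowers n b (raised_vac n \<sigma>) (rho_expo (2 * n) - expo (n + i) (int ?k))" if i: "i \<in> {1..n}" for i
    proof -
      have "good_state n (sum_list b) (rho_expo (2 * n) - expo (n + i) (int ?k))"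
        using good_state_rho[OF i k(2)] by (rule good_state_mono) (use k in simp)
      from lowers_cong[OF alt_kernel_power_sum[OF assms(2)] this] show ?thesis by (simp add: lowers_mult)
    qed
    have "(\<Sum>i=1..n. q_par ^ (n - i) * (?u * lowers n b (alt_kernel n (power_sum n \<sigma>)) (rho_expo (2 * n) - expo (n + i) (int ?k)))) =
        (\<Sum>i=1..n. ?e * ?u * (q_par ^ (n - i) * lowers n b (raised_vac n \<sigma>) (rho_expo (2 * n) - expo (n + i) (int ?k))))"
    proof (rule sum.cong[OF refl])
      fix i assume i: "i \<in> {1..n}"
      show "q_par ^ (n - i) * (?u * lowers n b (alt_kernel n (power_sum n \<sigma>)) (rho_expo (2 * n) - expo (n + i) (int ?k))) =
        ?e * ?u * (q_par ^ (n - i) * lowers n b (raised_vac n \<sigma>) (rho_expo (2 * n) - expo (n + i) (int ?k)))"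
        unfolding low[OF i] by (simp only: mult_ac)
    qed
    also have "\<dots> = ?e * ?u * weighted_lower n ?k (lowers n b (raised_vac n \<sigma>))"
      unfolding sum_distrib_left[symmetric] weighted_lower_def
      by (intro arg_cong2[of _ _ _ _ "(*)"] refl sum.reindex_bij_witness[of _ "\<lambda>i. i - n" "\<lambda>i. n + i"])
        (auto simp: block_def)
    \<comment> \<open>For \<open>?k = 0\<close> the weights add up to \<open>qsum n\<close>, whereas
      \<open>weighted_expect\<close> puts \<open>resid n\<close>; the first summand is the
      correction.\<close>
    also have "weighted_lower n ?k (lowers n b (raised_vac n \<sigma>)) =
        (if ?k = 0 then (qsum n - resid n) * of_nat (pairing \<sigma> b) else 0) + resid n * split_pairing \<sigma> b ?k"
    proof (cases "?k = 0")
      case True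
      have "weighted_lower n 0 \<eta> = qsum n * \<eta> (rho_expo (2 * n))" for \<eta>
        unfolding weighted_lower_def qsum_def sum_block_reindex[symmetric] by (simp add: sum_distrib_right)
      then have "weighted_lower n ?k (lowers n b (raised_vac n \<sigma>)) = qsum n * of_nat (pairing \<sigma> b)"
        by (simp only: True lowers_raised_vac[OF assms(2) b assms(4)])
      moreover have "resid n * of_nat (pairing \<sigma> b) = resid n * split_pairing \<sigma> b ?k"
        using weighted_expect_eq[OF assms(2) b assms(4) k(2)] lowers_raised_vac[OF assms(2) b assms(4)]
        unfolding weighted_expect_def True by simp
      ultimately show ?thesis using True by (simp only: if_True left_diff_distrib) simp
    next
      case False
      then show ?thesis using weighted_expect_eq[OF assms(2) b assms(4) k(2)]
        by (simp add: weighted_expect_def del: sum_list_eq_0_iff)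
    qed
    finally show "(\<Sum>i=1..n. q_par ^ (n - i) * (?u * lowers n b (alt_kernel n (power_sum n \<sigma>)) (rho_expo (2 * n) - expo (n + i) (int ?k)))) =
       ?e * (if ?k = 0 then ?u * ((qsum n - resid n) * of_nat (pairing \<sigma> b)) else 0) +
       ?e * (resid n * (?u * split_pairing \<sigma> b ?k))"
      by (auto simp: algebra_simps)
  qed
  also have "\<dots> = ?e * (\<Sum>(a, b)\<leftarrow>splits \<rho>. if sum_list a = 0 then (\<Prod>s\<leftarrow>a. ut s) * ((qsum n - resid n) * of_nat (pairing \<sigma> b)) else 0) +
      ?e * (resid n * (\<Sum>(a, b)\<leftarrow>splits \<rho>. (\<Prod>s\<leftarrow>a. ut s) * split_pairing \<sigma> b (sum_list a)))"
    by (rule sum_list_pair_linear)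
  finally show ?thesis unfolding splits_sum_0[OF assms(1)] by (simp add: distrib_left)
qed

section \<open>Symmetry of the forms on power sums\<close>

text \<open>The usual \<open>z_\<rho>\<close>, the order of the centraliser of a permutation of
  cycle type \<open>\<rho>\<close>.\<close>

definition zlist :: "nat list \<Rightarrow> nat" where
  "zlist \<rho> = (\<Prod>k\<in>set \<rho>. k ^ count_list \<rho> k * fact (count_list \<rho> k))"

lemma zlist_Cons: "zlist (s # \<sigma>) = s * Suc (count_list \<sigma> s) * zlist \<sigma>"
proof -
  let ?f = "\<lambda>\<rho> k. k ^ count_list \<rho> k * fact (count_list \<rho> k) :: nat"
  have eq: "(\<Prod>k\<in>set \<sigma> - {s}. ?f (s # \<sigma>) k) = (\<Prod>k\<in>set \<sigma> - {s}. ?f \<sigma> k)"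
    by (rule prod.cong) auto
  have "zlist (s # \<sigma>) = ?f (s # \<sigma>) s * (\<Prod>k\<in>set \<sigma> - {s}. ?f \<sigma> k)"
    unfolding zlist_def list.set(2) prod.insert_remove[OF finite_set] eq ..
  also have "\<dots> = s * Suc (count_list \<sigma> s) * (?f \<sigma> s * (\<Prod>k\<in>set \<sigma> - {s}. ?f \<sigma> k))"
    by (simp add: algebra_simps)
  also have "?f \<sigma> s * (\<Prod>k\<in>set \<sigma> - {s}. ?f \<sigma> k) = zlist \<sigma>"
    unfolding zlist_def by (cases "s \<in> set \<sigma>") (simp_all add: prod.remove[of "set \<sigma>" s] count_list_0_iff)
  finally show ?thesis .
qed

lemma pairing_eq: "pairing \<sigma> \<pi> = (if mset \<sigma> = mset \<pi> then zlist \<sigma> else 0)"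
proof (induction \<sigma> arbitrary: \<pi>)
  case Nil
  then show ?case by (auto simp: zlist_def)
next
  case (Cons s \<sigma>)
  show ?case
  proof (cases "s \<in> set \<pi>")
    case True
    then have iff: "mset (s # \<sigma>) = mset \<pi> \<longleftrightarrow> mset \<sigma> = mset (remove1 s \<pi>)"
      by (metis mset.simps(2) mset_remove1 insert_DiffM add_mset_remove_trivial set_mset_mset)
    have "count_list \<pi> s = Suc (count_list \<sigma> s)" if "mset (s # \<sigma>) = mset \<pi>"
      using arg_cong[OF that, of "\<lambda>M. count M s"] by (simp add: count_mset)
    then show ?thesis using Cons.IH[of "remove1 s \<pi>"] iff by (simp add: zlist_Cons)
  next
    case False
    then have "mset (s # \<sigma>) \<noteq> mset \<pi>" by (metis list.set_intros(1) mset_eq_setD)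
    then show ?thesis using False by (simp add: count_list_0_iff)
  qed
qed

lemma zlist_cong: "mset \<sigma> = mset \<rho> \<Longrightarrow> zlist \<sigma> = zlist \<rho>"
proof -
  assume eq: "mset \<sigma> = mset \<rho>"
  then have "count_list \<sigma> k = count_list \<rho> k" for k by (simp flip: count_mset)
  then show ?thesis using mset_eq_setD[OF eq] by (simp add: zlist_def)
qed

definition wfac :: "nat list \<Rightarrow> qtfield" where
  "wfac \<rho> = (\<Prod>k\<leftarrow>\<rho>. (1 - q_par ^ k) / (1 - t_par ^ k))"

lemma wfac_Cons: "wfac (k # \<rho>) = (1 - q_par ^ k) / (1 - t_par ^ k) * wfac \<rho>"
  by (simp add: wfac_def)

lemma z_qt_eq: "z_qt \<rho> = of_nat (zlist \<rho>) * wfac \<rho>"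
  by (simp add: z_qt_def zlist_def wfac_def)

lemma wfac_cong: "mset \<sigma> = mset \<rho> \<Longrightarrow> wfac \<sigma> = wfac \<rho>"
  unfolding wfac_def prod_mset_prod_list[symmetric] mset_map by simp

lemma wfac_pairing: "wfac \<rho> * of_nat (pairing \<sigma> \<rho>) = wfac \<sigma> * of_nat (pairing \<rho> \<sigma>)"
  using wfac_cong[of \<rho> \<sigma>] zlist_cong[of \<rho> \<sigma>] by (auto simp: pairing_eq)

lemma wfac_nonzero: "0 \<notin> set \<rho> \<Longrightarrow> wfac \<rho> \<noteq> 0"
  unfolding wfac_def
  by (induction \<rho>) (use q_par_power_neq_1 t_par_power_neq_1 in auto)

lemma zlist_pos: "0 \<notin> set \<rho> \<Longrightarrow> zlist \<rho> > 0"
  by (induction \<rho>) (auto simp: zlist_Cons, simp add: zlist_def)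

lemma z_qt_nonzero: "0 \<notin> set \<rho> \<Longrightarrow> z_qt \<rho> \<noteq> 0"
  using zlist_pos[of \<rho>] wfac_nonzero[of \<rho>] by (simp add: z_qt_eq)

abbreviation xq :: "nat list \<Rightarrow> qtfield" where
  "xq a \<equiv> \<Prod>s\<leftarrow>a. (q_par ^ s - 1)"

text \<open>The reason for the self-adjointness: Macdonald's factor trades the t-weights of the left
  argument for q-weights, and by \<open>vq_prod\<close> those of the right argument have the same
  form up to a power of q depending only on the degree of the split.\<close>

lemma ut_wfac: "0 \<notin> set a \<Longrightarrow> (\<Prod>s\<leftarrow>a. ut s) * wfac a = xq a"
proof (induction a)
  case (Cons s a)
  have "ut s * ((1 - q_par ^ s) / (1 - t_par ^ s)) = q_par ^ s - 1"
    using t_par_power_neq_1[of s] Cons.prems by (simp add: field_simps)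
  moreover have "(\<Prod>s\<leftarrow>s # a. ut s) * wfac (s # a) =
      (ut s * ((1 - q_par ^ s) / (1 - t_par ^ s))) * ((\<Prod>s\<leftarrow>a. ut s) * wfac a)"
    by (simp only: wfac_Cons list.map prod_list.Cons mult_ac)
  moreover have "(\<Prod>s\<leftarrow>a. ut s) * wfac a = xq a" using Cons by simp
  ultimately show ?case by (simp only: list.map prod_list.Cons)
qed (simp add: wfac_def)

lemma vq_prod: "(\<Prod>s\<leftarrow>a. vq s) = inverse q_par ^ sum_list a * xq a"
proof (induction a)
  case (Cons s a)
  have "vq s = inverse q_par ^ s * (q_par ^ s - 1)"
    using q_par_nonzero by (simp add: right_diff_distrib flip: power_mult_distrib)
  then show ?case using Cons by (simp add: power_add mult_ac)
qed simp

lemma wfac_splits: "(a, b) \<in> set (splits \<rho>) \<Longrightarrow> wfac \<rho> = wfac a * wfac b"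
  by (induction \<rho> arbitrary: a b) (auto simp: wfac_def)

lemma sum_list_commute:
  "(\<Sum>x\<leftarrow>xs. \<Sum>y\<leftarrow>ys. f x y) = (\<Sum>y\<leftarrow>ys. \<Sum>x\<leftarrow>xs. (f x y :: 'a :: comm_monoid_add))"
  by (induction xs) (simp_all add: sum_list_addf)

definition split_form :: "nat list \<Rightarrow> nat list \<Rightarrow> qtfield" where
  "split_form \<rho> \<sigma> = (\<Sum>(a, b)\<leftarrow>splits \<rho>. (\<Prod>s\<leftarrow>a. ut s) * split_pairing \<sigma> b (sum_list a))"

text \<open>In this form both lists enter alike, up to \<open>wfac_pairing\<close>, and symmetry
  becomes an exchange of summations.\<close>

lemma wfac_split_form_expand:
  assumes "0 \<notin> set \<rho>"
  shows "wfac \<rho> * split_form \<rho> \<sigma> = (\<Sum>x\<leftarrow>splits \<rho>. \<Sum>y\<leftarrow>splits \<sigma>.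
    if sum_list (fst x) = sum_list (fst y)
    then inverse q_par ^ sum_list (fst x) * (xq (fst x) * xq (fst y)) * (wfac (snd x) * of_nat (pairing (snd y) (snd x)))
    else 0)"
proof -
  have "wfac \<rho> * split_form \<rho> \<sigma> =
      (\<Sum>x\<leftarrow>splits \<rho>. wfac \<rho> * ((\<Prod>s\<leftarrow>fst x. ut s) * split_pairing \<sigma> (snd x) (sum_list (fst x))))"
    unfolding split_form_def sum_list_const_mult[symmetric] by (simp add: case_prod_unfold)
  also have "\<dots> = (\<Sum>x\<leftarrow>splits \<rho>. \<Sum>y\<leftarrow>splits \<sigma>.
    if sum_list (fst x) = sum_list (fst y)
    then inverse q_par ^ sum_list (fst x) * (xq (fst x) * xq (fst y)) * (wfac (snd x) * of_nat (pairing (snd y) (snd x)))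
    else 0)"
  proof (intro arg_cong[of _ _ sum_list] map_cong refl)
    fix x assume x: "x \<in> set (splits \<rho>)"
    then have x': "(fst x, snd x) \<in> set (splits \<rho>)" by simp
    have a: "0 \<notin> set (fst x)" using splits_set[OF x'] assms by auto
    have "wfac \<rho> * ((\<Prod>s\<leftarrow>fst x. ut s) * Y) = xq (fst x) * wfac (snd x) * Y" for Y
      by (simp add: wfac_splits[OF x'] flip: ut_wfac[OF a])
    then have "wfac \<rho> * ((\<Prod>s\<leftarrow>fst x. ut s) * split_pairing \<sigma> (snd x) (sum_list (fst x))) =
       (\<Sum>y\<leftarrow>splits \<sigma>. xq (fst x) * wfac (snd x) *
         (if sum_list (fst y) = sum_list (fst x) then (\<Prod>s\<leftarrow>fst y. vq s) * of_nat (pairing (snd y) (snd x)) else 0))"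
      unfolding split_pairing_def sum_list_const_mult by (simp add: case_prod_unfold)
    also have "\<dots> = (\<Sum>y\<leftarrow>splits \<sigma>. if sum_list (fst x) = sum_list (fst y)
       then inverse q_par ^ sum_list (fst x) * (xq (fst x) * xq (fst y)) * (wfac (snd x) * of_nat (pairing (snd y) (snd x)))
       else 0)"
      by (intro arg_cong[of _ _ sum_list] map_cong refl) (auto simp: vq_prod mult_ac)
    finally show "wfac \<rho> * ((\<Prod>s\<leftarrow>fst x. ut s) * split_pairing \<sigma> (snd x) (sum_list (fst x))) = \<dots>" .
  qed
  finally show ?thesis .
qed

lemma wfac_split_form_commute:
  assumes "0 \<notin> set \<rho>" "0 \<notin> set \<sigma>"
  shows "wfac \<rho> * split_form \<rho> \<sigma> = wfac \<sigma> * split_form \<sigma> \<rho>"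
  unfolding wfac_split_form_expand[OF assms(1)] wfac_split_form_expand[OF assms(2)]
    sum_list_commute[of _ "splits \<rho>" "splits \<sigma>"]
proof (intro arg_cong[of _ _ sum_list] map_cong refl)
  fix x y :: "nat list \<times> nat list"
  show "(if sum_list (fst y) = sum_list (fst x)
      then inverse q_par ^ sum_list (fst y) * (xq (fst y) * xq (fst x)) * (wfac (snd y) * of_nat (pairing (snd x) (snd y)))
      else 0) =
    (if sum_list (fst x) = sum_list (fst y)
      then inverse q_par ^ sum_list (fst x) * (xq (fst x) * xq (fst y)) * (wfac (snd x) * of_nat (pairing (snd y) (snd x)))
      else 0)"
    unfolding wfac_pairing[of "snd x" "snd y"] by (auto simp: mult_ac)
qed

text \<open>Its sign cancels the one in \<open>form_power_sum\<close> and its weight turns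
  \<open>z_\<rho>\<close> into \<open>z_qt\<close>, so twisting one argument of \<open>form\<close>
  gives Macdonald's scalar product.\<close>

definition twist :: "nat list \<Rightarrow> qtfield" where
  "twist \<rho> = (-1) ^ length \<rho> * wfac \<rho>"

lemma twist_nonzero: "0 \<notin> set \<rho> \<Longrightarrow> twist \<rho> \<noteq> 0"
  by (simp add: twist_def wfac_nonzero)

lemma twist_wform_commute:
  assumes "0 \<notin> set \<rho>" "0 \<notin> set \<sigma>" "sum_list \<rho> \<le> n" "sum_list \<sigma> \<le> n"
  shows "twist \<rho> * wform n (power_sum n \<rho>) (power_sum n \<sigma>) =
    twist \<sigma> * wform n (power_sum n \<sigma>) (power_sum n \<rho>)"
proof -
  have *: "twist \<rho> * wform n (power_sum n \<rho>) (power_sum n \<sigma>) =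
      (-1) ^ length \<rho> * (-1) ^ length \<sigma> * ((qsum n - resid n) * (wfac \<rho> * of_nat (pairing \<sigma> \<rho>)) +
        resid n * (wfac \<rho> * split_form \<rho> \<sigma>))"
    if "0 \<notin> set \<rho>" "0 \<notin> set \<sigma>" "sum_list \<rho> \<le> n" "sum_list \<sigma> \<le> n" for \<rho> \<sigma>
    unfolding wform_power_sum[OF that] twist_def split_form_def by (simp add: algebra_simps)
  show ?thesis
    unfolding *[OF assms] *[OF assms(2,1,4,3)] wfac_pairing[of \<rho> \<sigma>] wfac_split_form_commute[OF assms(1,2)]
    by (simp only: mult.commute[of "(-1) ^ length \<rho>"])
qed

lemma twist_form:
  assumes "0 \<notin> set \<rho>" "0 \<notin> set \<sigma>" "sum_list \<rho> \<le> n" "sum_list \<sigma> \<le> n"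
  shows "twist \<rho> * form n (power_sum n \<rho>) (power_sum n \<sigma>) = (if mset \<rho> = mset \<sigma> then z_qt \<rho> else 0)"
proof (cases "mset \<rho> = mset \<sigma>")
  case True
  have "twist \<rho> * form n (power_sum n \<rho>) (power_sum n \<sigma>) =
      ((-1) ^ length \<rho> * (-1) ^ length \<sigma>) * (wfac \<rho> * of_nat (pairing \<sigma> \<rho>))"
    by (simp add: form_power_sum[OF assms] twist_def mult_ac)
  also have "length \<sigma> = length \<rho>" using True by (metis size_mset)
  finally show ?thesis using True by (simp add: pairing_eq z_qt_eq zlist_cong[OF True] flip: power_mult_distrib)
next
  case False
  then show ?thesis by (simp add: form_power_sum[OF assms] pairing_eq)
qed

section \<open>Partitions\<close>

lemma partitions_of_D:
  assumes "lam \<in> partitions_of d"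
  shows "sorted_wrt (\<ge>) lam" "0 \<notin> set lam" "sum_list lam = d"
  using assms by (auto simp: partitions_of_def)

lemma length_le_sum_list: "0 \<notin> set lam \<Longrightarrow> length lam \<le> sum_list (lam :: nat list)"
proof (induction lam)
  case (Cons a lam)
  then have "a \<ge> 1" "length lam \<le> sum_list lam" by auto
  then show ?case by simp
qed simp

lemma nat_member_le_sum_list: "x \<in> set xs \<Longrightarrow> x \<le> sum_list (xs :: nat list)"
  by (rule member_le_sum_list) auto

lemma length_partition_le: "lam \<in> partitions_of d \<Longrightarrow> length lam \<le> d"
  using length_le_sum_list partitions_of_D by metis

lemma finite_partitions_of: "finite (partitions_of d)"
proof (rule finite_subset)
  show "partitions_of d \<subseteq> {lam. set lam \<subseteq> {0..d} \<and> length lam \<le> d}"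
    using length_partition_le nat_member_le_sum_list by (auto simp: partitions_of_def)
  show "finite {lam :: nat list. set lam \<subseteq> {0..d} \<and> length lam \<le> d}"
    by (rule finite_lists_length_le) simp
qed

lemma part_outside: "i = 0 \<or> length lam < i \<Longrightarrow> part lam i = 0"
  by (auto simp: part_def)

lemma part_pos_iff: "0 \<notin> set lam \<Longrightarrow> part lam i > 0 \<longleftrightarrow> 1 \<le> i \<and> i \<le> length lam"
  unfolding part_def by (auto, metis Suc_le_eq Suc_pred gr0I nth_mem)

lemma part_antimono:
  assumes "sorted_wrt (\<ge>) lam" "1 \<le> i" "i \<le> j"
  shows "part lam j \<le> part lam i"
proof (cases "i < j \<and> j \<le> length lam")
  case True
  then have "lam ! (i - 1) \<ge> lam ! (j - 1)"
    using assms by (intro sorted_wrt_nth_less[OF assms(1)]) auto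
  then show ?thesis using True assms by (simp add: part_def)
next
  case False
  then show ?thesis using assms by (cases "i = j") (auto simp: part_outside)
qed

lemma sum_part: "length lam \<le> n \<Longrightarrow> (\<Sum>i=1..n. part lam i) = sum_list lam"
proof -
  assume "length lam \<le> n"
  then have "(\<Sum>i=1..n. part lam i) = (\<Sum>i=1..length lam. part lam i)"
    by (intro sum.mono_neutral_right) (auto simp: part_outside)
  also have "\<dots> = (\<Sum>i<length lam. lam ! i)"
    by (rule sum.reindex_bij_witness[of _ Suc "\<lambda>i. i - 1"]) (auto simp: part_def)
  finally show ?thesis by (simp add: sum_list_sum_nth atLeast0LessThan)
qed

lemma part_le_sum_list: "part lam i \<le> sum_list lam"
  by (auto simp: part_def intro!: nat_member_le_sum_list)

lemma partition_eqI:
  assumes "lam \<in> partitions_of d" "mu \<in> partitions_of e" "\<And>i. 1 \<le> i \<Longrightarrow> part lam i = part mu i"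
  shows "lam = mu"
proof -
  have "length lam = length mu"
  proof (rule antisym; rule ccontr)
    assume "\<not> length lam \<le> length mu"
    then show False
      using assms(3)[of "length lam"] part_pos_iff[OF partitions_of_D(2)[OF assms(1)], of "length lam"]
      by (simp add: part_outside)
  next
    assume "\<not> length mu \<le> length lam"
    then show False
      using assms(3)[of "length mu"] part_pos_iff[OF partitions_of_D(2)[OF assms(2)], of "length mu"]
      by (simp add: part_outside)
  qed
  moreover have "lam ! i = mu ! i" if "i < length lam" for i
    using assms(3)[of "Suc i"] that calculation by (simp add: part_def)
  ultimately show ?thesis by (rule nth_equalityI)
qed

lemma le_card_down_closed:
  fixes S :: "nat set"
  assumes "finite S" "0 \<notin> S" "\<And>i j. j \<in> S \<Longrightarrow> 1 \<le> i \<Longrightarrow> i \<le> j \<Longrightarrow> i \<in> S" "1 \<le> i"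
  shows "i \<le> card S \<longleftrightarrow> i \<in> S"
proof
  assume "i \<in> S"
  then have "{1..i} \<subseteq> S" using assms(3) by auto
  then show "i \<le> card S" using card_mono[OF assms(1), of "{1..i}"] by simp
next
  assume le: "i \<le> card S"
  show "i \<in> S"
  proof (rule ccontr)
    assume "i \<notin> S"
    have "S \<subseteq> {1..<i}"
    proof
      fix x assume x: "x \<in> S"
      then have "x \<noteq> 0" using assms(2) by (cases x) auto
      moreover have "\<not> i \<le> x" using assms(3)[OF x assms(4)] \<open>i \<notin> S\<close> by blast
      ultimately show "x \<in> {1..<i}" by simp
    qed
    then have "card S \<le> i - 1" using card_mono[of "{1..<i}" S] by simp
    then show False using le assms(4) by simp
  qed
qed

lemma part_conj_part:
  assumes "sorted_wrt (\<ge>) lam" "1 \<le> j"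
  shows "part (conj_part lam) j = card {i \<in> {1..length lam}. j \<le> part lam i}"
proof (cases "j \<le> part lam 1")
  case True
  have "length (conj_part lam) = part lam 1"
    by (simp add: conj_part_def del: upt_Suc)
  moreover have "conj_part lam ! (j - 1) = card {i \<in> {1..length lam}. j \<le> part lam i}"
  proof -
    have "[1..<Suc (part lam 1)] ! (j - 1) = j" using True assms(2) by (subst nth_upt) auto
    then show ?thesis using True assms(2) by (simp add: conj_part_def del: upt_Suc)
  qed
  ultimately show ?thesis using True assms(2) unfolding part_def[of "conj_part lam"] by simp
next
  case False
  then have "{i \<in> {1..length lam}. j \<le> part lam i} = {}"
    using part_antimono[OF assms(1), of 1] by fastforce
  then show ?thesis using False unfolding conj_part_def by (simp add: part_outside del: upt_Suc)
qed

text \<open>Both sides say that the cell in row \<open>i\<close> and column \<open>j\<close> belongs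
  to the diagram.\<close>

lemma le_part_conj_iff:
  assumes "sorted_wrt (\<ge>) lam" "1 \<le> i" "1 \<le> j"
  shows "i \<le> part (conj_part lam) j \<longleftrightarrow> j \<le> part lam i"
proof -
  let ?S = "{i \<in> {1..length lam}. j \<le> part lam i}"
  have "i \<le> card ?S \<longleftrightarrow> i \<in> ?S"
  proof (rule le_card_down_closed)
    fix i k assume k: "k \<in> ?S" and i: "1 \<le> i" "i \<le> k"
    then show "i \<in> ?S" using part_antimono[OF assms(1) i] by auto
  qed (use assms in auto)
  also have "i \<in> ?S \<longleftrightarrow> j \<le> part lam i"
    using assms by (cases "i \<le> length lam") (auto simp: part_outside)
  finally show ?thesis by (simp only: part_conj_part[OF assms(1,3)])
qed

text \<open>The cells in the first \<open>j\<close> columns, counted by rows and by columns.\<close>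

lemma sum_conj_count:
  assumes "sorted_wrt (\<ge>) lam" "length lam \<le> n"
  shows "(\<Sum>i=1..n. min (part lam i) j) = (\<Sum>k=1..j. part (conj_part lam) k)"
proof -
  have "(\<Sum>k=1..j. part (conj_part lam) k) = (\<Sum>k=1..j. card {i \<in> {1..length lam}. k \<le> part lam i})"
    by (rule sum.cong) (auto simp: part_conj_part[OF assms(1)])
  also have "\<dots> = (\<Sum>k=1..j. \<Sum>i=1..n. if k \<le> part lam i then 1 else 0)"
  proof (rule sum.cong[OF refl])
    fix k assume k: "k \<in> {1..j}"
    then have "{i \<in> {1..length lam}. k \<le> part lam i} = {i \<in> {1..n}. k \<le> part lam i}"
      using assms(2) by (auto simp: part_def split: if_splits)
    then show "card {i \<in> {1..length lam}. k \<le> part lam i} = (\<Sum>i=1..n. if k \<le> part lam i then 1 else 0)"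
      by (simp add: sum.If_cases Int_def)
  qed
  also have "\<dots> = (\<Sum>i=1..n. \<Sum>k=1..j. if k \<le> part lam i then 1 else 0)"
    by (rule sum.swap)
  also have "\<dots> = (\<Sum>i=1..n. min (part lam i) j)"
  proof (rule sum.cong[OF refl])
    fix i
    have "{1..j} \<inter> {k. k \<le> part lam i} = {1..min (part lam i) j}" by auto
    then show "(\<Sum>k=1..j. if k \<le> part lam i then 1 else 0) = min (part lam i) j"
      by (simp add: sum.If_cases)
  qed
  finally show ?thesis ..
qed

lemma conj_part_partition:
  assumes "lam \<in> partitions_of d"
  shows "conj_part lam \<in> partitions_of d"
proof -
  note lam = partitions_of_D[OF assms]
  define f where "f j = card {i \<in> {1..length lam}. j \<le> part lam i}" for j
  have conj: "conj_part lam = map f [1..<Suc (part lam 1)]"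
    by (simp add: conj_part_def f_def)
  have len: "length (conj_part lam) = part lam 1" by (simp add: conj del: upt_Suc)
  have mono: "f k \<le> f j" if "j \<le> k" for j k
    unfolding f_def by (rule card_mono) (use that in auto)
  have "sorted_wrt (\<ge>) (conj_part lam)"
    unfolding conj sorted_wrt_map
    by (rule sorted_wrt_mono_rel[OF _ sorted_wrt_upt]) (auto intro: mono)
  moreover have "0 \<notin> set (conj_part lam)"
  proof
    assume "0 \<in> set (conj_part lam)"
    then obtain j where j: "1 \<le> j" "j \<le> part lam 1" "f j = 0" by (auto simp: conj)
    then have "1 \<le> length lam" by (auto simp: part_def split: if_splits)
    then have "{i \<in> {1..length lam}. j \<le> part lam i} \<noteq> {}" using j by force
    moreover have "finite {i \<in> {1..length lam}. j \<le> part lam i}" by simp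
    ultimately show False using j(3) unfolding f_def by (metis card_0_eq)
  qed
  moreover have "sum_list (conj_part lam) = d"
  proof -
    have "sum_list (conj_part lam) = (\<Sum>i=1..length lam. min (part lam i) (part lam 1))"
      using sum_part[of "conj_part lam" "part lam 1"] sum_conj_count[OF lam(1) order_refl, of "part lam 1"] len
      by simp
    also have "\<dots> = (\<Sum>i=1..length lam. part lam i)"
      using part_antimono[OF lam(1), of 1] by (intro sum.cong refl) (simp add: min_def)
    finally show ?thesis using sum_part[OF order_refl, of lam] lam(3) by simp
  qed
  ultimately show ?thesis by (simp add: partitions_of_def)
qed

lemma conj_conj_part:
  assumes "lam \<in> partitions_of d"
  shows "conj_part (conj_part lam) = lam"
proof (rule partition_eqI)
  note c = conj_part_partition[OF assms]
  show "conj_part (conj_part lam) \<in> partitions_of d" by (rule conj_part_partition[OF c])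
  show "lam \<in> partitions_of d" by (rule assms)
  fix i :: nat assume i: "1 \<le> i"
  have iff: "k \<le> part (conj_part (conj_part lam)) i \<longleftrightarrow> k \<le> part lam i" if "1 \<le> k" for k
    using le_part_conj_iff[OF partitions_of_D(1)[OF c] that i]
      le_part_conj_iff[OF partitions_of_D(1)[OF assms] i that] by simp
  show "part (conj_part (conj_part lam)) i = part lam i"
    using iff[of "part (conj_part (conj_part lam)) i"] iff[of "part lam i"]
    by (cases "part (conj_part (conj_part lam)) i"; cases "part lam i") auto
qed

section \<open>The dominance order\<close>

lemma dominance_antisym:
  assumes "lam \<in> partitions_of d" "mu \<in> partitions_of d"
    and "\<And>i. (\<Sum>k=1..i. part lam k) = (\<Sum>k=1..i. part mu k)"
  shows "lam = mu"
proof (rule partition_eqI[OF assms(1,2)])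
  fix i :: nat assume "1 \<le> i"
  then obtain j where "i = Suc j" by (metis Suc_le_D One_nat_def)
  then show "part lam i = part mu i"
    using assms(3)[of i] assms(3)[of j] by simp
qed

text \<open>A strictly monotone integer rank for dominance on partitions of \<open>d\<close>, used
  for inductions and for triangular determinants. Summing up to \<open>d\<close> loses nothing,
  since all later partial sums equal \<open>d\<close>.\<close>

definition dom_rank :: "nat \<Rightarrow> nat list \<Rightarrow> nat" where
  "dom_rank d lam = (\<Sum>i=1..d. \<Sum>k=1..i. part lam k)"

lemma dom_rank_mono: "dominance_le lam mu \<Longrightarrow> dom_rank d lam \<le> dom_rank d mu"
  unfolding dom_rank_def dominance_le_def by (rule sum_mono) blast

lemma partial_sum_beyond:
  assumes "lam \<in> partitions_of d" "d \<le> i"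
  shows "(\<Sum>k=1..i. part lam k) = d"
  using sum_part[of lam i] length_partition_le[OF assms(1)] partitions_of_D(3)[OF assms(1)] assms(2) by simp

lemma dom_rank_strict:
  assumes "lam \<in> partitions_of d" "mu \<in> partitions_of d" "dominance_le lam mu" "dom_rank d mu \<le> dom_rank d lam"
  shows "lam = mu"
proof (rule dominance_antisym[OF assms(1,2)])
  fix i
  have le: "(\<Sum>k=1..i. part lam k) \<le> (\<Sum>k=1..i. part mu k)" for i
    using assms(3) by (simp add: dominance_le_def)
  show "(\<Sum>k=1..i. part lam k) = (\<Sum>k=1..i. part mu k)"
  proof (cases "i \<in> {1..d}")
    case True
    show ?thesis
    proof (rule ccontr)
      assume "(\<Sum>k=1..i. part lam k) \<noteq> (\<Sum>k=1..i. part mu k)"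
      then have "(\<Sum>k=1..i. part lam k) < (\<Sum>k=1..i. part mu k)" using le[of i] by simp
      then have "dom_rank d lam < dom_rank d mu"
        unfolding dom_rank_def using True le by (intro sum_strict_mono_ex1) auto
      then show False using assms(4) by simp
    qed
  next
    case False
    then consider "i = 0" | "d \<le> i" by force
    then show ?thesis using partial_sum_beyond[OF assms(1)] partial_sum_beyond[OF assms(2)] by cases auto
  qed
qed

lemma dominance_refl: "dominance_le lam lam"
  by (simp add: dominance_le_def)

lemma dominance_trans: "dominance_le a b \<Longrightarrow> dominance_le b c \<Longrightarrow> dominance_le a c"
  unfolding dominance_le_def by (metis le_trans)

lemma finite_strictly_below: "finite (strictly_below lam)"
  unfolding strictly_below_def using finite_partitions_of by simp

text \<open>Trading the indices of \<open>S\<close> beyond \<open>card S\<close> for the equally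
  many missing smaller ones cannot decrease the sum.\<close>

lemma sum_antimono_le:
  fixes f :: "nat \<Rightarrow> nat"
  assumes anti: "\<And>i j. 1 \<le> i \<Longrightarrow> i \<le> j \<Longrightarrow> f j \<le> f i" and S: "finite S" "0 \<notin> S"
  shows "(\<Sum>i\<in>S. f i) \<le> (\<Sum>i=1..card S. f i)"
proof (cases "S = {}")
  case False
  define J where "J = {1..card S}"
  have fJ: "finite J" "card J = card S" by (simp_all add: J_def)
  have c: "card (S - J) = card (J - S)"
    using S(1) fJ by (simp add: card_Diff_subset_Int Int_commute)
  have pos: "1 \<le> card S" using False S(1) by (simp add: Suc_le_eq card_gt_0_iff)
  have "f i \<le> f (card S)" if "i \<in> S - J" for i
  proof (rule anti[OF pos])
    have "i \<noteq> 0" using that S(2) by (metis DiffD1)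
    then show "card S \<le> i" using that by (auto simp: J_def)
  qed
  from sum_bounded_above[of "S - J", OF this]
  have "(\<Sum>i\<in>S - J. f i) \<le> card (S - J) * f (card S)" by simp
  moreover have "card (J - S) * f (card S) \<le> (\<Sum>i\<in>J - S. f i)"
    using sum_bounded_below[of "J - S" "f (card S)" f] anti by (auto simp: J_def)
  moreover have "(\<Sum>i\<in>S. f i) = (\<Sum>i\<in>S - J. f i) + (\<Sum>i\<in>S \<inter> J. f i)"
    using S sum.Int_Diff[of S f J] by simp
  moreover have "(\<Sum>i\<in>J. f i) = (\<Sum>i\<in>J - S. f i) + (\<Sum>i\<in>S \<inter> J. f i)"
    using fJ sum.Int_Diff[of J f S] by (simp add: inf_commute)
  ultimately show ?thesis using c by (simp add: J_def)
qed simp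

section \<open>Rearrangements and compositions\<close>

lemma rearrangements_outside: "\<alpha> \<in> rearrangements n nu \<Longrightarrow> i \<notin> {1..n} \<Longrightarrow> \<alpha> i = 0"
  by (auto simp: rearrangements_def permutes_not_in part_outside split: if_splits)

lemma finite_rearrangements: "finite (rearrangements n nu)"
proof -
  have "{part nu \<circ> \<pi> | \<pi>. \<pi> permutes {1..n}} = (\<lambda>\<pi>. part nu \<circ> \<pi>) ` {\<pi>. \<pi> permutes {1..n}}" by auto
  then show ?thesis by (simp add: rearrangements_def finite_permutations)
qed

lemma sum_rearrangement:
  assumes "\<alpha> \<in> rearrangements n nu"
  shows "(\<Sum>i=1..n. \<alpha> i) = sum_list nu"
proof -
  obtain \<pi> where \<pi>: "\<pi> permutes {1..n}" "\<alpha> = part nu \<circ> \<pi>" "length nu \<le> n"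
    using assms by (auto simp: rearrangements_def split: if_splits)
  have "(\<Sum>i=1..n. \<alpha> i) = (\<Sum>i=1..n. part nu i)"
    using sum.permute[OF \<pi>(1), of "part nu"] \<pi>(2) by simp
  then show ?thesis using sum_part \<pi>(3) by simp
qed

lemma sum_rearrangement_subset:
  assumes "\<alpha> \<in> rearrangements n nu" "sorted_wrt (\<ge>) nu" "S \<subseteq> {1..n}"
  shows "(\<Sum>i\<in>S. \<alpha> i) \<le> (\<Sum>i=1..card S. part nu i)"
proof -
  obtain \<pi> where \<pi>: "\<pi> permutes {1..n}" "\<alpha> = part nu \<circ> \<pi>"
    using assms by (auto simp: rearrangements_def split: if_splits)
  have inj: "inj_on \<pi> S" using permutes_inj[OF \<pi>(1)] by (rule inj_on_subset) simp
  have "(\<Sum>i\<in>S. \<alpha> i) = (\<Sum>i\<in>\<pi> ` S. part nu i)"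
    by (simp add: sum.reindex[OF inj] \<pi>(2))
  also have "\<dots> \<le> (\<Sum>i=1..card (\<pi> ` S). part nu i)"
  proof (rule sum_antimono_le)
    show "finite (\<pi> ` S)" using assms(3) finite_subset by blast
    show "0 \<notin> \<pi> ` S"
    proof
      assume "0 \<in> \<pi> ` S"
      then obtain i where "i \<in> {1..n}" "\<pi> i = 0" using assms(3) by force
      then show False using permutes_in_image[OF \<pi>(1), of i] by simp
    qed
  qed (rule part_antimono[OF assms(2)])
  finally show ?thesis by (simp add: card_image[OF inj])
qed

lemma sum_rearrangement_comp:
  assumes "\<alpha> \<in> rearrangements n nu"
  shows "(\<Sum>i=1..n. f (\<alpha> i)) = (\<Sum>i=1..n. f (part nu i) :: nat)"
proof -
  obtain \<pi> where \<pi>: "\<pi> permutes {1..n}" "\<alpha> = part nu \<circ> \<pi>"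
    using assms by (auto simp: rearrangements_def split: if_splits)
  then show ?thesis using sum.permute[OF \<pi>(1), of "\<lambda>i. f (part nu i)"] by (simp add: comp_def)
qed

definition compositions :: "nat \<Rightarrow> nat \<Rightarrow> (nat \<Rightarrow> nat) set" where
  "compositions n d = {\<alpha>. (\<forall>i. i \<notin> {1..n} \<longrightarrow> \<alpha> i = 0) \<and> (\<Sum>i=1..n. \<alpha> i) = d}"

lemma image_part_mset:
  assumes "length nu \<le> n"
  shows "image_mset (part nu) (mset_set {1..n}) = mset nu + replicate_mset (n - length nu) 0"
proof -
  have "image_mset (part nu) (mset_set {1..n}) = mset (map (part nu) [1..<Suc n])"
    by (simp del: upt_Suc) (metis atLeastLessThanSuc_atLeastAtMost mset_upt)
  also have "map (part nu) [1..<Suc n] = nu @ replicate (n - length nu) 0"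
    using assms by (intro nth_equalityI) (auto simp: part_def nth_append simp del: upt_Suc)
  finally show ?thesis by simp
qed

lemma rearrangements_mset:
  assumes "\<alpha> \<in> rearrangements n nu"
  shows "image_mset \<alpha> (mset_set {1..n}) = mset nu + replicate_mset (n - length nu) 0"
proof -
  obtain \<pi> where \<pi>: "\<pi> permutes {1..n}" "\<alpha> = part nu \<circ> \<pi>" "length nu \<le> n"
    using assms by (auto simp: rearrangements_def split: if_splits)
  have "image_mset \<alpha> (mset_set {1..n}) = image_mset (part nu) (image_mset \<pi> (mset_set {1..n}))"
    by (simp add: \<pi>(2) multiset.map_comp)
  also have "image_mset \<pi> (mset_set {1..n}) = mset_set {1..n}"
    using image_mset_mset_set[OF permutes_inj_on[OF \<pi>(1)]] permutes_image[OF \<pi>(1)] by metis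
  finally show ?thesis using image_part_mset[OF \<pi>(3)] by simp
qed

lemma partition_mset_eq:
  assumes "lam \<in> partitions_of d" "mu \<in> partitions_of e" "mset lam = mset mu"
  shows "lam = mu"
proof -
  have "sorted (rev lam)" "sorted (rev mu)"
    using partitions_of_D(1)[OF assms(1)] partitions_of_D(1)[OF assms(2)] by (simp_all add: sorted_wrt_rev)
  then have "rev lam = rev mu"
    using properties_for_sort[of "rev lam" "rev mu"] assms(3) by (simp add: sorted_sort_id)
  then show ?thesis by simp
qed

text \<open>The values of \<open>\<alpha>\<close> determine the positive parts with their
  multiplicities; zeros are padding only.\<close>

lemma rearrangements_disjoint:
  assumes "\<alpha> \<in> rearrangements n lam" "\<alpha> \<in> rearrangements n mu"
    and "lam \<in> partitions_of d" "mu \<in> partitions_of e"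
  shows "lam = mu"
proof -
  have eq: "mset lam + replicate_mset (n - length lam) 0 = mset mu + replicate_mset (n - length mu) 0"
    using rearrangements_mset[OF assms(1)] rearrangements_mset[OF assms(2)] by (rule trans[OF sym])
  have "mset lam = mset mu"
  proof (rule multiset_eqI)
    fix x
    show "count (mset lam) x = count (mset mu) x"
    proof (cases "x = 0")
      case True
      then show ?thesis
        using partitions_of_D(2)[OF assms(3)] partitions_of_D(2)[OF assms(4)]
        by (simp add: count_mset count_list_0_iff)
    next
      case False
      then show ?thesis using arg_cong[OF eq, of "\<lambda>M. count M x"] by simp
    qed
  qed
  then show ?thesis by (rule partition_mset_eq[OF assms(3,4)])
qed

lemma composition_rearrangement:
  assumes "\<alpha> \<in> compositions n d"
  obtains nu where "nu \<in> partitions_of d" "\<alpha> \<in> rearrangements n nu"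
proof -
  define xs where "xs = map \<alpha> [1..<Suc n]"
  define nu where "nu = rev (sort (filter (\<lambda>x. x \<noteq> 0) xs))"
  have m: "mset nu = filter_mset (\<lambda>x. x \<noteq> 0) (mset xs)" by (simp add: nu_def)
  have xs: "mset xs = image_mset \<alpha> (mset_set {1..n})"
    unfolding xs_def by (simp del: upt_Suc) (metis atLeastLessThanSuc_atLeastAtMost mset_upt)
  have "sum_list nu = sum_list xs"
  proof -
    have "sum_list nu = sum_list (filter (\<lambda>x. x \<noteq> 0) xs)"
      by (simp only: nu_def sum_mset_sum_list[symmetric] mset_rev mset_sort)
    also have "\<dots> = sum_list xs" by (induction xs) auto
    finally show ?thesis .
  qed
  also have "\<dots> = (\<Sum>i=1..n. \<alpha> i)"
    unfolding xs_def by (simp add: sum_list_distinct_conv_sum_set atLeastLessThanSuc_atLeastAtMost del: upt_Suc)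
  also have "\<dots> = d" using assms by (simp add: compositions_def)
  finally have sum: "sum_list nu = d" .
  have nu: "nu \<in> partitions_of d"
  proof -
    have "sorted_wrt (\<ge>) nu"
      unfolding nu_def sorted_wrt_rev by (rule sorted_sort)
    moreover have "0 \<notin> set nu" by (simp add: nu_def)
    ultimately show ?thesis using sum by (simp add: partitions_of_def)
  qed
  have len: "length nu \<le> n"
    using length_filter_le[of "\<lambda>x. x \<noteq> 0" xs] by (simp add: nu_def xs_def del: upt_Suc)
  have dec: "mset xs = mset nu + replicate_mset (count (mset xs) 0) 0"
    by (rule multiset_eqI) (simp add: m)
  have "length xs = length nu + count (mset xs) 0"
    using arg_cong[OF dec, of size] by simp
  then have "count (mset xs) 0 = n - length nu" by (simp add: xs_def del: upt_Suc)
  then have "image_mset \<alpha> (mset_set {1..n}) = image_mset (part nu) (mset_set {1..n})"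
    using dec xs image_part_mset[OF len] by simp
  then obtain p where p: "p permutes {1..n}" "\<forall>x\<in>{1..n}. \<alpha> x = part nu (p x)"
    using image_mset_eq_implies_permutes[of "{1..n}" \<alpha> "part nu"] by auto
  have "\<alpha> = part nu \<circ> p"
  proof
    fix i
    show "\<alpha> i = (part nu \<circ> p) i"
    proof (cases "i \<in> {1..n}")
      case False
      then have "\<alpha> i = 0" using assms by (simp add: compositions_def)
      moreover have "part nu i = 0" using False len by (intro part_outside) auto
      ultimately show ?thesis using False p(1) by (simp add: permutes_not_in)
    qed (use p in simp)
  qed
  then have "\<alpha> \<in> rearrangements n nu" using p(1) len by (auto simp: rearrangements_def)
  with nu show thesis by (rule that)
qed

lemma rearrangements_compositions:
  "nu \<in> partitions_of d \<Longrightarrow> rearrangements n nu \<subseteq> compositions n d"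
  using sum_rearrangement rearrangements_outside partitions_of_D(3) by (fastforce simp: compositions_def)

lemma finite_compositions: "finite (compositions n d)"
proof -
  have "compositions n d \<subseteq> (\<Union>nu\<in>partitions_of d. rearrangements n nu)"
    using composition_rearrangement by blast
  then show ?thesis using finite_partitions_of finite_rearrangements
    by (meson finite_UN_I finite_subset)
qed

lemma sum_compositions:
  "(\<Sum>\<alpha>\<in>compositions n d. f \<alpha>) = (\<Sum>nu\<in>partitions_of d. \<Sum>\<alpha>\<in>rearrangements n nu. (f \<alpha> :: 'a :: comm_monoid_add))"
proof -
  have U: "compositions n d = (\<Union>nu\<in>partitions_of d. rearrangements n nu)"
  proof
    show "compositions n d \<subseteq> (\<Union>nu\<in>partitions_of d. rearrangements n nu)"
    proof
      fix \<alpha> assume "\<alpha> \<in> compositions n d"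
      then obtain nu where "nu \<in> partitions_of d" "\<alpha> \<in> rearrangements n nu"
        by (rule composition_rearrangement)
      then show "\<alpha> \<in> (\<Union>nu\<in>partitions_of d. rearrangements n nu)" by (rule UN_I)
    qed
    show "(\<Union>nu\<in>partitions_of d. rearrangements n nu) \<subseteq> compositions n d"
      using rearrangements_compositions by (rule UN_least)
  qed
  show ?thesis unfolding U
  proof (rule sum.UNION_disjoint[OF finite_partitions_of])
    show "\<forall>i\<in>partitions_of d. \<forall>j\<in>partitions_of d. i \<noteq> j \<longrightarrow> rearrangements n i \<inter> rearrangements n j = {}"
    proof (intro ballI impI equals0I)
      fix i j \<alpha> assume ij: "i \<in> partitions_of d" "j \<in> partitions_of d" "i \<noteq> j"
        and "\<alpha> \<in> rearrangements n i \<inter> rearrangements n j"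
      then have "\<alpha> \<in> rearrangements n i" "\<alpha> \<in> rearrangements n j" by simp_all
      from rearrangements_disjoint[OF this ij(1,2)] ij(3) show False by simp
    qed
  qed (simp add: finite_rearrangements)
qed

lemma part_in_rearrangements: "length nu \<le> n \<Longrightarrow> part nu \<in> rearrangements n nu"
  by (auto simp: rearrangements_def intro!: exI[of _ id] permutes_id)

lemma rearrangements_permute:
  assumes "\<alpha> \<in> rearrangements n nu" "\<beta> \<in> rearrangements n nu"
  obtains \<pi> where "\<pi> permutes {1..n}" "\<beta> = \<alpha> \<circ> \<pi>"
proof -
  obtain p q where p: "p permutes {1..n}" "\<alpha> = part nu \<circ> p" and q: "q permutes {1..n}" "\<beta> = part nu \<circ> q"
    using assms by (auto simp: rearrangements_def split: if_splits)
  have "\<beta> = \<alpha> \<circ> (Hilbert_Choice.inv p \<circ> q)"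
    using p q by (simp add: fun_eq_iff permutes_inverses)
  moreover have "Hilbert_Choice.inv p \<circ> q permutes {1..n}" using p q by (simp add: permutes_compose permutes_inv)
  ultimately show thesis using that by blast
qed

section \<open>Triangularity\<close>

definition nexp :: "nat \<Rightarrow> (nat \<Rightarrow> nat) \<Rightarrow> state" where
  "nexp n \<alpha> = fexp {1..n} (\<lambda>i. int (\<alpha> i))"

text \<open>The exponent of the product of \<open>x^(\<rho> - \<alpha>')\<close> with
  \<open>x^\<beta>\<close>, that is, of one term of the pairing of two monomial symmetric
  polynomials.\<close>

definition pair_state :: "nat \<Rightarrow> (nat \<Rightarrow> nat) \<Rightarrow> (nat \<Rightarrow> nat) \<Rightarrow> state" where
  "pair_state n \<alpha> \<beta> = rho_expo (2 * n) - shift n (nexp n \<alpha>) + nexp n \<beta>"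

lemma lookup_pair_state:
  "i \<in> {1..n} \<Longrightarrow> lookup (pair_state n \<alpha> \<beta>) i = int i - 1 + int (\<beta> i)"
  "i \<in> {1..n} \<Longrightarrow> lookup (pair_state n \<alpha> \<beta>) (n + i) = int n + int i - 1 - int (\<alpha> i)"
  "i \<notin> {1..2 * n} \<Longrightarrow> lookup (pair_state n \<alpha> \<beta>) i = 0"
  by (auto simp: pair_state_def lookup_add lookup_minus lookup_rho lookup_shift nexp_def lookup_fexp block_def)

section \<open>Dominance from the values above a threshold\<close>

lemma double_sum_segment: "a \<le> b \<Longrightarrow> 2 * \<Sum>{a..<b::int} = (b - a) * (a + b - 1)"
proof (induction b rule: int_ge_induct)
  case (step b)
  then have "{a..<b + 1} = insert b {a..<b}" by auto
  then show ?case using step by (simp add: algebra_simps)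
qed simp

lemma sum_index_le_top:
  assumes "S \<subseteq> {1..n}"
  shows "(\<Sum>i\<in>S. int i - 1) \<le> \<Sum>{int n - int (card S)..<int n}"
proof -
  have inj: "inj_on (\<lambda>i. int i - 1) S" by (auto simp: inj_on_def)
  have "\<Sum>((\<lambda>i. int i - 1) ` S) \<le> \<Sum>{int n - int (card ((\<lambda>i. int i - 1) ` S))..<int n}"
    by (rule sum_le_top_segment) (use assms finite_subset in auto)
  then show ?thesis using sum.reindex[OF inj, of "\<lambda>x. x"] card_image[OF inj] by (simp add: comp_def)
qed

text \<open>Reflecting the indices at \<open>n\<close> turns the maximal sum into a minimal one, to
  which \<open>initial_segment_if_small_sum\<close> applies.\<close>

lemma top_if_sum_eq:
  assumes S: "S \<subseteq> {1..n}" and eq: "(\<Sum>i\<in>S. int i - 1) = \<Sum>{int n - int (card S)..<int n}"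
  shows "i \<in> S \<longleftrightarrow> n - card S < i \<and> i \<le> n"
proof -
  have fin: "finite S" using S finite_subset by blast
  have cS: "card S \<le> n" using card_mono[OF _ S] by simp
  define R where "R = (\<lambda>i. int n - int i) ` S"
  have inj: "inj_on (\<lambda>i. int n - int i) S" by (auto simp: inj_on_def)
  have cR: "card R = card S" by (simp add: R_def card_image[OF inj])
  have "\<Sum>R = (\<Sum>i\<in>S. int n - int i)"
    using sum.reindex[OF inj, of "\<lambda>x. x"] by (simp add: R_def comp_def)
  also have "\<dots> = (\<Sum>i\<in>S. (int n - 1) - (int i - 1))" by (rule sum.cong) auto
  also have "\<dots> = int (card S) * (int n - 1) - (\<Sum>i\<in>S. int i - 1)"
    by (simp add: sum_subtractf algebra_simps)
  finally have "2 * \<Sum>R = 2 * (int (card S) * (int n - 1)) - 2 * \<Sum>{int n - int (card S)..<int n}"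
    using eq by simp
  also have "\<dots> = int (card S) * (int (card S) - 1)"
    by (subst double_sum_segment) (simp_all add: algebra_simps)
  also have "\<dots> = 2 * \<Sum>{0..<int (card R)}"
    by (subst double_sum_segment) (simp_all add: cR algebra_simps)
  finally have "\<Sum>R \<le> \<Sum>{0..<int (card R)}" by simp
  then have R: "R = {0..<int (card S)}"
  proof -
    have "0 \<le> x" if "x \<in> R" for x
    proof -
      from that obtain i where i: "i \<in> S" "x = int n - int i" by (auto simp: R_def)
      then have "i \<in> {1..n}" using S by blast
      then show ?thesis using i(2) by simp
    qed
    moreover have "finite R" using fin by (simp add: R_def)
    ultimately show ?thesis using initial_segment_if_small_sum[of R] \<open>\<Sum>R \<le> _\<close> cR by metis
  qed
  have "i \<in> S \<longleftrightarrow> int n - int i \<in> R" if "i \<le> n"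
    unfolding R_def by (auto simp: image_iff)
  then show ?thesis using R S cS by (cases "i \<le> n") auto
qed

text \<open>A term survives only if the values \<open>a i\<close> and \<open>b i\<close> are
  complementary in {0, ..., 2n-1}. Counting and summing the values from a threshold \<open>T\<close>
  upwards then compares \<open>\<alpha>\<close> with \<open>\<beta>\<close>.\<close>

locale nonzero_pair =
  fixes n :: nat and \<alpha> \<beta> :: "nat \<Rightarrow> nat"
  assumes nz: "alt_sign (2 * n) (pair_state n \<alpha> \<beta>) \<noteq> 0"
begin

abbreviation "a i \<equiv> int i - 1 + int (\<beta> i)"
abbreviation "b i \<equiv> int n + int i - 1 - int (\<alpha> i)"

definition "A T = {i \<in> {1..n}. T \<le> a i}"
definition "B T = {i \<in> {1..n}. T \<le> b i}"

lemma vals: "i \<in> {1..n} \<Longrightarrow> lookup (pair_state n \<alpha> \<beta>) i = a i"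
  "i \<in> {1..n} \<Longrightarrow> lookup (pair_state n \<alpha> \<beta>) (n + i) = b i"
  by (rule lookup_pair_state; assumption)+

lemma inj_a: "inj_on a {1..n}"
proof (rule inj_onI)
  fix i j assume ij: "i \<in> {1..n}" "j \<in> {1..n}" "a i = a j"
  then have "lookup (pair_state n \<alpha> \<beta>) i = lookup (pair_state n \<alpha> \<beta>) j" by (simp only: vals)
  then show "i = j" using inj_onD[OF alt_sign_support(1)[OF nz], of i j] ij by auto
qed

lemma inj_b: "inj_on b {1..n}"
proof (rule inj_onI)
  fix i j assume ij: "i \<in> {1..n}" "j \<in> {1..n}" "b i = b j"
  then have "lookup (pair_state n \<alpha> \<beta>) (n + i) = lookup (pair_state n \<alpha> \<beta>) (n + j)" by (simp only: vals)
  then show "i = j" using inj_onD[OF alt_sign_support(1)[OF nz], of "n + i" "n + j"] ij by auto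
qed

lemma ab_disjoint: "i \<in> {1..n} \<Longrightarrow> j \<in> {1..n} \<Longrightarrow> a i \<noteq> b j"
proof
  assume ij: "i \<in> {1..n}" "j \<in> {1..n}" "a i = b j"
  then have "lookup (pair_state n \<alpha> \<beta>) i = lookup (pair_state n \<alpha> \<beta>) (n + j)" by (simp only: vals)
  then show False using inj_onD[OF alt_sign_support(1)[OF nz], of i "n + j"] ij by auto
qed

lemma ab_image: "a ` {1..n} \<union> b ` {1..n} = {0..<2 * int n}"
proof -
  have split: "{1..2 * n} = {1..n} \<union> (+) n ` {1..n}"
    by (auto simp: image_iff)
  have "lookup (pair_state n \<alpha> \<beta>) ` {1..2 * n} = a ` {1..n} \<union> b ` {1..n}"
    unfolding split image_Un image_image by (intro arg_cong2[of _ _ _ _ "(\<union>)"] image_cong refl vals)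
  then show ?thesis using alt_sign_support(2)[OF nz] by simp
qed

lemma ab_range:
  assumes "i \<in> {1..n}"
  shows "0 \<le> a i \<and> a i < 2 * int n \<and> 0 \<le> b i \<and> b i < 2 * int n"
proof -
  have "a i \<in> {0..<2 * int n}" "b i \<in> {0..<2 * int n}"
    using assms unfolding ab_image[symmetric] by blast+
  then show ?thesis by simp
qed

lemma threshold_union:
  assumes "0 \<le> T" "T \<le> 2 * int n"
  shows "a ` A T \<union> b ` B T = {T..<2 * int n}"
proof -
  have "a ` A T \<union> b ` B T = {x \<in> a ` {1..n} \<union> b ` {1..n}. T \<le> x}"
    by (auto simp: A_def B_def)
  then show ?thesis using ab_image assms by auto
qed

lemma finite_AB [simp]: "finite (A T)" "finite (B T)"
  by (simp_all add: A_def B_def)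

lemma threshold_sums:
  assumes "0 \<le> T" "T \<le> 2 * int n"
  shows "int (card (A T)) + int (card (B T)) = 2 * int n - T"
    and "(\<Sum>i\<in>A T. a i) + (\<Sum>i\<in>B T. b i) = \<Sum>{T..<2 * int n}"
proof -
  have ia: "inj_on a (A T)" by (rule inj_on_subset[OF inj_a]) (auto simp: A_def)
  have ib: "inj_on b (B T)" by (rule inj_on_subset[OF inj_b]) (auto simp: B_def)
  have disj: "a ` A T \<inter> b ` B T = {}"
    using ab_disjoint by (auto simp: A_def B_def)
  have "card (a ` A T \<union> b ` B T) = card (A T) + card (B T)"
    using disj card_image[OF ia] card_image[OF ib] by (simp add: card_Un_disjoint)
  then show "int (card (A T)) + int (card (B T)) = 2 * int n - T"
    unfolding threshold_union[OF assms] using assms by simp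
  have "\<Sum>(a ` A T \<union> b ` B T) = (\<Sum>i\<in>A T. a i) + (\<Sum>i\<in>B T. b i)"
    using disj sum.reindex[OF ia, of "\<lambda>x. x"] sum.reindex[OF ib, of "\<lambda>x. x"]
    by (simp add: sum.union_disjoint comp_def)
  then show "(\<Sum>i\<in>A T. a i) + (\<Sum>i\<in>B T. b i) = \<Sum>{T..<2 * int n}"
    unfolding threshold_union[OF assms] ..
qed

text \<open>The values from \<open>T\<close> upwards have a known sum, which ties the sum of
  \<open>\<beta>\<close> over \<open>A T\<close> to that of \<open>\<alpha>\<close> over
  \<open>B T\<close>; an index outside \<open>B T\<close> adds at most \<open>j\<close> to the sum
  of minima. The two bracketed differences measure how far \<open>A T\<close> and \<open>B T\<close>
  are from final segments of {1, ..., n}. They are kept because they decide the case of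
  equality.\<close>

lemma threshold_ineq:
  assumes T: "0 \<le> T" "T \<le> 2 * int n"
  defines "j \<equiv> card (A T)" and "s \<equiv> card (B T)"
  shows "int (\<Sum>i=1..n. min (\<alpha> i) j) + (\<Sum>{int n - int j..<int n} - (\<Sum>i\<in>A T. int i - 1)) +
    (\<Sum>{int n - int s..<int n} - (\<Sum>i\<in>B T. int i - 1)) \<le> int (\<Sum>i\<in>A T. \<beta> i)"
proof -
  have sub: "A T \<subseteq> {1..n}" "B T \<subseteq> {1..n}" by (auto simp: A_def B_def)
  have jn: "j \<le> n" "s \<le> n"
    using card_mono[OF _ sub(1)] card_mono[OF _ sub(2)] by (simp_all add: j_def s_def)
  have js: "T = 2 * int n - int j - int s" using threshold_sums(1)[OF T] by (simp add: j_def s_def)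
  have "(\<Sum>i=1..n. min (\<alpha> i) j) = (\<Sum>i\<in>B T. min (\<alpha> i) j) + (\<Sum>i\<in>{1..n} - B T. min (\<alpha> i) j)"
    by (subst sum.subset_diff[OF sub(2)]) simp_all
  also have "\<dots> \<le> (\<Sum>i\<in>B T. \<alpha> i) + (\<Sum>i\<in>{1..n} - B T. j)"
    by (intro add_mono sum_mono) auto
  also have "\<dots> = (\<Sum>i\<in>B T. \<alpha> i) + (n - s) * j"
    using card_Diff_subset[OF _ sub(2)] by (simp add: s_def)
  finally have "int (\<Sum>i=1..n. min (\<alpha> i) j) \<le> int ((\<Sum>i\<in>B T. \<alpha> i) + (n - s) * j)"
    by (simp only: of_nat_le_iff)
  then have min: "int (\<Sum>i=1..n. min (\<alpha> i) j) \<le> (\<Sum>i\<in>B T. int (\<alpha> i)) + (int n - int s) * int j"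
    using jn by (simp add: of_nat_diff)
  have sa: "(\<Sum>i\<in>A T. a i) = (\<Sum>i\<in>A T. int i - 1) + (\<Sum>i\<in>A T. int (\<beta> i))"
    by (simp only: sum.distrib)
  have "(\<Sum>i\<in>B T. b i) = (\<Sum>i\<in>B T. int n + (int i - 1) - int (\<alpha> i))"
    by (rule sum.cong) auto
  then have sb: "(\<Sum>i\<in>B T. b i) = int s * int n + (\<Sum>i\<in>B T. int i - 1) - (\<Sum>i\<in>B T. int (\<alpha> i))"
    by (simp only: sum.distrib sum_subtractf[of _ "\<lambda>i. int (\<alpha> i)"] sum_constant s_def)
  \<comment> \<open>Segment sums are doubled to keep the closed formulas free of division.\<close>
  have g1: "2 * \<Sum>{int n - int j..<int n} = int j * (2 * int n - int j - 1)"
    using double_sum_segment[of "int n - int j" "int n"] by (simp add: algebra_simps)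
  have g2: "2 * \<Sum>{int n - int s..<int n} = int s * (2 * int n - int s - 1)"
    using double_sum_segment[of "int n - int s" "int n"] by (simp add: algebra_simps)
  have g3: "2 * \<Sum>{T..<2 * int n} = (int j + int s) * (4 * int n - int j - int s - 1)"
    using double_sum_segment[OF T(2)] by (simp add: js algebra_simps)
  have arith: "2 * \<Sum>{T..<2 * int n} = 2 * (int s * int n) + 2 * \<Sum>{int n - int j..<int n}
      + 2 * \<Sum>{int n - int s..<int n} + 2 * ((int n - int s) * int j)"
    unfolding g1 g2 g3 by (simp add: algebra_simps)
  have "int (\<Sum>i\<in>A T. \<beta> i) = (\<Sum>i\<in>A T. int (\<beta> i))" by simp
  then show ?thesis
    using min threshold_sums(2)[OF T] sa sb arith by linarith
qed

text \<open>A discrete intermediate value argument: lowering the threshold by one admits at most one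
  new index, as \<open>a\<close> is injective.\<close>

lemma threshold_exists:
  assumes "j \<le> n"
  obtains T where "0 \<le> T" "T \<le> 2 * int n" "card (A T) = j"
proof -
  define f where "f k = int (card (A (2 * int n - int k)))" for k
  have range: "0 \<le> a i \<and> a i < 2 * int n" if "i \<in> {1..n}" for i
    using ab_range that by blast
  have step: "\<bar>f (k + 1) - f k\<bar> \<le> 1" for k
  proof -
    let ?N = "{i \<in> {1..n}. a i = 2 * int n - int k - 1}"
    have "A (2 * int n - int (k + 1)) = A (2 * int n - int k) \<union> ?N"
      by (auto simp: A_def)
    moreover have "A (2 * int n - int k) \<inter> ?N = {}" by (auto simp: A_def)
    moreover have "card ?N \<le> 1"
    proof -
      have "\<forall>x\<in>?N. \<forall>y\<in>?N. x = y" using inj_onD[OF inj_a] by simp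
      moreover have "finite ?N" by simp
      ultimately show ?thesis by (simp only: One_nat_def card_le_Suc0_iff_eq)
    qed
    ultimately show ?thesis by (simp add: f_def card_Un_disjoint)
  qed
  have "A (2 * int n) = {}" using range unfolding A_def by force
  then have f0: "f 0 \<le> int j" by (simp add: f_def)
  have "A 0 = {1..n}" using range unfolding A_def by blast
  then have fn: "int j \<le> f (2 * n)" using assms by (simp add: f_def)
  obtain k where "k \<le> 2 * n" "f k = int j"
    using nat0_intermed_int_val[of "2 * n" f "int j"] step f0 fn by auto
  then show thesis by (intro that[of "2 * int n - int k"]) (auto simp: f_def)
qed

lemma slack_nonneg:
  "(\<Sum>i\<in>A T. int i - 1) \<le> \<Sum>{int n - int (card (A T))..<int n}"
  "(\<Sum>i\<in>B T. int i - 1) \<le> \<Sum>{int n - int (card (B T))..<int n}"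
  by (rule sum_index_le_top, auto simp: A_def B_def)+

end

text \<open>As \<open>\<alpha>\<close> rearranges the conjugate of \<open>nu\<close>, its minima
  with \<open>j\<close> add up to the first \<open>j\<close> parts of \<open>nu\<close>, while any
  \<open>j\<close> entries of \<open>\<beta>\<close> add up to at most the first \<open>j\<close>
  parts of \<open>mu\<close>. If the partitions agree, nothing is left for the two
  differences.\<close>

lemma (in nonzero_pair) dominance:
  assumes nu: "nu \<in> partitions_of d" and mu: "mu \<in> partitions_of d" and d: "d \<le> n"
    and \<alpha>: "\<alpha> \<in> rearrangements n (conj_part nu)" and \<beta>: "\<beta> \<in> rearrangements n mu"
  shows "dominance_le nu mu"
    and "nu = mu \<Longrightarrow> 0 \<le> T \<Longrightarrow> T \<le> 2 * int n \<Longrightarrow>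
      (\<Sum>i\<in>A T. int i - 1) = \<Sum>{int n - int (card (A T))..<int n} \<and>
      (\<Sum>i\<in>B T. int i - 1) = \<Sum>{int n - int (card (B T))..<int n}"
proof -
  have kap: "conj_part nu \<in> partitions_of d" by (rule conj_part_partition[OF nu])
  have min: "(\<Sum>i=1..n. min (\<alpha> i) j) = (\<Sum>i=1..j. part nu i)" for j
  proof -
    have "(\<Sum>i=1..n. min (\<alpha> i) j) = (\<Sum>i=1..n. min (part (conj_part nu) i) j)"
      by (rule sum_rearrangement_comp[OF \<alpha>])
    also have "\<dots> = (\<Sum>k=1..j. part (conj_part (conj_part nu)) k)"
      by (rule sum_conj_count[OF partitions_of_D(1)[OF kap]]) (use length_partition_le[OF kap] d in simp)
    finally show ?thesis by (simp only: conj_conj_part[OF nu])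
  qed
  have le: "(\<Sum>i\<in>A T. \<beta> i) \<le> (\<Sum>i=1..card (A T). part mu i)" for T
    by (rule sum_rearrangement_subset[OF \<beta> partitions_of_D(1)[OF mu]]) (auto simp: A_def)
  have ineq: "int (\<Sum>i=1..card (A T). part nu i) + (\<Sum>{int n - int (card (A T))..<int n} - (\<Sum>i\<in>A T. int i - 1)) +
    (\<Sum>{int n - int (card (B T))..<int n} - (\<Sum>i\<in>B T. int i - 1)) \<le> int (\<Sum>i=1..card (A T). part mu i)"
    if "0 \<le> T" "T \<le> 2 * int n" for T
  proof -
    have "int (\<Sum>i\<in>A T. \<beta> i) \<le> int (\<Sum>i=1..card (A T). part mu i)" using le by (simp only: of_nat_le_iff)
    then show ?thesis using threshold_ineq[OF that] unfolding min by linarith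
  qed
  show "dominance_le nu mu"
    unfolding dominance_le_def
  proof (intro conjI allI)
    show "sum_list nu = sum_list mu" using partitions_of_D(3)[OF nu] partitions_of_D(3)[OF mu] by simp
    fix j
    show "(\<Sum>k=1..j. part nu k) \<le> (\<Sum>k=1..j. part mu k)"
    proof (cases "j \<le> n")
      case True
      then obtain T where T: "0 \<le> T" "T \<le> 2 * int n" "card (A T) = j" by (rule threshold_exists)
      have "int (\<Sum>k=1..j. part nu k) \<le> int (\<Sum>k=1..j. part mu k)"
        using ineq[OF T(1,2)] slack_nonneg[of T] unfolding T(3) by linarith
      then show ?thesis by (simp only: of_nat_le_iff)
    next
      case False
      then show ?thesis using partial_sum_beyond[OF nu, of j] partial_sum_beyond[OF mu, of j] d by simp
    qed
  qed
  assume eq: "nu = mu" and T: "0 \<le> T" "T \<le> 2 * int n"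
  show "(\<Sum>i\<in>A T. int i - 1) = \<Sum>{int n - int (card (A T))..<int n} \<and>
      (\<Sum>i\<in>B T. int i - 1) = \<Sum>{int n - int (card (B T))..<int n}"
    using ineq[OF T] slack_nonneg[of T] unfolding eq by linarith
qed

text \<open>All threshold sets are now final segments of {1, ..., n}. The set for the threshold
  \<open>a i\<close> contains \<open>i\<close>, hence also every later \<open>j\<close>.\<close>

lemma (in nonzero_pair) increasing:
  assumes mu: "mu \<in> partitions_of d" and d: "d \<le> n"
    and \<alpha>: "\<alpha> \<in> rearrangements n (conj_part mu)" and \<beta>: "\<beta> \<in> rearrangements n mu"
    and ij: "i \<in> {1..n}" "j \<in> {1..n}" "i < j"
  shows "a i < a j" "b i < b j"
proof -
  note top = dominance(2)[OF mu mu d \<alpha> \<beta> refl]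
  have range: "0 \<le> a i" "a i < 2 * int n" "0 \<le> b i" "b i < 2 * int n"
    using ab_range[OF ij(1)] by simp_all
  have "i \<in> A (a i)" "i \<in> B (b i)" using ij by (auto simp: A_def B_def)
  moreover have "x \<in> A (a i) \<longleftrightarrow> n - card (A (a i)) < x \<and> x \<le> n" for x
    by (rule top_if_sum_eq) (use top[of "a i"] range in \<open>auto simp: A_def\<close>)
  moreover have "x \<in> B (b i) \<longleftrightarrow> n - card (B (b i)) < x \<and> x \<le> n" for x
    by (rule top_if_sum_eq) (use top[of "b i"] range in \<open>auto simp: B_def\<close>)
  ultimately have "j \<in> A (a i)" "j \<in> B (b i)" using ij by auto
  then have "a i \<le> a j" "b i \<le> b j" by (auto simp: A_def B_def)
  moreover have "a i \<noteq> a j" "b i \<noteq> b j"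
    using inj_onD[OF inj_a _ ij(1,2)] inj_onD[OF inj_b _ ij(1,2)] ij(3) by auto
  ultimately show "a i < a j" "b i < b j" by auto
qed

section \<open>The single diagonal term and its sign\<close>

lemma rearrangement_antimono:
  assumes \<alpha>: "\<alpha> \<in> rearrangements n nu" and nu: "nu \<in> partitions_of d"
    and anti: "\<And>i. 1 \<le> i \<Longrightarrow> i < n \<Longrightarrow> \<alpha> (Suc i) \<le> \<alpha> i"
  shows "\<alpha> = part nu"
proof -
  obtain \<pi> where \<pi>: "\<pi> permutes {1..n}" "\<alpha> = part nu \<circ> \<pi>" "length nu \<le> n"
    using \<alpha> by (auto simp: rearrangements_def split: if_splits)
  have anti': "\<alpha> j \<le> \<alpha> i" if "1 \<le> i" "i \<le> j" for i j
  proof (cases "j \<le> n")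
    case True
    from that(2) True show ?thesis
    proof (induction j rule: dec_induct)
      case (step j)
      then show ?case using anti[of j] that(1) by fastforce
    qed simp
  next
    case False
    then show ?thesis using rearrangements_outside[OF \<alpha>, of j] by simp
  qed
  define \<rho> where "\<rho> = inv_into UNIV \<pi>"
  have \<rho>: "\<rho> permutes {1..n}" unfolding \<rho>_def by (rule permutes_inv[OF \<pi>(1)])
  have part: "part nu i = \<alpha> (\<rho> i)" for i
    using permutes_inverses(1)[OF \<pi>(1)] by (simp add: \<pi>(2) \<rho>_def)
  have sums: "(\<Sum>i=1..k. \<alpha> i) = (\<Sum>i=1..k. part nu i)" if "k \<le> n" for k
  proof (rule antisym)
    show "(\<Sum>i=1..k. \<alpha> i) \<le> (\<Sum>i=1..k. part nu i)"
      using sum_rearrangement_subset[OF \<alpha> partitions_of_D(1)[OF nu], of "{1..k}"] that by simp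
    have inj: "inj_on \<rho> {1..k}" by (rule permutes_inj_on[OF \<rho>])
    have "(\<Sum>i=1..k. part nu i) = (\<Sum>i\<in>\<rho> ` {1..k}. \<alpha> i)"
      by (simp only: sum.reindex[OF inj] part comp_def)
    also have "\<dots> \<le> (\<Sum>i=1..card (\<rho> ` {1..k}). \<alpha> i)"
    proof (rule sum_antimono_le[OF anti'])
      show "0 \<notin> \<rho> ` {1..k}"
      proof
        assume "0 \<in> \<rho> ` {1..k}"
        then obtain i where i: "i \<in> {1..k}" "0 = \<rho> i" by (rule imageE)
        then have "i \<in> {1..n}" "\<rho> i = 0" using that by simp_all
        then show False using permutes_in_image[OF \<rho>, of i] by simp
      qed
    qed simp_all
    finally show "(\<Sum>i=1..k. part nu i) \<le> (\<Sum>i=1..k. \<alpha> i)"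
      unfolding card_image[OF inj] card_atLeastAtMost by simp
  qed
  show ?thesis
  proof
    fix i
    show "\<alpha> i = part nu i"
    proof (cases "i \<in> {1..n}")
      case True
      then obtain k where "i = Suc k" by (cases i) auto
      then show ?thesis using sums[of i] sums[of k] True by simp
    next
      case False
      then show ?thesis using rearrangements_outside[OF \<alpha>] \<pi>(3) by (auto simp: part_outside)
    qed
  qed
qed

definition rev_part :: "nat \<Rightarrow> nat list \<Rightarrow> nat \<Rightarrow> nat" where
  "rev_part n mu i = (if i \<in> {1..n} then part mu (n + 1 - i) else 0)"

lemma reflect_permutes: "(\<lambda>i. if i \<in> {1..n} then n + 1 - i else i) permutes {1..n::nat}"
  by (rule bij_imp_permutes)
    (auto intro!: bij_betwI[where g = "\<lambda>i. if i \<in> {1..n} then n + 1 - i else i"])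

lemma rev_part_rearrangement:
  assumes "length mu \<le> n"
  shows "rev_part n mu \<in> rearrangements n mu"
proof -
  have "rev_part n mu = part mu \<circ> (\<lambda>i. if i \<in> {1..n} then n + 1 - i else i)"
    using assms by (auto simp: rev_part_def part_outside fun_eq_iff)
  then show ?thesis using assms reflect_permutes[of n] unfolding rearrangements_def by auto
qed

lemma rearrangement_mono:
  assumes \<beta>: "\<beta> \<in> rearrangements n mu" and mu: "mu \<in> partitions_of d"
    and mono: "\<And>i. 1 \<le> i \<Longrightarrow> i < n \<Longrightarrow> \<beta> i \<le> \<beta> (Suc i)"
  shows "\<beta> = rev_part n mu"
proof -
  let ?r = "\<lambda>i. if i \<in> {1..n} then n + 1 - i else i"
  obtain \<pi> where \<pi>: "\<pi> permutes {1..n}" "\<beta> = part mu \<circ> \<pi>" "length mu \<le> n"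
    using \<beta> by (auto simp: rearrangements_def split: if_splits)
  have "\<beta> \<circ> ?r = part mu \<circ> (\<pi> \<circ> ?r)" by (simp add: \<pi>(2) comp_assoc)
  then have r: "\<beta> \<circ> ?r \<in> rearrangements n mu"
    using \<pi>(3) permutes_compose[OF reflect_permutes \<pi>(1)] unfolding rearrangements_def by auto
  have eq: "\<beta> \<circ> ?r = part mu"
  proof (rule rearrangement_antimono[OF r mu])
    fix i assume i: "1 \<le> i" "i < n"
    then show "(\<beta> \<circ> ?r) (Suc i) \<le> (\<beta> \<circ> ?r) i"
      using mono[of "n - i"] by (simp add: Suc_diff_le)
  qed
  show ?thesis
  proof
    fix i
    show "\<beta> i = rev_part n mu i"
    proof (cases "i \<in> {1..n}")
      case True
      then have "?r (n + 1 - i) = i" by auto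
      then have "\<beta> i = part mu (n + 1 - i)"
        using fun_cong[OF eq, of "n + 1 - i"] by (simp only: comp_apply)
      then show ?thesis using True by (simp add: rev_part_def)
    next
      case False
      then show ?thesis using rearrangements_outside[OF \<beta>] by (auto simp: rev_part_def)
    qed
  qed
qed

lemma increasing_enumeration:
  fixes f :: "nat \<Rightarrow> int"
  assumes inc: "\<And>i. 1 \<le> i \<Longrightarrow> i < n \<Longrightarrow> f i < f (Suc i)"
    and range: "\<And>i. i \<in> {1..n} \<Longrightarrow> v \<le> f i \<and> f i < v + int n"
    and i: "i \<in> {1..n}"
  shows "f i = v + int i - 1"
proof (rule antisym)
  have i': "1 \<le> i" "i \<le> n" using i by auto
  show "f i \<le> v + int i - 1"
    using i'(2)
  proof (induction rule: inc_induct)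
    case base
    show ?case using range[of n] i' by simp
  next
    case (step k)
    then show ?case using inc[of k] i' by simp
  qed
  show "v + int i - 1 \<le> f i"
    using i'
  proof (induction i rule: dec_induct)
    case base
    then show ?case using range[of 1] by simp
  next
    case (step k)
    then show ?case using inc[of k] by simp
  qed
qed

text \<open>Increasing values below \<open>n\<close> in the first half must be 0, ..., n-1, and the
  second half has to take the remaining values in order.\<close>

lemma alt_sign_if_small:
  assumes nz: "alt_sign (2 * n) c \<noteq> 0"
    and inc1: "\<And>i. 1 \<le> i \<Longrightarrow> i < n \<Longrightarrow> lookup c i < lookup c (Suc i)"
    and inc2: "\<And>i. 1 \<le> i \<Longrightarrow> i < n \<Longrightarrow> lookup c (n + i) < lookup c (n + Suc i)"
    and small: "\<And>i. i \<in> {1..n} \<Longrightarrow> lookup c i < int n"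
  shows "c = rho_expo (2 * n)"
proof (rule poly_mapping_eqI)
  have range: "0 \<le> lookup c i \<and> lookup c i < 2 * int n" if "i \<in> {1..2 * n}" for i
  proof -
    have "lookup c i \<in> {0..<int (2 * n)}" using that unfolding alt_sign_support(2)[OF nz, symmetric] by blast
    then show ?thesis by simp
  qed
  have low: "lookup c i = 0 + int i - 1" if "i \<in> {1..n}" for i
  proof (rule increasing_enumeration[where n = n])
    fix i assume "i \<in> {1..n}"
    then show "0 \<le> lookup c i \<and> lookup c i < 0 + int n" using range[of i] small[of i] by simp
  qed (use inc1 that in auto)
  have high: "lookup c (n + i) = int n + int i - 1" if "i \<in> {1..n}" for i
  proof (rule increasing_enumeration[where n = n and f = "\<lambda>i. lookup c (n + i)"])
    fix j assume j: "j \<in> {1..n}"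
    have "int n \<le> lookup c (n + j)"
    proof (rule ccontr)
      assume less: "\<not> int n \<le> lookup c (n + j)"
      define k where "k = Suc (nat (lookup c (n + j)))"
      have "0 \<le> lookup c (n + j)" using range[of "n + j"] j by simp
      then have k: "k \<in> {1..n}" "lookup c k = lookup c (n + j)"
        using less low[of k] by (auto simp: k_def)
      then show False using inj_onD[OF alt_sign_support(1)[OF nz] k(2)] j by auto
    qed
    then show "int n \<le> lookup c (n + j) \<and> lookup c (n + j) < int n + int n" using range[of "n + j"] j by simp
  qed (use inc2 that in auto)
  fix i
  consider "i \<in> {1..n}" | j where "j \<in> {1..n}" "i = n + j" | "i \<notin> {1..2 * n}"
  proof (cases "i \<le> n")
    case False
    then have "i = n + (i - n)" by simp
    then show thesis using that(2)[of "i - n"] that(3) False by fastforce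
  qed (use that in fastforce)
  then show "lookup c i = lookup (rho_expo (2 * n)) i"
    using low high alt_sign_support(3)[OF nz] by cases (auto simp: lookup_rho)
qed

text \<open>The excess \<open>m\<close> is removed in unit steps: a value of the first half whose
  predecessor sits in the second half is exchanged with it. Both halves stay increasing, the sign
  changes, and the sum over the first half drops by one.\<close>

lemma alt_sign_increasing:
  assumes "alt_sign (2 * n) c \<noteq> 0"
    and "\<And>i. 1 \<le> i \<Longrightarrow> i < n \<Longrightarrow> lookup c i < lookup c (Suc i)"
    and "\<And>i. 1 \<le> i \<Longrightarrow> i < n \<Longrightarrow> lookup c (n + i) < lookup c (n + Suc i)"
    and "(\<Sum>i=1..n. lookup c i) = (\<Sum>i=1..n. int i - 1) + int m"
  shows "alt_sign (2 * n) c = (-1) ^ m"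
  using assms
proof (induction m arbitrary: c)
  case 0
  note supp = alt_sign_support[OF 0(1)]
  define A where "A = lookup c ` {1..n}"
  have inj: "inj_on (lookup c) {1..n}" by (rule inj_on_subset[OF supp(1)]) auto
  have fA: "finite A" by (simp add: A_def)
  have cA: "card A = n" using card_image[OF inj] by (simp add: A_def)
  have "\<Sum>A = (\<Sum>i=1..n. int i - 1)"
    using 0(4) sum.reindex[OF inj, of "\<lambda>x. x"] by (simp add: A_def comp_def)
  also have "\<dots> = \<Sum>{0..<int n}"
    by (rule sum.reindex_bij_witness[of _ "\<lambda>x. nat (x + 1)" "\<lambda>i. int i - 1"]) auto
  finally have "A = {0..<int (card A)}"
  proof (intro initial_segment_if_small_sum)
    fix x assume "x \<in> A"
    then have "x \<in> lookup c ` {1..2 * n}" by (auto simp: A_def)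
    then show "0 \<le> x" unfolding supp(2) by simp
  qed (simp_all add: fA cA)
  then have small: "lookup c i < int n" if "i \<in> {1..n}" for i
  proof -
    have "lookup c i \<in> A" using that by (simp add: A_def)
    also note \<open>A = {0..<int (card A)}\<close>
    finally show ?thesis by (simp add: cA)
  qed
  have "c = rho_expo (2 * n)" by (rule alt_sign_if_small[OF 0(1-3) small])
  then show ?case by (simp add: alt_sign_rho)
next
  case (Suc m)
  note supp = alt_sign_support[OF Suc.prems(1)]
  have inj: "inj_on (lookup c) {1..n}" by (rule inj_on_subset[OF supp(1)]) auto
  have nonneg: "0 \<le> lookup c i" if "i \<in> {1..2 * n}" for i
  proof -
    have "lookup c i \<in> {0..<int (2 * n)}" using that unfolding supp(2)[symmetric] by blast
    then show ?thesis by simp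
  qed
  have "\<exists>i0\<in>{1..n}. \<not> lookup c i0 < int n"
  proof (rule ccontr)
    assume "\<not> ?thesis"
    then have small: "lookup c i < int n" if "i \<in> {1..n}" for i using that by blast
    have "c = rho_expo (2 * n)" by (rule alt_sign_if_small[OF Suc.prems(1-3) small])
    then have "(\<Sum>i=1..n. lookup c i) = (\<Sum>i=1..n. int i - 1)"
      by (auto simp: lookup_rho intro!: sum.cong)
    then show False using Suc.prems(4) by simp
  qed
  then obtain i0 where i0: "i0 \<in> {1..n}" "\<not> lookup c i0 < int n" by blast
  \<comment> \<open>Otherwise the values of the first half would be closed under predecessors.
    Starting from the value at \<open>i0\<close>, which is at least \<open>n\<close>, they would
    include 0, ..., n, one value too many.\<close>
  have "\<exists>i\<in>{1..n}. 1 \<le> lookup c i \<and> lookup c i - 1 \<notin> lookup c ` {1..n}"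
  proof (rule ccontr)
    assume neg: "\<not> ?thesis"
    have down: "x - 1 \<in> lookup c ` {1..n}" if "x \<in> lookup c ` {1..n}" "1 \<le> x" for x
      using that neg by blast
    have "int n - int k \<in> lookup c ` {1..n}" if "k \<le> n" for k
      using that
    proof (induction k)
      case 0
      have "lookup c i0 - int j \<in> lookup c ` {1..n}" if "int j \<le> lookup c i0" for j
        using that
      proof (induction j)
        case (Suc j)
        then show ?case using down[of "lookup c i0 - int j"] by (simp add: algebra_simps)
      qed (use i0 in simp)
      from this[of "nat (lookup c i0 - int n)"] show ?case using i0(2) by simp
    next
      case (Suc k)
      then show ?case using down[of "int n - int k"] by (simp add: algebra_simps)
    qed
    then have "(\<lambda>k. int n - int k) ` {0..n} \<subseteq> lookup c ` {1..n}" by auto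
    then have "card ((\<lambda>k. int n - int k) ` {0..n}) \<le> card (lookup c ` {1..n})" by (rule card_mono[rotated]) simp
    moreover have "card ((\<lambda>k. int n - int k) ` {0..n}) = n + 1" by (subst card_image) (auto simp: inj_on_def)
    moreover have "card (lookup c ` {1..n}) \<le> n" using card_image_le[of "{1..n}" "lookup c"] by simp
    ultimately show False by simp
  qed
  then obtain i where i: "i \<in> {1..n}" "1 \<le> lookup c i" "lookup c i - 1 \<notin> lookup c ` {1..n}"
    by blast
  have "lookup c i < int (2 * n)"
  proof -
    have "lookup c i \<in> {0..<int (2 * n)}" using i(1) unfolding supp(2)[symmetric] by simp
    then show ?thesis by simp
  qed
  then have "lookup c i - 1 \<in> {0..<int (2 * n)}" using i(2) by simp
  then obtain k where k: "k \<in> {1..2 * n}" "lookup c k = lookup c i - 1"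
    unfolding supp(2)[symmetric] by (metis imageE)
  have "k \<notin> {1..n}" using k(2) i(3) by (metis imageI)
  then have kn: "n < k" "k \<le> 2 * n" using k(1) by auto
  define c' where "c' = perm_expo (Transposition.transpose i k) c"
  have l: "lookup c' j = (if j = i then lookup c i - 1 else if j = k then lookup c i else lookup c j)" for j
    using k(2) by (auto simp: c'_def lookup_perm_expo Transposition.transpose_def)
  have ik: "i \<in> {1..2 * n}" "i \<noteq> k" using i(1) kn by auto
  have sign: "alt_sign (2 * n) c' = - alt_sign (2 * n) c"
    unfolding c'_def by (rule alt_sign_transpose[OF ik(1) k(1) ik(2)])
  have diff: "lookup c j \<noteq> lookup c i" if "j \<in> {1..2 * n}" "j \<noteq> i" for j
    using inj_onD[OF supp(1) _ that(1) ik(1)] that(2) by blast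
  have diff': "lookup c j \<noteq> lookup c k" if "j \<in> {1..2 * n}" "j \<noteq> k" for j
    using inj_onD[OF supp(1) _ that(1) k(1)] that(2) by blast
  have "alt_sign (2 * n) c' = (-1) ^ m"
  proof (rule Suc.IH)
    show "alt_sign (2 * n) c' \<noteq> 0" using sign Suc.prems(1) by simp
    fix j assume j: "1 \<le> j" "j < n"
    have "lookup c j < lookup c (Suc j)" by (rule Suc.prems(2)[OF j])
    moreover have "lookup c j \<noteq> lookup c k" using diff'[of j] j kn by auto
    ultimately show "lookup c' j < lookup c' (Suc j)"
      using j kn k(2) by (auto simp: l)
    have "lookup c (n + j) < lookup c (n + Suc j)" by (rule Suc.prems(3)[OF j])
    moreover have "lookup c (n + Suc j) \<noteq> lookup c i" using diff[of "n + Suc j"] j i(1) by auto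
    ultimately show "lookup c' (n + j) < lookup c' (n + Suc j)"
      using j i(1) k(2) by (auto simp: l)
  next
    have "(\<Sum>j=1..n. lookup c' j) = (\<Sum>j=1..n. lookup c j - (if j = i then 1 else 0))"
      by (rule sum.cong) (use kn in \<open>auto simp: l\<close>)
    also have "\<dots> = (\<Sum>j=1..n. lookup c j) - 1" using i(1) by (simp add: sum_subtractf)
    finally show "(\<Sum>j=1..n. lookup c' j) = (\<Sum>i=1..n. int i - 1) + int m"
      using Suc.prems(4) by simp
  qed
  then show ?case using sign by simp
qed

text \<open>The classical complementarity of a partition and its conjugate. With
  \<open>k = n + 1 - i\<close>, the values mu_k + n - k and n + j - 1 - mu'_j never meet: the first
  is larger if the cell (k, j) lies in the diagram and smaller if it does not.\<close>

lemma pair_state_conj_nonzero: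
  assumes mu: "mu \<in> partitions_of d" and d: "d \<le> n"
  shows "alt_sign (2 * n) (pair_state n (part (conj_part mu)) (rev_part n mu)) \<noteq> 0"
proof -
  let ?c = "pair_state n (part (conj_part mu)) (rev_part n mu)"
  note c = conj_part_partition[OF mu]
  have le: "part mu i \<le> n" "part (conj_part mu) i \<le> n" for i
    using part_le_sum_list[of mu i] part_le_sum_list[of "conj_part mu" i] partitions_of_D(3)[OF mu]
      partitions_of_D(3)[OF c] d by simp_all
  have low: "lookup ?c i = int i - 1 + int (part mu (n + 1 - i))" if "i \<in> {1..n}" for i
    unfolding lookup_pair_state(1)[OF that] using that by (simp add: rev_part_def)
  have high: "lookup ?c (n + i) = int n + int i - 1 - int (part (conj_part mu) i)" if "i \<in> {1..n}" for i
    by (rule lookup_pair_state(2)[OF that])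
  have cross: "lookup ?c i \<noteq> lookup ?c (n + j)" if "i \<in> {1..n}" "j \<in> {1..n}" for i j
  proof -
    define k where "k = n + 1 - i"
    have k: "1 \<le> k" "int i = int n + 1 - int k" "1 \<le> j" using that by (auto simp: k_def)
    show ?thesis
      using le_part_conj_iff[OF partitions_of_D(1)[OF mu] k(1,3)] that k
      unfolding low[OF that(1)] high[OF that(2)] k_def[symmetric]
      by (cases "j \<le> part mu k") auto
  qed
  have mono1: "lookup ?c i < lookup ?c j" if "i \<in> {1..n}" "j \<in> {1..n}" "i < j" for i j
  proof -
    have "part mu (n + 1 - i) \<le> part mu (n + 1 - j)"
      by (rule part_antimono[OF partitions_of_D(1)[OF mu]]) (use that in auto)
    then show ?thesis using that(3) unfolding low[OF that(1)] low[OF that(2)] by linarith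
  qed
  have mono2: "lookup ?c (n + i) < lookup ?c (n + j)" if "i \<in> {1..n}" "j \<in> {1..n}" "i < j" for i j
  proof -
    have "part (conj_part mu) j \<le> part (conj_part mu) i"
      by (rule part_antimono[OF partitions_of_D(1)[OF c]]) (use that in auto)
    then show ?thesis using that(3) unfolding high[OF that(1)] high[OF that(2)] by linarith
  qed
  have split: "i \<in> {1..n} \<or> (\<exists>j\<in>{1..n}. i = n + j)" if "i \<in> {1..2 * n}" for i
  proof (cases "i \<le> n")
    case False
    then show ?thesis using that by (intro disjI2 bexI[of _ "i - n"]) auto
  qed (use that in simp)
  have neq: "lookup ?c i \<noteq> lookup ?c j" if ij: "i \<in> {1..2 * n}" "j \<in> {1..2 * n}" "i < j" for i j
  proof (cases "i \<in> {1..n}")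
    case True
    show ?thesis
    proof (cases "j \<in> {1..n}")
      case False
      then obtain j' where "j' \<in> {1..n}" "j = n + j'" using split[OF ij(2)] by blast
      then show ?thesis using cross[OF True] by blast
    qed (use mono1[OF True _ ij(3)] in fastforce)
  next
    case False
    then obtain i' where i': "i' \<in> {1..n}" "i = n + i'" using split[OF ij(1)] by blast
    then have "j \<notin> {1..n}" using ij(3) by auto
    then obtain j' where j': "j' \<in> {1..n}" "j = n + j'" using split[OF ij(2)] by blast
    show ?thesis using mono2[OF i'(1) j'(1)] ij(3) i' j' by auto
  qed
  have inj: "inj_on (lookup ?c) {1..2 * n}"
    by (rule linorder_inj_onI) (use neq in auto)
  have "lookup ?c ` {1..2 * n} \<subseteq> {0..<int (2 * n)}"
  proof
    fix x assume "x \<in> lookup ?c ` {1..2 * n}"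
    then obtain i where i: "i \<in> {1..2 * n}" "x = lookup ?c i" by blast
    from split[OF i(1)] show "x \<in> {0..<int (2 * n)}"
    proof
      assume "i \<in> {1..n}"
      then show ?thesis using low[of i] le(1)[of "n + 1 - i"] i(2) by auto
    next
      assume "\<exists>j\<in>{1..n}. i = n + j"
      then obtain j where "j \<in> {1..n}" "i = n + j" by blast
      then show ?thesis using high[of j] le(2)[of j] i(2) by auto
    qed
  qed
  then have "lookup ?c ` {1..2 * n} = {0..<int (2 * n)}"
  proof (rule card_subset_eq[rotated])
    show "card (lookup ?c ` {1..2 * n}) = card {0..<int (2 * n)}"
      unfolding card_image[OF inj] by simp
  qed simp
  then obtain \<pi> where "\<pi> permutes {1..2 * n}" "?c = perm_expo \<pi> (rho_expo (2 * n))"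
    by (rule perm_rho_ex[OF inj _ lookup_pair_state(3)])
  then show ?thesis using alt_sign_perm by simp
qed

lemma pair_state_diagonal:
  assumes mu: "mu \<in> partitions_of d" and d: "d \<le> n"
    and \<alpha>: "\<alpha> \<in> rearrangements n (conj_part mu)" and \<beta>: "\<beta> \<in> rearrangements n mu"
  shows "alt_sign (2 * n) (pair_state n \<alpha> \<beta>) =
    (if \<alpha> = part (conj_part mu) \<and> \<beta> = rev_part n mu then (-1) ^ d else 0)"
proof -
  have main: "\<alpha> = part (conj_part mu) \<and> \<beta> = rev_part n mu \<and> alt_sign (2 * n) (pair_state n \<alpha> \<beta>) = (-1) ^ d"
    if nz: "alt_sign (2 * n) (pair_state n \<alpha> \<beta>) \<noteq> 0"
  proof -
    interpret nonzero_pair n \<alpha> \<beta> by unfold_locales (rule nz)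
    note inc = increasing[OF mu d \<alpha> \<beta>]
    have "\<alpha> = part (conj_part mu)"
    proof (rule rearrangement_antimono[OF \<alpha> conj_part_partition[OF mu]])
      fix i assume "1 \<le> i" "i < n"
      then show "\<alpha> (Suc i) \<le> \<alpha> i" using inc(2)[of i "Suc i"] by simp
    qed
    moreover have "\<beta> = rev_part n mu"
    proof (rule rearrangement_mono[OF \<beta> mu])
      fix i assume "1 \<le> i" "i < n"
      then show "\<beta> i \<le> \<beta> (Suc i)" using inc(1)[of i "Suc i"] by simp
    qed
    moreover have "alt_sign (2 * n) (pair_state n \<alpha> \<beta>) = (-1) ^ d"
    proof (rule alt_sign_increasing[OF nz])
      fix i assume i: "1 \<le> i" "i < n"
      show "lookup (pair_state n \<alpha> \<beta>) i < lookup (pair_state n \<alpha> \<beta>) (Suc i)"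
        using inc(1)[of i "Suc i"] vals(1)[of i] vals(1)[of "Suc i"] i by simp
      show "lookup (pair_state n \<alpha> \<beta>) (n + i) < lookup (pair_state n \<alpha> \<beta>) (n + Suc i)"
        using inc(2)[of i "Suc i"] vals(2)[of i] vals(2)[of "Suc i"] i by simp
    next
      have "(\<Sum>i=1..n. lookup (pair_state n \<alpha> \<beta>) i) = (\<Sum>i=1..n. (int i - 1) + int (\<beta> i))"
        by (rule sum.cong[OF refl]) (rule vals(1))
      also have "\<dots> = (\<Sum>i=1..n. int i - 1) + int (\<Sum>i=1..n. \<beta> i)"
        by (simp add: sum.distrib)
      also have "(\<Sum>i=1..n. \<beta> i) = d"
        using sum_rearrangement[OF \<beta>] partitions_of_D(3)[OF mu] by simp
      finally show "(\<Sum>i=1..n. lookup (pair_state n \<alpha> \<beta>) i) = (\<Sum>i=1..n. int i - 1) + int d" .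
    qed
    ultimately show ?thesis by blast
  qed
  show ?thesis
  proof (cases "\<alpha> = part (conj_part mu) \<and> \<beta> = rev_part n mu")
    case True
    then show ?thesis using main pair_state_conj_nonzero[OF mu d] by simp
  next
    case False
    then have "alt_sign (2 * n) (pair_state n \<alpha> \<beta>) = 0" using main by blast
    then show ?thesis by (simp only: False if_False)
  qed
qed

section \<open>The brackets on monomial symmetric polynomials\<close>

lemma prod_var_eq: "(\<Prod>i=1..n. var i ^ \<alpha> i) = xmon (nexp n \<alpha>)"
  unfolding nexp_def fexp_def by (simp add: var_power xmon_sum)

lemma monomial_sym_eq: "monomial_sym n mu = (\<Sum>\<alpha>\<in>rearrangements n mu. xmon (nexp n \<alpha>))"
  by (simp only: monomial_sym_def prod_var_eq)

lemma lin_monomial_sym: "lin \<Phi> (monomial_sym n mu) = (\<Sum>\<alpha>\<in>rearrangements n mu. \<Phi> (nexp n \<alpha>))"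
  by (simp add: monomial_sym_eq lin_sum)

text \<open>Up to sign, the pairing of a single \<open>s_\<alpha>\<close> with \<omega> applied to
  \<open>monomial_sym n mu\<close>; \<open>form\<close> and \<open>wform\<close> sum it over
  rearrangements without and with weights.\<close>

definition pair_sum :: "nat \<Rightarrow> nat list \<Rightarrow> (nat \<Rightarrow> nat) \<Rightarrow> qtfield" where
  "pair_sum n mu \<alpha> = (\<Sum>\<beta>\<in>rearrangements n mu. altq n (pair_state n \<alpha> \<beta>))"

lemma alt_kernel_monomial:
  "alt_kernel n (monomial_sym n mu) (rho_expo (2 * n) - shift n (nexp n \<alpha>)) = pair_sum n mu \<alpha>"
  by (simp add: alt_kernel_def lin_monomial_sym pair_sum_def pair_state_def)

lemma form_monomial:
  "form n (monomial_sym n nu) (monomial_sym n mu) = (\<Sum>\<alpha>\<in>rearrangements n nu. pair_sum n mu \<alpha>)"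
  by (simp add: form_def lin_monomial_sym alt_kernel_monomial)

lemma lookup_nexp: "lookup (nexp n \<alpha>) i = (if i \<in> {1..n} then int (\<alpha> i) else 0)"
  by (simp add: nexp_def lookup_fexp)

lemma wform_monomial:
  "wform n (monomial_sym n nu) (monomial_sym n mu) =
    (\<Sum>\<alpha>\<in>rearrangements n nu. tq_size n \<alpha> * pair_sum n mu \<alpha>)"
proof -
  have "wform n (monomial_sym n nu) (monomial_sym n mu) =
      (\<Sum>i=1..n. \<Sum>\<alpha>\<in>rearrangements n nu. t_par ^ \<alpha> i * q_par ^ (n - i) * pair_sum n mu \<alpha>)"
    unfolding wform_def lin_monomial_sym alt_kernel_monomial sum_distrib_left
    by (intro sum.cong refl) (simp add: lookup_nexp)
  also have "\<dots> = (\<Sum>\<alpha>\<in>rearrangements n nu. tq_size n \<alpha> * pair_sum n mu \<alpha>)"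
    unfolding tq_size_def sum_distrib_right by (rule sum.swap)
  finally show ?thesis .
qed

lemma pair_sum_dominance:
  assumes "nu \<in> partitions_of d" "mu \<in> partitions_of d" "d \<le> n"
    and "\<alpha> \<in> rearrangements n (conj_part nu)" "pair_sum n mu \<alpha> \<noteq> 0"
  shows "dominance_le nu mu"
proof -
  obtain \<beta> where \<beta>: "\<beta> \<in> rearrangements n mu" "altq n (pair_state n \<alpha> \<beta>) \<noteq> 0"
    using assms(5) unfolding pair_sum_def by (rule sum.not_neutral_contains_not_neutral)
  then interpret nonzero_pair n \<alpha> \<beta> by unfold_locales simp
  show ?thesis by (rule dominance(1)[OF assms(1-4) \<beta>(1)])
qed

lemma form_dominance:
  assumes "nu \<in> partitions_of d" "mu \<in> partitions_of d" "d \<le> n" "\<not> dominance_le nu mu"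
  shows "form n (monomial_sym n (conj_part nu)) (monomial_sym n mu) = 0"
    and "wform n (monomial_sym n (conj_part nu)) (monomial_sym n mu) = 0"
proof -
  have "pair_sum n mu \<alpha> = 0" if "\<alpha> \<in> rearrangements n (conj_part nu)" for \<alpha>
    using pair_sum_dominance[OF assms(1-3) that] assms(4) by blast
  then show "form n (monomial_sym n (conj_part nu)) (monomial_sym n mu) = 0"
    and "wform n (monomial_sym n (conj_part nu)) (monomial_sym n mu) = 0"
    unfolding form_monomial wform_monomial by simp_all
qed

lemma pair_sum_diagonal:
  assumes "mu \<in> partitions_of d" "d \<le> n" "\<alpha> \<in> rearrangements n (conj_part mu)"
  shows "pair_sum n mu \<alpha> = (if \<alpha> = part (conj_part mu) then (-1) ^ d else 0)"
proof -
  have len: "length mu \<le> n" using length_partition_le[OF assms(1)] assms(2) by simp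
  have "pair_sum n mu \<alpha> = (\<Sum>\<beta>\<in>rearrangements n mu.
      if \<beta> = rev_part n mu then (if \<alpha> = part (conj_part mu) then (-1) ^ d else 0) else 0)"
    unfolding pair_sum_def
  proof (intro sum.cong refl)
    fix \<beta> assume "\<beta> \<in> rearrangements n mu"
    from pair_state_diagonal[OF assms this] show "altq n (pair_state n \<alpha> \<beta>) =
      (if \<beta> = rev_part n mu then (if \<alpha> = part (conj_part mu) then (-1) ^ d else 0) else 0)"
      by simp
  qed
  then show ?thesis using rev_part_rearrangement[OF len] finite_rearrangements by simp
qed

lemma form_diagonal:
  assumes "mu \<in> partitions_of d" "d \<le> n"
  shows "form n (monomial_sym n (conj_part mu)) (monomial_sym n mu) = (-1) ^ d"
    and "wform n (monomial_sym n (conj_part mu)) (monomial_sym n mu) =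
      tq_size n (part (conj_part mu)) * (-1) ^ d"
proof -
  have "part (conj_part mu) \<in> rearrangements n (conj_part mu)"
    using length_partition_le[OF conj_part_partition[OF assms(1)]] assms(2) by (intro part_in_rearrangements) simp
  then show "form n (monomial_sym n (conj_part mu)) (monomial_sym n mu) = (-1) ^ d"
    and "wform n (monomial_sym n (conj_part mu)) (monomial_sym n mu) =
      tq_size n (part (conj_part mu)) * (-1) ^ d"
    unfolding form_monomial wform_monomial
    using finite_rearrangements[of n "conj_part mu"]
    by (simp_all add: pair_sum_diagonal[OF assms] if_distrib[of "(*) _"] cong: if_cong)
qed

lemma prod_single:
  "finite A \<Longrightarrow> (\<Prod>i\<in>A. Poly_Mapping.single (expo i (g i)) (x i)) =
    Poly_Mapping.single (fexp A g) (prod x A :: qtfield)"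
  by (induction A rule: finite_induct) (simp_all add: fexp_def mult_single)

lemma neg_one_powi_diff: "((-1 :: qtfield) powi (int k - int m)) * (-1) ^ k = (-1) ^ m"
  by (cases "even m"; cases "even k") (simp_all add: power_int_diff)

text \<open>The signs of \<open>xbar\<close> belonging to \<rho> cancel \<open>omega_sign\<close>,
  and those belonging to \<open>\<alpha>\<close> leave (-1)^d. No exponent is negative because the
  entries of \<open>\<alpha>\<close> are at most \<open>n\<close>, and the degree is right because
  \<open>\<alpha>\<close> and \<open>\<beta>\<close> have the same sum.\<close>

lemma dd_scalar_monomial:
  assumes nu: "nu \<in> partitions_of d" and mu: "mu \<in> partitions_of d" and d: "d \<le> n"
    and \<alpha>: "\<alpha> \<in> rearrangements n nu"
  shows "dd_scalar n (xbar (2 * n) (rho_minus n \<alpha>)) (monomial_sym n mu) =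
    const ((-1) ^ d * pair_sum n mu \<alpha>)"
proof -
  define x where "x = (\<Prod>i=1..2*n. (-1 :: qtfield) powi rho_minus n \<alpha> i)"
  have sum\<alpha>: "(\<Sum>i=1..n. \<alpha> i) = d"
    using sum_rearrangement[OF \<alpha>] partitions_of_D(3)[OF nu] by simp
  have le: "\<alpha> i \<le> n" if "i \<in> {1..n}" for i
    using member_le_sum[of i "{1..n}" \<alpha>] that sum\<alpha> d by simp
  have sgn: "x * omega_sign (2 * n) = (-1) ^ d"
  proof -
    have "x * omega_sign (2 * n) = (\<Prod>i=1..2*n. (-1) ^ (if i \<le> n then 0 else \<alpha> (i - n)))"
      unfolding x_def omega_sign_def prod.distrib[symmetric]
    proof (intro prod.cong refl)
      fix i assume i: "i \<in> {1..2 * n}"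
      then have "rho_minus n \<alpha> i = int (i - 1) - int (if i \<le> n then 0 else \<alpha> (i - n))"
        by (simp add: rho_minus_def)
      then show "(-1 :: qtfield) powi rho_minus n \<alpha> i * (-1) ^ (i - 1) = (-1) ^ (if i \<le> n then 0 else \<alpha> (i - n))"
        by (simp only: neg_one_powi_diff)
    qed
    also have "\<dots> = (-1) ^ (\<Sum>i=1..2*n. if i \<le> n then 0 else \<alpha> (i - n))"
      by (rule power_sum[symmetric])
    also have "(\<Sum>i=1..2*n. if i \<le> n then 0 else \<alpha> (i - n)) = (\<Sum>i\<in>block n. \<alpha> (i - n))"
      by (rule sum.mono_neutral_cong_right) (auto simp: block_def)
    also have "\<dots> = (\<Sum>i=1..n. \<alpha> i)"
      by (rule sum.reindex_bij_witness[of _ "\<lambda>i. n + i" "\<lambda>i. i - n"]) (auto simp: block_def)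
    finally show ?thesis by (simp only: sum\<alpha>)
  qed
  have xb: "xbar (2 * n) (rho_minus n \<alpha>) * xmon (nexp n \<beta>) = const x * xmon (pair_state n \<alpha> \<beta>)" for \<beta>
  proof -
    have "fexp {1..2 * n} (rho_minus n \<alpha>) + nexp n \<beta> = pair_state n \<alpha> \<beta>"
      by (rule poly_mapping_eqI)
        (use rearrangements_outside[OF \<alpha>] in \<open>auto simp: pair_state_def lookup_add lookup_minus lookup_rho
          lookup_shift lookup_nexp lookup_fexp block_def rho_minus_def\<close>)
    then show ?thesis
      unfolding xbar_def prod_single[OF finite_atLeastAtMost] x_def[symmetric]
      by (simp add: mult_single const_def)
  qed
  have omega: "omega_from (2 * n) 1 (xmon (pair_state n \<alpha> \<beta>)) =
      const (altq n (pair_state n \<alpha> \<beta>) * omega_sign (2 * n))" if \<beta>: "\<beta> \<in> rearrangements n mu" for \<beta>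
  proof (rule omega_from_xmon)
    fix i assume i: "i \<in> {1..2 * n}"
    show "0 \<le> lookup (pair_state n \<alpha> \<beta>) i"
    proof (cases "i \<in> {1..n}")
      case True
      then show ?thesis by (simp add: lookup_pair_state(1)[OF True])
    next
      case False
      then have j: "i - n \<in> {1..n}" "i = n + (i - n)" using i by auto
      show ?thesis using lookup_pair_state(2)[OF j(1), of \<alpha> \<beta>] le[OF j(1)] j by simp
    qed
  next
    fix i assume "i \<notin> {1..2 * n}"
    then show "lookup (pair_state n \<alpha> \<beta>) i = 0" by (rule lookup_pair_state(3))
  next
    have split: "(\<Sum>i=1..2*n. f i) = (\<Sum>i=1..n. f i) + (\<Sum>i=1..n. f (n + i))" for f :: "nat \<Rightarrow> int"
    proof -
      have "(\<Sum>i=1..2*n. f i) = (\<Sum>i=1..n. f i) + (\<Sum>i\<in>block n. f i)"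
        unfolding block_def by (subst sum.union_disjoint[symmetric]) (auto intro!: sum.cong)
      also have "(\<Sum>i\<in>block n. f i) = (\<Sum>i=1..n. f (n + i))"
        by (rule sum.reindex_bij_witness[of _ "\<lambda>i. n + i" "\<lambda>i. i - n"]) (auto simp: block_def)
      finally show ?thesis .
    qed
    have low: "(\<Sum>i=1..n. lookup (pair_state n \<alpha> \<beta>) i) = (\<Sum>i=1..n. (int i - 1) + int (\<beta> i))"
      by (intro sum.cong refl lookup_pair_state(1))
    have high: "(\<Sum>i=1..n. lookup (pair_state n \<alpha> \<beta>) (n + i)) = (\<Sum>i=1..n. (int (n + i) - 1) - int (\<alpha> i))"
      by (intro sum.cong refl) (simp add: lookup_pair_state(2))
    have "(\<Sum>i=1..n. \<beta> i) = (\<Sum>i=1..n. \<alpha> i)"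
      using sum_rearrangement[OF \<beta>] sum\<alpha> partitions_of_D(3)[OF mu] by simp
    then have "(\<Sum>i=1..n. int (\<beta> i)) = (\<Sum>i=1..n. int (\<alpha> i))" by (simp flip: of_nat_sum)
    then show "(\<Sum>i=1..2*n. lookup (pair_state n \<alpha> \<beta>) i) = (\<Sum>i=1..2*n. int i - 1)"
      unfolding split low high by (simp add: sum.distrib sum_subtractf)
  qed
  have "dd_scalar n (xbar (2 * n) (rho_minus n \<alpha>)) (monomial_sym n mu) =
      (\<Sum>\<beta>\<in>rearrangements n mu. omega_from (2 * n) 1 (xbar (2 * n) (rho_minus n \<alpha>) * xmon (nexp n \<beta>)))"
    by (simp only: dd_scalar_def div_diff_omega_eq monomial_sym_eq sum_distrib_left omega_from_sum)
  also have "\<dots> = (\<Sum>\<beta>\<in>rearrangements n mu. const ((-1) ^ d * altq n (pair_state n \<alpha> \<beta>)))"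
  proof (intro sum.cong refl)
    fix \<beta> assume \<beta>: "\<beta> \<in> rearrangements n mu"
    have "x * (altq n (pair_state n \<alpha> \<beta>) * omega_sign (2 * n)) = (-1) ^ d * altq n (pair_state n \<alpha> \<beta>)"
      unfolding sgn[symmetric] by (simp only: mult_ac)
    then show "omega_from (2 * n) 1 (xbar (2 * n) (rho_minus n \<alpha>) * xmon (nexp n \<beta>)) =
        const ((-1) ^ d * altq n (pair_state n \<alpha> \<beta>))"
      unfolding xb omega_from_const omega[OF \<beta>] const_mult[symmetric] by (simp only:)
  qed
  also have "\<dots> = const ((-1) ^ d * pair_sum n mu \<alpha>)"
    by (simp add: pair_sum_def sum_distrib_left const_sum)
  finally show ?thesis .
qed

lemma bracket_monomial:
  assumes nu: "nu \<in> partitions_of d" and mu: "mu \<in> partitions_of d" and d: "d \<le> n"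
  shows "bracket n kappa nu (monomial_sym n mu) =
    const ((-1) ^ d * (tq_size n (part kappa) * form n (monomial_sym n nu) (monomial_sym n mu) -
      wform n (monomial_sym n nu) (monomial_sym n mu)))"
proof -
  have "bracket n kappa nu (monomial_sym n mu) = (\<Sum>\<alpha>\<in>rearrangements n nu.
      const ((-1) ^ d * (tq_size n (part kappa) * pair_sum n mu \<alpha> - tq_size n \<alpha> * pair_sum n mu \<alpha>)))"
    unfolding bracket_def
  proof (intro sum.cong refl)
    fix \<alpha> assume \<alpha>: "\<alpha> \<in> rearrangements n nu"
    show "dd_scalar n (xbar (2 * n) (rho_minus n \<alpha>)) (monomial_sym n mu) *
        const (tq_size n (part kappa) - tq_size n \<alpha>) =
      const ((-1) ^ d * (tq_size n (part kappa) * pair_sum n mu \<alpha> - tq_size n \<alpha> * pair_sum n mu \<alpha>))"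
      unfolding dd_scalar_monomial[OF assms \<alpha>] const_mult[symmetric] by (simp add: algebra_simps)
  qed
  then show ?thesis
    by (simp add: form_monomial wform_monomial sum_distrib_left sum_subtractf const_sum right_diff_distrib const_diff)
qed

text \<open>The parts can be read off: the power \<open>n - j\<close> of q marks coordinate
  \<open>j\<close>, and the accompanying power of t is the part.\<close>

lemma tq_size_inj:
  assumes "lam \<in> partitions_of d" "mu \<in> partitions_of d" "d \<le> n"
    and eq: "tq_size n (part lam) = tq_size n (part mu)"
  shows "lam = mu"
proof (rule partition_eqI[OF assms(1,2)])
  have tq: "tq_size n f = Fract (\<Sum>i=1..n. monom (monom 1 (n - i)) (f i)) 1" for f
  proof -
    have "t_par ^ f i * q_par ^ (n - i) = Fract (monom (monom 1 (n - i)) (f i)) 1" for i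
    proof -
      have "monom 1 (f i) * [:monom (1::rat) (n - i):] = monom (monom 1 (n - i)) (f i)"
        by (simp add: smult_monom flip: monom_0) (simp add: mult_monom)
      then show ?thesis by (simp add: t_par_power q_par_power)
    qed
    then have "tq_size n f = (\<Sum>i=1..n. Fract (monom (monom 1 (n - i)) (f i)) 1)"
      by (simp only: tq_size_def)
    moreover have "(\<Sum>i\<in>A. Fract (g i) 1) = Fract (sum g A) 1" if "finite A" for g :: "nat \<Rightarrow> rat poly poly" and A
      using that by (induction A rule: finite_induct) (simp_all add: Zero_fract_def)
    ultimately show ?thesis by simp
  qed
  have coeff: "coeff (coeff (\<Sum>i=1..n. monom (monom (1::rat) (n - i)) (f i)) m) (n - j) = (if f j = m then 1 else 0)"
    if j: "j \<in> {1..n}" for f m j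
  proof -
    have "coeff (coeff (\<Sum>i=1..n. monom (monom (1::rat) (n - i)) (f i)) m) (n - j) =
        (\<Sum>i=1..n. if i = j then (if f j = m then 1 else 0) else 0)"
      unfolding coeff_sum by (intro sum.cong refl) (use j in \<open>auto simp: coeff_monom\<close>)
    then show ?thesis using j by simp
  qed
  have poly: "(\<Sum>i=1..n. monom (monom (1::rat) (n - i)) (part lam i)) = (\<Sum>i=1..n. monom (monom (1::rat) (n - i)) (part mu i))"
    using eq unfolding tq by (simp add: eq_fract)
  fix j :: nat assume j: "1 \<le> j"
  show "part lam j = part mu j"
  proof (cases "j \<le> n")
    case True
    then have "j \<in> {1..n}" using j by simp
    from coeff[OF this, of "part lam" "part lam j"] coeff[OF this, of "part mu" "part lam j"] poly
    show ?thesis by (auto split: if_splits)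
  next
    case False
    then show ?thesis using length_partition_le[OF assms(1)] length_partition_le[OF assms(2)] assms(3)
      by (simp add: part_outside)
  qed
qed

section \<open>The space of symmetric polynomials of fixed degree\<close>

interpretation lvs: vector_space "\<lambda>(a :: qtfield) (f :: laurent). const a * f"
  by unfold_locales (simp_all add: const_add const_mult distrib_left distrib_right mult.assoc)

lemma nexp_inj:
  assumes "\<alpha> \<in> compositions n d" "\<beta> \<in> compositions n e" "nexp n \<alpha> = nexp n \<beta>"
  shows "\<alpha> = \<beta>"
proof
  fix i
  show "\<alpha> i = \<beta> i"
    using arg_cong[OF assms(3), of "\<lambda>c. lookup c i"] assms(1,2)
    by (cases "i \<in> {1..n}") (auto simp: lookup_nexp compositions_def)
qed

lemma part_in_compositions:
  assumes "nu \<in> partitions_of d" "d \<le> n"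
  shows "part nu \<in> rearrangements n nu" "part nu \<in> compositions n d"
proof -
  show "part nu \<in> rearrangements n nu"
    using length_partition_le[OF assms(1)] assms(2) by (intro part_in_rearrangements) simp
  then show "part nu \<in> compositions n d" using rearrangements_compositions[OF assms(1)] by blast
qed

lemma lookup_xmon_mult: "lookup (xmon l * f) k = lookup f (k - l)"
proof (induction f rule: laurent_induct)
  case (single e a)
  have "l + e = k \<longleftrightarrow> e = k - l" by (metis add_diff_cancel_left' diff_add_cancel add.commute)
  then show ?case by (simp add: mult_single lookup_single when_def)
qed (simp add: distrib_left lookup_add)

lemma lookup_power_sum_Cons:
  "lookup (power_sum n (r # \<rho>)) k = (\<Sum>i=1..n. lookup (power_sum n \<rho>) (k - expo i (int r)))"
  by (simp add: power_sum_Cons sum_distrib_right lookup_sum var_power lookup_xmon_mult)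

lemma lookup_power_sum_perm:
  assumes \<pi>: "\<pi> permutes {1..n}"
  shows "lookup (power_sum n \<rho>) (perm_expo \<pi> k) = lookup (power_sum n \<rho>) k"
proof (induction \<rho> arbitrary: k)
  case Nil
  have "perm_expo \<pi> k = 0 \<longleftrightarrow> k = 0"
  proof
    assume eq: "perm_expo \<pi> k = 0"
    show "k = 0"
    proof (rule poly_mapping_eqI)
      fix i
      have "lookup k (\<pi> (inv_into UNIV \<pi> i)) = 0"
        using arg_cong[OF eq, of "\<lambda>c. lookup c (inv_into UNIV \<pi> i)"]
        by (simp add: lookup_perm_expo[OF permutes_inj[OF \<pi>]])
      then show "lookup k i = lookup 0 i" by (simp add: permutes_inverses(1)[OF \<pi>])
    qed
  qed (simp add: map_key_zero permutes_inj[OF \<pi>])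
  then show ?case by (simp add: power_sum_Nil lookup_one when_def)
next
  case (Cons r \<rho>)
  have "perm_expo \<pi> k - expo i (int r) = perm_expo \<pi> (k - expo (\<pi> i) (int r))" for i
    using permutes_inj[OF \<pi>]
    by (intro poly_mapping_eqI) (auto simp: lookup_perm_expo lookup_minus lookup_single when_def inj_eq)
  then have "lookup (power_sum n (r # \<rho>)) (perm_expo \<pi> k) =
      (\<Sum>i=1..n. lookup (power_sum n \<rho>) (k - expo (\<pi> i) (int r)))"
    by (simp only: lookup_power_sum_Cons Cons.IH)
  also have "\<dots> = (\<Sum>i=1..n. lookup (power_sum n \<rho>) (k - expo i (int r)))"
    using sum.permute[OF \<pi>, of "\<lambda>i. lookup (power_sum n \<rho>) (k - expo i (int r))"] by (simp add: comp_def)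
  finally show ?case by (simp only: lookup_power_sum_Cons)
qed

lemma keys_power_sum: "lookup (power_sum n \<rho>) k \<noteq> 0 \<Longrightarrow> \<exists>\<alpha>\<in>compositions n (sum_list \<rho>). k = nexp n \<alpha>"
proof (induction \<rho> arbitrary: k)
  case Nil
  then have "k = 0" by (auto simp: power_sum_Nil lookup_one when_def split: if_splits)
  then have "k = nexp n (\<lambda>i. 0)" by (intro poly_mapping_eqI) (simp add: lookup_nexp)
  then show ?case by (intro bexI[of _ "\<lambda>i. 0"]) (simp_all add: compositions_def)
next
  case (Cons r \<rho>)
  from Cons.prems obtain i where i: "i \<in> {1..n}" "lookup (power_sum n \<rho>) (k - expo i (int r)) \<noteq> 0"
    unfolding lookup_power_sum_Cons by (rule sum.not_neutral_contains_not_neutral)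
  then obtain \<alpha> where \<alpha>: "\<alpha> \<in> compositions n (sum_list \<rho>)" "k - expo i (int r) = nexp n \<alpha>"
    using Cons.IH by blast
  have "k = nexp n (\<alpha>(i := \<alpha> i + r))"
  proof (rule poly_mapping_eqI)
    fix j
    show "lookup k j = lookup (nexp n (\<alpha>(i := \<alpha> i + r))) j"
      using arg_cong[OF \<alpha>(2), of "\<lambda>c. lookup c j"] i(1)
      by (auto simp: lookup_nexp lookup_minus lookup_single when_def split: if_splits)
  qed
  moreover have "\<alpha>(i := \<alpha> i + r) \<in> compositions n (sum_list (r # \<rho>))"
  proof -
    have "(\<Sum>j=1..n. (\<alpha>(i := \<alpha> i + r)) j) = (\<Sum>j=1..n. \<alpha> j + (if j = i then r else 0))"
      by (rule sum.cong) auto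
    also have "\<dots> = sum_list (r # \<rho>)" using \<alpha>(1) i(1) by (simp add: sum.distrib compositions_def)
    finally show ?thesis using \<alpha>(1) i(1) by (auto simp: compositions_def)
  qed
  ultimately show ?case by blast
qed

lemma nexp_comp: "\<pi> permutes {1..n} \<Longrightarrow> nexp n (\<alpha> \<circ> \<pi>) = perm_expo \<pi> (nexp n \<alpha>)"
  by (rule poly_mapping_eqI)
    (simp add: lookup_perm_expo permutes_inj lookup_nexp permutes_in_image del: atLeastAtMost_iff)

text \<open>By symmetry the coefficients are constant on rearrangement classes, so the exponents can
  be grouped by partition.\<close>

lemma power_sum_expand:
  assumes \<rho>: "\<rho> \<in> partitions_of d" and d: "d \<le> n"
  shows "power_sum n \<rho> = (\<Sum>nu\<in>partitions_of d. const (lookup (power_sum n \<rho>) (nexp n (part nu))) * monomial_sym n nu)"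
proof -
  have inj: "inj_on (nexp n) (compositions n d)" by (rule inj_onI) (rule nexp_inj)
  have "keys (power_sum n \<rho>) \<subseteq> nexp n ` compositions n d"
    using keys_power_sum[of n \<rho>] partitions_of_D(3)[OF \<rho>] by (auto simp: in_keys_iff)
  then have "power_sum n \<rho> = (\<Sum>k\<in>nexp n ` compositions n d. const (lookup (power_sum n \<rho>) k) * xmon k)"
    by (intro laurent_lookup_expand) (simp add: finite_compositions)
  also have "\<dots> = (\<Sum>\<alpha>\<in>compositions n d. const (lookup (power_sum n \<rho>) (nexp n \<alpha>)) * xmon (nexp n \<alpha>))"
    by (simp add: sum.reindex[OF inj])
  also have "\<dots> = (\<Sum>nu\<in>partitions_of d. \<Sum>\<alpha>\<in>rearrangements n nu.
      const (lookup (power_sum n \<rho>) (nexp n \<alpha>)) * xmon (nexp n \<alpha>))"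
    by (rule sum_compositions)
  also have "\<dots> = (\<Sum>nu\<in>partitions_of d. const (lookup (power_sum n \<rho>) (nexp n (part nu))) * monomial_sym n nu)"
  proof (rule sum.cong[OF refl])
    fix nu assume nu: "nu \<in> partitions_of d"
    have "lookup (power_sum n \<rho>) (nexp n \<alpha>) = lookup (power_sum n \<rho>) (nexp n (part nu))"
      if \<alpha>: "\<alpha> \<in> rearrangements n nu" for \<alpha>
    proof -
      obtain \<pi> where "\<pi> permutes {1..n}" "\<alpha> = part nu \<circ> \<pi>"
        using rearrangements_permute[OF part_in_compositions(1)[OF nu d] \<alpha>] by blast
      then show ?thesis by (simp only: nexp_comp lookup_power_sum_perm)
    qed
    then show "(\<Sum>\<alpha>\<in>rearrangements n nu. const (lookup (power_sum n \<rho>) (nexp n \<alpha>)) * xmon (nexp n \<alpha>)) =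
        const (lookup (power_sum n \<rho>) (nexp n (part nu))) * monomial_sym n nu"
      by (simp add: monomial_sym_eq sum_distrib_left)
  qed
  finally show ?thesis .
qed

lemma form_sum_left: "form n (\<Sum>x\<in>A. const (a x) * g x) f = (\<Sum>x\<in>A. a x * form n (g x) f)"
  by (simp add: form_def lin_sum lin_const_mult)

lemma wform_sum_left: "wform n (\<Sum>x\<in>A. const (a x) * g x) f = (\<Sum>x\<in>A. a x * wform n (g x) f)"
proof -
  have "wform n (\<Sum>x\<in>A. const (a x) * g x) f = (\<Sum>i=1..n. \<Sum>x\<in>A. a x * (q_par ^ (n - i) *
     lin (\<lambda>\<alpha>. t_par powi lookup \<alpha> i * alt_kernel n f (rho_expo (2 * n) - shift n \<alpha>)) (g x)))"
    unfolding wform_def lin_sum lin_const_mult sum_distrib_left by (simp only: mult.left_commute)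
  also have "\<dots> = (\<Sum>x\<in>A. a x * wform n (g x) f)"
    unfolding wform_def sum_distrib_left by (rule sum.swap)
  finally show ?thesis .
qed

lemma alt_kernel_sum: "alt_kernel n (\<Sum>x\<in>A. const (b x) * f x) c = (\<Sum>x\<in>A. b x * alt_kernel n (f x) c)"
  by (simp add: alt_kernel_def lin_sum lin_const_mult)

lemma form_sum_right: "form n g (\<Sum>x\<in>A. const (b x) * f x) = (\<Sum>x\<in>A. b x * form n g (f x))"
  by (simp add: form_def alt_kernel_sum lin_fun_sum lin_fun_mult)

lemma wform_sum_right: "wform n g (\<Sum>x\<in>A. const (b x) * f x) = (\<Sum>x\<in>A. b x * wform n g (f x))"
proof -
  have "wform n g (\<Sum>x\<in>A. const (b x) * f x) = (\<Sum>i=1..n. \<Sum>x\<in>A. b x * (q_par ^ (n - i) *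
     lin (\<lambda>\<alpha>. t_par powi lookup \<alpha> i * alt_kernel n (f x) (rho_expo (2 * n) - shift n \<alpha>)) g))"
    unfolding wform_def alt_kernel_sum sum_distrib_left
      mult.left_commute[of "t_par powi _" "b _"] lin_fun_sum lin_fun_mult
    by (simp only: mult.left_commute)
  also have "\<dots> = (\<Sum>x\<in>A. b x * wform n g (f x))"
    unfolding wform_def sum_distrib_left by (rule sum.swap)
  finally show ?thesis .
qed

lemma twist_form_partitions:
  assumes "\<rho> \<in> partitions_of d" "\<sigma> \<in> partitions_of d" "d \<le> n"
  shows "twist \<rho> * form n (power_sum n \<rho>) (power_sum n \<sigma>) = (if \<rho> = \<sigma> then z_qt \<rho> else 0)"
proof -
  have "mset \<rho> = mset \<sigma> \<longleftrightarrow> \<rho> = \<sigma>" using partition_mset_eq[OF assms(1,2)] by blast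
  then show ?thesis
    using twist_form[of \<rho> \<sigma> n] partitions_of_D[OF assms(1)] partitions_of_D[OF assms(2)] assms(3) by simp
qed

lemma form_power_sum_zero:
  assumes "\<rho> \<in> partitions_of d" "\<sigma> \<in> partitions_of d" "d \<le> n"
  shows "form n (power_sum n \<rho>) (power_sum n \<sigma>) = 0 \<longleftrightarrow> \<rho> \<noteq> \<sigma>"
  using twist_form_partitions[OF assms] twist_nonzero[of \<rho>] z_qt_nonzero[of \<rho>] partitions_of_D(2)[OF assms(1)]
  by (cases "\<rho> = \<sigma>") auto

text \<open>Pairing with \<open>power_sum n \<sigma>\<close> isolates one coefficient, because
  \<open>form\<close> is diagonal on power sums with nonzero diagonal.\<close>

lemma power_sum_independent:
  assumes d: "d \<le> n" and zero: "(\<Sum>\<rho>\<in>partitions_of d. const (c \<rho>) * power_sum n \<rho>) = 0" and \<sigma>: "\<sigma> \<in> partitions_of d"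
  shows "c \<sigma> = 0"
proof -
  have "0 = form n (\<Sum>\<rho>\<in>partitions_of d. const (c \<rho>) * power_sum n \<rho>) (power_sum n \<sigma>)"
    unfolding zero by (simp add: form_def)
  also have "\<dots> = (\<Sum>\<rho>\<in>partitions_of d. if \<rho> = \<sigma> then c \<sigma> * form n (power_sum n \<sigma>) (power_sum n \<sigma>) else 0)"
    unfolding form_sum_left
    by (intro sum.cong refl) (use form_power_sum_zero[OF _ \<sigma> d] in auto)
  also have "\<dots> = c \<sigma> * form n (power_sum n \<sigma>) (power_sum n \<sigma>)"
    using finite_partitions_of \<sigma> by simp
  finally show ?thesis using form_power_sum_zero[OF \<sigma> \<sigma> d] by simp
qed

lemma power_sum_inj:
  assumes "\<rho> \<in> partitions_of d" "\<sigma> \<in> partitions_of d" "d \<le> n" "power_sum n \<rho> = power_sum n \<sigma>"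
  shows "\<rho> = \<sigma>"
  using form_power_sum_zero[OF assms(1,2,3)] form_power_sum_zero[OF assms(1,1,3)] assms(4) by auto

section \<open>Coordinates in power sums and Macdonald's scalar product\<close>

definition sym_space :: "nat \<Rightarrow> nat \<Rightarrow> laurent set" where
  "sym_space n d = lvs.span (power_sum n ` partitions_of d)"

lemma span_image_coeffs:
  assumes fin: "finite A" and f: "f \<in> lvs.span (g ` A)"
  obtains c where "f = (\<Sum>x\<in>A. const (c x) * g x)" "\<And>x. x \<notin> A \<Longrightarrow> c x = 0"
proof -
  have "\<exists>c. f = (\<Sum>x\<in>A. const (c x) * g x)"
    using f
  proof (induction rule: lvs.span_induct_alt)
    case base
    show ?case by (intro exI[of _ "\<lambda>x. 0"]) simp
  next
    case (step a y f)
    then obtain x c where x: "x \<in> A" "y = g x" and c: "f = (\<Sum>x\<in>A. const (c x) * g x)" by blast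
    have "(\<Sum>z\<in>A. const (c z + (if z = x then a else 0)) * g z) =
        (\<Sum>z\<in>A. const (c z) * g z + (if z = x then const a * g x else 0))"
      by (rule sum.cong) (auto simp: const_add distrib_right)
    also have "\<dots> = const a * y + f" using fin x c by (simp add: sum.distrib)
    finally show ?case by (rule exI[of "\<lambda>c. const a * y + f = (\<Sum>x\<in>A. const (c x) * g x)", OF sym])
  qed
  then obtain c where c: "f = (\<Sum>x\<in>A. const (c x) * g x)" by blast
  show thesis
    by (rule that[of "\<lambda>x. if x \<in> A then c x else 0"]) (auto simp: c intro!: sum.cong)
qed

text \<open>A dimension count: the power sums are independent and lie in the span of the monomial
  symmetric polynomials, of which there are no more. One of these outside the span of the power sums
  would give too large an independent set.\<close>

lemma monomial_in_sym_space:
  assumes mu: "mu \<in> partitions_of d" and d: "d \<le> n"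
  shows "monomial_sym n mu \<in> sym_space n d"
proof (rule ccontr)
  let ?P = "power_sum n ` partitions_of d" and ?M = "monomial_sym n ` partitions_of d"
  assume notin: "monomial_sym n mu \<notin> sym_space n d"
  have inj: "inj_on (power_sum n) (partitions_of d)"
    by (rule inj_onI) (rule power_sum_inj[OF _ _ d])
  have indep: "lvs.independent ?P"
  proof (rule lvs.independent_if_scalars_zero)
    show "finite ?P" using finite_partitions_of by simp
    fix f x assume zero: "(\<Sum>x\<in>?P. const (f x) * x) = 0" and x: "x \<in> ?P"
    then obtain \<sigma> where \<sigma>: "\<sigma> \<in> partitions_of d" "x = power_sum n \<sigma>" by blast
    have "(\<Sum>\<rho>\<in>partitions_of d. const (f (power_sum n \<rho>)) * power_sum n \<rho>) = 0"
      using zero by (simp add: sum.reindex[OF inj])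
    from power_sum_independent[OF d this \<sigma>(1)] show "f x = 0" using \<sigma>(2) by simp
  qed
  have P_sub: "?P \<subseteq> lvs.span ?M"
  proof
    fix x assume "x \<in> ?P"
    then obtain \<rho> where \<rho>: "\<rho> \<in> partitions_of d" "x = power_sum n \<rho>" by blast
    show "x \<in> lvs.span ?M"
      unfolding \<rho>(2) by (subst power_sum_expand[OF \<rho>(1) d])
        (intro lvs.span_sum lvs.span_scale lvs.span_base imageI)
  qed
  have "lvs.independent (insert (monomial_sym n mu) ?P)"
    using notin indep by (intro lvs.independent_insertI) (simp add: sym_space_def)
  moreover have "insert (monomial_sym n mu) ?P \<subseteq> lvs.span ?M"
    using P_sub mu by (auto intro: lvs.span_base)
  ultimately have "card (insert (monomial_sym n mu) ?P) \<le> card ?M"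
    using lvs.independent_span_bound[of ?M] finite_partitions_of by blast
  moreover have "card ?M \<le> card (partitions_of d)"
    by (rule card_image_le[OF finite_partitions_of])
  moreover have "monomial_sym n mu \<notin> ?P"
    using notin lvs.span_base[of "monomial_sym n mu" ?P] by (auto simp: sym_space_def)
  then have "card (insert (monomial_sym n mu) ?P) = Suc (card (partitions_of d))"
    using finite_partitions_of card_image[OF inj] by simp
  ultimately show False by simp
qed

lemma sym_space_coeffs:
  assumes "f \<in> sym_space n d"
  obtains c where "f = (\<Sum>\<rho>\<in>partitions_of d. const (c \<rho>) * power_sum n \<rho>)"
    "\<And>\<rho>. \<rho> \<notin> partitions_of d \<Longrightarrow> c \<rho> = 0"
  by (rule span_image_coeffs[OF finite_partitions_of assms[unfolded sym_space_def]]) (rule that)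

lemma power_sum_coords_eqI:
  assumes d: "d \<le> n" and f: "f = (\<Sum>\<rho>\<in>partitions_of d. const (c \<rho>) * power_sum n \<rho>)"
    and c: "\<And>\<rho>. \<rho> \<notin> partitions_of d \<Longrightarrow> c \<rho> = 0"
  shows "power_sum_coords n d f = c"
  unfolding power_sum_coords_def
proof (rule the_equality)
  fix c' assume c': "(\<forall>rho. rho \<notin> partitions_of d \<longrightarrow> c' rho = 0) \<and>
    f = (\<Sum>rho\<in>partitions_of d. const (c' rho) * power_sum n rho)"
  have "(\<Sum>\<rho>\<in>partitions_of d. const (c' \<rho> - c \<rho>) * power_sum n \<rho>) = 0"
    using c' f by (simp add: const_diff left_diff_distrib sum_subtractf)
  from power_sum_independent[OF d this] have eq: "c' \<rho> = c \<rho>" if "\<rho> \<in> partitions_of d" for \<rho> using that by simp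
  show "c' = c"
  proof
    fix \<rho>
    show "c' \<rho> = c \<rho>"
      using c c' eq by (cases "\<rho> \<in> partitions_of d") auto
  qed
qed (use f c in blast)

lemma power_sum_coords:
  assumes d: "d \<le> n" and f: "f \<in> sym_space n d"
  shows "f = (\<Sum>\<rho>\<in>partitions_of d. const (power_sum_coords n d f \<rho>) * power_sum n \<rho>)"
    and "\<rho> \<notin> partitions_of d \<Longrightarrow> power_sum_coords n d f \<rho> = 0"
proof -
  obtain c where c: "f = (\<Sum>\<rho>\<in>partitions_of d. const (c \<rho>) * power_sum n \<rho>)"
    "\<And>\<rho>. \<rho> \<notin> partitions_of d \<Longrightarrow> c \<rho> = 0"
    using sym_space_coeffs[OF f] by blast
  have "power_sum_coords n d f = c" by (rule power_sum_coords_eqI[OF d c])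
  then show "f = (\<Sum>\<rho>\<in>partitions_of d. const (power_sum_coords n d f \<rho>) * power_sum n \<rho>)"
    and "\<rho> \<notin> partitions_of d \<Longrightarrow> power_sum_coords n d f \<rho> = 0"
    using c by simp_all
qed

lemma power_sum_coords_linear:
  assumes d: "d \<le> n" and f: "f \<in> sym_space n d" and g: "g \<in> sym_space n d"
  shows "power_sum_coords n d (const a * f + g) \<rho> = a * power_sum_coords n d f \<rho> + power_sum_coords n d g \<rho>"
proof -
  have "power_sum_coords n d (const a * f + g) = (\<lambda>\<rho>. a * power_sum_coords n d f \<rho> + power_sum_coords n d g \<rho>)"
  proof (rule power_sum_coords_eqI[OF d])
    have "const a * f + g = const a * (\<Sum>\<rho>\<in>partitions_of d. const (power_sum_coords n d f \<rho>) * power_sum n \<rho>) +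
        (\<Sum>\<rho>\<in>partitions_of d. const (power_sum_coords n d g \<rho>) * power_sum n \<rho>)"
      by (rule arg_cong2[of _ _ _ _ "\<lambda>x y. const a * x + y",
            OF power_sum_coords(1)[OF d f] power_sum_coords(1)[OF d g]])
    also have "\<dots> = (\<Sum>\<rho>\<in>partitions_of d.
        const (a * power_sum_coords n d f \<rho> + power_sum_coords n d g \<rho>) * power_sum n \<rho>)"
      unfolding sum_distrib_left sum.distrib[symmetric]
      by (intro sum.cong refl) (simp only: const_add const_mult distrib_right mult.assoc)
    finally show "const a * f + g = \<dots>" .
  next
    fix \<rho> assume "\<rho> \<notin> partitions_of d"
    from power_sum_coords(2)[OF d f this] power_sum_coords(2)[OF d g this]
    show "a * power_sum_coords n d f \<rho> + power_sum_coords n d g \<rho> = 0" by (simp only: mult_zero_right add_0_right)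
  qed
  then show ?thesis by simp
qed

lemma qt_scalar_commute: "qt_scalar n d f g = qt_scalar n d g f"
  unfolding qt_scalar_def by (intro sum.cong refl) (simp only: mult_ac)

lemma qt_scalar_linear:
  assumes "d \<le> n" "f \<in> sym_space n d" "g \<in> sym_space n d"
  shows "qt_scalar n d h (const a * f + g) = a * qt_scalar n d h f + qt_scalar n d h g"
  unfolding qt_scalar_def power_sum_coords_linear[OF assms]
  unfolding sum_distrib_left sum.distrib[symmetric]
  by (intro sum.cong refl) (simp only: distrib_left mult_ac)

lemma zero_in_sym_space: "0 \<in> sym_space n d"
  unfolding sym_space_def by (rule lvs.span_zero)

lemma qt_scalar_0: "d \<le> n \<Longrightarrow> qt_scalar n d h 0 = 0"
  using power_sum_coords_eqI[of d n 0 "\<lambda>\<rho>. 0"] by (simp add: qt_scalar_def)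

lemma qt_scalar_span_zero:
  assumes d: "d \<le> n" and S: "S \<subseteq> sym_space n d" and orth: "\<And>x. x \<in> S \<Longrightarrow> qt_scalar n d h x = 0"
    and f: "f \<in> lvs.span S"
  shows "qt_scalar n d h f = 0"
proof -
  have sub: "lvs.subspace (sym_space n d)" unfolding sym_space_def by (rule lvs.subspace_span)
  have "f \<in> sym_space n d \<and> qt_scalar n d h f = 0"
    using f
  proof (induction rule: lvs.span_induct_alt)
    case base
    then show ?case using zero_in_sym_space qt_scalar_0[OF d] by blast
  next
    case (step a x y)
    have x: "x \<in> sym_space n d" using step S by blast
    have "const a * x + y \<in> sym_space n d"
      using sub step x by (intro lvs.subspace_add lvs.subspace_scale) auto
    then show ?case using qt_scalar_linear[OF d x, of y] step orth by simp
  qed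
  then show ?thesis by blast
qed

lemma qt_scalar_power_sum:
  assumes "d \<le> n" "\<sigma> \<in> partitions_of d"
  shows "qt_scalar n d h (power_sum n \<sigma>) = z_qt \<sigma> * power_sum_coords n d h \<sigma>"
proof -
  have "power_sum_coords n d (power_sum n \<sigma>) = (\<lambda>\<rho>. if \<rho> = \<sigma> then 1 else 0)"
  proof (rule power_sum_coords_eqI[OF assms(1)])
    have "(\<Sum>\<rho>\<in>partitions_of d. const (if \<rho> = \<sigma> then 1 else 0) * power_sum n \<rho>) =
        (\<Sum>\<rho>\<in>partitions_of d. if \<rho> = \<sigma> then power_sum n \<rho> else 0)"
      by (rule sum.cong) auto
    then show "power_sum n \<sigma> = (\<Sum>\<rho>\<in>partitions_of d. const (if \<rho> = \<sigma> then 1 else 0) * power_sum n \<rho>)"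
      using finite_partitions_of assms(2) by simp
  qed (use assms(2) in auto)
  then show ?thesis
    unfolding qt_scalar_def using finite_partitions_of assms(2)
    by (simp add: if_distrib[of "(*) _"] cong: if_cong)
qed

lemma qt_scalar_nondegenerate:
  assumes d: "d \<le> n" and f: "f \<in> sym_space n d"
    and orth: "\<And>\<sigma>. \<sigma> \<in> partitions_of d \<Longrightarrow> qt_scalar n d f (power_sum n \<sigma>) = 0"
  shows "f = 0"
proof -
  have "power_sum_coords n d f \<sigma> = 0" if "\<sigma> \<in> partitions_of d" for \<sigma>
    using orth[OF that] qt_scalar_power_sum[OF d that] z_qt_nonzero[OF partitions_of_D(2)[OF that]] by simp
  then show ?thesis by (subst power_sum_coords(1)[OF d f]) simp
qed

text \<open>The Macdonald involution \<open>\<omega>\<^sub>q\<^sub>,\<^sub>t\<close> up to sign.\<close>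

definition twisted :: "nat \<Rightarrow> nat \<Rightarrow> laurent \<Rightarrow> laurent" where
  "twisted n d f = (\<Sum>\<rho>\<in>partitions_of d. const (power_sum_coords n d f \<rho> * twist \<rho>) * power_sum n \<rho>)"

lemma form_twisted:
  assumes d: "d \<le> n" and g: "g \<in> sym_space n d"
  shows "form n (twisted n d f) g = qt_scalar n d f g"
proof -
  have "form n (power_sum n \<rho>) g * twist \<rho> = z_qt \<rho> * power_sum_coords n d g \<rho>"
    if \<rho>: "\<rho> \<in> partitions_of d" for \<rho>
  proof -
    have "form n (power_sum n \<rho>) g = (\<Sum>\<sigma>\<in>partitions_of d. power_sum_coords n d g \<sigma> * form n (power_sum n \<rho>) (power_sum n \<sigma>))"
      by (subst power_sum_coords(1)[OF d g]) (rule form_sum_right)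
    then have "form n (power_sum n \<rho>) g * twist \<rho> =
        (\<Sum>\<sigma>\<in>partitions_of d. power_sum_coords n d g \<sigma> * (twist \<rho> * form n (power_sum n \<rho>) (power_sum n \<sigma>)))"
      by (simp only: sum_distrib_right) (intro sum.cong refl, simp only: mult_ac)
    also have "\<dots> = (\<Sum>\<sigma>\<in>partitions_of d. if \<rho> = \<sigma> then power_sum_coords n d g \<rho> * z_qt \<rho> else 0)"
      by (intro sum.cong refl) (simp add: twist_form_partitions[OF \<rho> _ d])
    finally show ?thesis using finite_partitions_of \<rho> by (simp add: mult.commute)
  qed
  note main = this
  show ?thesis
    unfolding twisted_def form_sum_left qt_scalar_def
  proof (intro sum.cong refl)
    fix \<rho> assume \<rho>: "\<rho> \<in> partitions_of d"
    have "power_sum_coords n d f \<rho> * twist \<rho> * form n (power_sum n \<rho>) g =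
        power_sum_coords n d f \<rho> * (form n (power_sum n \<rho>) g * twist \<rho>)" by simp
    then show "power_sum_coords n d f \<rho> * twist \<rho> * form n (power_sum n \<rho>) g =
        z_qt \<rho> * power_sum_coords n d f \<rho> * power_sum_coords n d g \<rho>"
      unfolding main[OF \<rho>] by simp
  qed
qed

text \<open>Self-adjointness for Macdonald's scalar product of the adjoint of D under
  \<open>form\<close>, stated without constructing that operator.\<close>

lemma wform_twisted_commute:
  assumes d: "d \<le> n" and f: "f \<in> sym_space n d" and g: "g \<in> sym_space n d"
  shows "wform n (twisted n d f) g = wform n (twisted n d g) f"
proof -
  have expand: "wform n (twisted n d f) g = (\<Sum>\<rho>\<in>partitions_of d. \<Sum>\<sigma>\<in>partitions_of d.
      power_sum_coords n d f \<rho> * power_sum_coords n d g \<sigma> * (twist \<rho> * wform n (power_sum n \<rho>) (power_sum n \<sigma>)))"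
    if g: "g \<in> sym_space n d" for f g
  proof -
    have "wform n (power_sum n \<rho>) g = (\<Sum>\<sigma>\<in>partitions_of d. power_sum_coords n d g \<sigma> * wform n (power_sum n \<rho>) (power_sum n \<sigma>))" for \<rho>
      by (subst power_sum_coords(1)[OF d g]) (rule wform_sum_right)
    then show ?thesis
      unfolding twisted_def wform_sum_left
      by (simp only: sum_distrib_left) (intro sum.cong refl, simp only: mult_ac)
  qed
  have "wform n (twisted n d f) g = (\<Sum>\<rho>\<in>partitions_of d. \<Sum>\<sigma>\<in>partitions_of d.
      power_sum_coords n d g \<sigma> * power_sum_coords n d f \<rho> * (twist \<sigma> * wform n (power_sum n \<sigma>) (power_sum n \<rho>)))"
    unfolding expand[OF g]
  proof (intro sum.cong refl)
    fix \<rho> \<sigma> assume \<rho>: "\<rho> \<in> partitions_of d" and \<sigma>: "\<sigma> \<in> partitions_of d"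
    have "twist \<rho> * wform n (power_sum n \<rho>) (power_sum n \<sigma>) = twist \<sigma> * wform n (power_sum n \<sigma>) (power_sum n \<rho>)"
      by (rule twist_wform_commute) (use partitions_of_D[OF \<rho>] partitions_of_D[OF \<sigma>] d in simp_all)
    then show "power_sum_coords n d f \<rho> * power_sum_coords n d g \<sigma> * (twist \<rho> * wform n (power_sum n \<rho>) (power_sum n \<sigma>)) =
      power_sum_coords n d g \<sigma> * power_sum_coords n d f \<rho> * (twist \<sigma> * wform n (power_sum n \<sigma>) (power_sum n \<rho>))"
      by (simp only: mult.commute)
  qed
  also have "\<dots> = wform n (twisted n d g) f"
    unfolding expand[OF f] by (rule sum.swap)
  finally show ?thesis .
qed

text \<open>The eigenvalue equation in weak form, tested against all
  \<open>monomial_sym n nu\<close>. This fits the brackets, which by \<open>bracket_monomial\<close>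
  are differences of the two sides.\<close>

definition eigen :: "nat \<Rightarrow> nat \<Rightarrow> laurent \<Rightarrow> qtfield \<Rightarrow> bool" where
  "eigen n d f c \<longleftrightarrow> f \<in> sym_space n d \<and>
     (\<forall>nu\<in>partitions_of d. wform n (monomial_sym n nu) f = c * form n (monomial_sym n nu) f)"

lemma eigen_twisted:
  assumes d: "d \<le> n" and e: "eigen n d f c"
  shows "wform n (twisted n d g) f = c * form n (twisted n d g) f"
proof -
  have "wform n (power_sum n \<rho>) f = c * form n (power_sum n \<rho>) f" if \<rho>: "\<rho> \<in> partitions_of d" for \<rho>
  proof -
    have "wform n (monomial_sym n nu) f = c * form n (monomial_sym n nu) f" if "nu \<in> partitions_of d" for nu
      using e that by (simp add: eigen_def)
    then have "(\<Sum>nu\<in>partitions_of d. lookup (power_sum n \<rho>) (nexp n (part nu)) * wform n (monomial_sym n nu) f) =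
        c * (\<Sum>nu\<in>partitions_of d. lookup (power_sum n \<rho>) (nexp n (part nu)) * form n (monomial_sym n nu) f)"
      unfolding sum_distrib_left by (intro sum.cong refl) (simp only: mult_ac)
    then show ?thesis
      unfolding wform_sum_left[symmetric] form_sum_left[symmetric] power_sum_expand[OF \<rho> d, symmetric] .
  qed
  then show ?thesis
    unfolding twisted_def wform_sum_left form_sum_left sum_distrib_left
    by (intro sum.cong refl) (simp only: mult_ac)
qed

text \<open>The usual argument for self-adjoint operators: both eigenvalues multiply the same scalar
  product.\<close>

lemma eigen_orthogonal:
  assumes d: "d \<le> n" and f: "eigen n d f c" and g: "eigen n d g c'" and "c \<noteq> c'"
  shows "qt_scalar n d f g = 0"
proof -
  have fs: "f \<in> sym_space n d" and gs: "g \<in> sym_space n d" using f g by (simp_all add: eigen_def)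
  have "c' * qt_scalar n d f g = wform n (twisted n d f) g"
    using eigen_twisted[OF d g] form_twisted[OF d gs] by simp
  also have "\<dots> = wform n (twisted n d g) f" by (rule wform_twisted_commute[OF d fs gs])
  also have "\<dots> = c * qt_scalar n d f g"
    using eigen_twisted[OF d f] form_twisted[OF d fs] qt_scalar_commute[of n d g f] by simp
  finally show ?thesis using assms(4) by simp
qed

section \<open>Macdonald polynomials as determinants\<close>

text \<open>Allows \<open>det\<close> to be exchanged with \<open>const\<close> in the minors of
  \<open>full_det\<close>.\<close>

interpretation const_hom: comm_ring_hom const
  by unfold_locales (simp_all add: const_add const_mult)

lemma strictly_below_D:
  assumes "mu \<in> strictly_below lam" "lam \<in> partitions_of d"
  shows "mu \<in> partitions_of d" "dominance_le mu lam" "mu \<noteq> lam"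
  using assms partitions_of_D(3)[OF assms(2)] by (auto simp: strictly_below_def)

lemma dominance_le_antisym:
  assumes "lam \<in> partitions_of d" "mu \<in> partitions_of d" "dominance_le lam mu" "dominance_le mu lam"
  shows "lam = mu"
  using dom_rank_strict[OF assms(1,2,3)] dom_rank_mono[OF assms(4)] by blast

lemma tq_size_conj_inj:
  assumes lam: "lam \<in> partitions_of d" and mu: "mu \<in> partitions_of d" and d: "d \<le> n"
    and eq: "tq_size n (part (conj_part lam)) = tq_size n (part (conj_part mu))"
  shows "lam = mu"
proof -
  have "conj_part lam = conj_part mu"
    by (rule tq_size_inj[OF conj_part_partition[OF lam] conj_part_partition[OF mu] d eq])
  from arg_cong[OF this, of conj_part] show ?thesis
    by (simp only: conj_conj_part[OF lam] conj_conj_part[OF mu])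
qed

text \<open>A nonzero Leibniz term other than that of the identity would increase the rank somewhere
  and decrease it nowhere, although a permutation preserves the total rank. Phrased by a rank,
  triangularity is independent of the order of rows and columns, as suits an arbitrary
  listing.\<close>

lemma det_triangular_rank:
  fixes A :: "'a :: idom mat" and rk :: "nat \<Rightarrow> nat"
  assumes A: "A \<in> carrier_mat r r"
    and tri: "\<And>i j. i < r \<Longrightarrow> j < r \<Longrightarrow> i \<noteq> j \<Longrightarrow> A $$ (i, j) \<noteq> 0 \<Longrightarrow> rk i < rk j"
  shows "det A = (\<Prod>i<r. A $$ (i, i))"
proof -
  have zero: "(\<Prod>i = 0..<r. A $$ (i, p i)) = 0" if p: "p permutes {0..<r}" "p \<noteq> id" for p
  proof (rule ccontr)
    assume nz: "(\<Prod>i = 0..<r. A $$ (i, p i)) \<noteq> 0"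
    have pr: "p i < r" if "i < r" for i using permutes_in_image[OF p(1), of i] that by simp
    have le: "rk i \<le> rk (p i)" if "i \<in> {0..<r}" for i
      using tri[of i "p i"] nz that pr[of i] by (cases "p i = i") auto
    obtain i where i: "p i \<noteq> i" using p(2) by (auto simp: fun_eq_iff)
    then have ir: "i \<in> {0..<r}" using permutes_not_in[OF p(1)] by blast
    then have "rk i < rk (p i)" using tri[of i "p i"] nz i pr[of i] by simp
    then have "(\<Sum>i = 0..<r. rk i) < (\<Sum>i = 0..<r. rk (p i))"
      using le ir by (intro sum_strict_mono_ex1) auto
    also have "\<dots> = (\<Sum>i = 0..<r. rk i)"
      using sum.permute[OF p(1), of rk] by (simp add: comp_def)
    finally show False by simp
  qed
  have "det A = (\<Sum>p\<in>{p. p permutes {0..<r}}. signof p * (\<Prod>i = 0..<r. A $$ (i, p i)))"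
    by (rule det_def'[OF A])
  also have "\<dots> = (\<Sum>p\<in>{id}. signof p * (\<Prod>i = 0..<r. A $$ (i, p i)))"
    by (rule sum.mono_neutral_right) (use zero permutes_id in \<open>auto simp: finite_permutations\<close>)
  finally show ?thesis by (simp add: atLeast0LessThan)
qed

locale below_list =
  fixes n d r :: nat and lam :: "nat list" and mus :: "nat list list"
  assumes lam: "lam \<in> partitions_of d" and dn: "d \<le> n"
    and dist: "distinct mus" and mus: "set mus = strictly_below lam" and r: "r = length mus"
begin

definition L :: "nat \<Rightarrow> nat list" where "L j = (lam # mus) ! j"

abbreviation ev :: qtfield where "ev \<equiv> tq_size n (part (conj_part lam))"

text \<open>The scalar behind the bracket (\<open>bracket_entry\<close>), extended to row 0, where
  the matrix of the theorem has polynomials. That row turns out to vanish, which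
  \<open>F_eigen\<close> uses.\<close>

definition entry :: "nat \<Rightarrow> nat \<Rightarrow> qtfield" where
  "entry i j = (-1) ^ d * (ev * form n (monomial_sym n (conj_part (L i))) (monomial_sym n (L j)) -
     wform n (monomial_sym n (conj_part (L i))) (monomial_sym n (L j)))"

definition full_det :: laurent where
  "full_det = det (mat (r + 1) (r + 1) (\<lambda>(i, j).
      if i = 0 then monomial_sym n ((lam # mus) ! j)
      else bracket n (conj_part lam) (conj_part ((lam # mus) ! i)) (monomial_sym n ((lam # mus) ! j))))"

lemma L_below: "0 < j \<Longrightarrow> j < r + 1 \<Longrightarrow> L j \<in> strictly_below lam"
  using mus r nth_mem[of "j - 1" mus] by (cases j) (auto simp: L_def)

lemma L_0: "L 0 = lam"
  by (simp add: L_def)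

lemma L_partition: "j < r + 1 \<Longrightarrow> L j \<in> partitions_of d"
  using L_below[of j] strictly_below_D(1)[OF _ lam] lam L_0 by (cases "j = 0") auto

lemma L_le: "j < r + 1 \<Longrightarrow> dominance_le (L j) lam"
  using L_below[of j] strictly_below_D(2)[OF _ lam] dominance_refl L_0 by (cases "j = 0") auto

lemma L_inj: "i < r + 1 \<Longrightarrow> j < r + 1 \<Longrightarrow> L i = L j \<Longrightarrow> i = j"
proof -
  assume ij: "i < r + 1" "j < r + 1" "L i = L j"
  have "distinct (lam # mus)" using dist mus by (auto simp: strictly_below_def)
  then show "i = j" using ij r by (simp add: L_def nth_eq_iff_index_eq del: distinct.simps)
qed

lemma L_surj: "nu \<in> partitions_of d \<Longrightarrow> dominance_le nu lam \<Longrightarrow> \<exists>i<r + 1. L i = nu"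
proof -
  assume "nu \<in> partitions_of d" "dominance_le nu lam"
  then have "nu \<in> set (lam # mus)"
    using mus partitions_of_D(3)[OF lam] by (auto simp: strictly_below_def)
  then show "\<exists>i<r + 1. L i = nu" using r by (auto simp: L_def in_set_conv_nth)
qed

lemma entry_zero: "i < r + 1 \<Longrightarrow> j < r + 1 \<Longrightarrow> \<not> dominance_le (L i) (L j) \<Longrightarrow> entry i j = 0"
  by (simp add: entry_def form_dominance[OF L_partition L_partition dn])

lemma entry_diagonal: "i < r + 1 \<Longrightarrow> entry i i = ev - tq_size n (part (conj_part (L i)))"
  by (simp add: entry_def form_diagonal[OF L_partition dn] algebra_simps flip: power_mult_distrib)

lemma bracket_entry:
  "i < r + 1 \<Longrightarrow> j < r + 1 \<Longrightarrow>
    bracket n (conj_part lam) (conj_part (L i)) (monomial_sym n (L j)) = const (entry i j)"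
  unfolding entry_def by (rule bracket_monomial[OF conj_part_partition[OF L_partition] L_partition dn])

text \<open>Cofactors along the first row involve only the scalar rows, so they are formed over the
  field instead of the polynomial ring.\<close>

definition S :: "qtfield mat" where
  "S = mat (r + 1) (r + 1) (\<lambda>(i, j). if i = 0 then 0 else entry i j)"

definition k :: "nat \<Rightarrow> qtfield" where
  "k j = cofactor S 0 j"

lemma full_det_expand: "full_det = (\<Sum>j<r + 1. const (k j) * monomial_sym n (L j))"
proof -
  define A where "A = mat (r + 1) (r + 1) (\<lambda>(i, j). if i = 0 then monomial_sym n (L j) else const (entry i j))"
  have eq: "full_det = det A"
    unfolding full_det_def A_def
    by (intro arg_cong[of _ _ det] cong_mat refl) (auto simp: L_def[symmetric] bracket_entry)
  have A: "A \<in> carrier_mat (r + 1) (r + 1)" by (simp add: A_def)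
  have "cofactor A 0 j = const (k j)" if j: "j < r + 1" for j
  proof -
    have "mat_delete A 0 j = map_mat const (mat_delete S 0 j)"
      using j by (intro eq_matI) (auto simp: mat_delete_def A_def S_def)
    then show ?thesis
      by (simp add: k_def cofactor_def const_mult const_power const_minus)
  qed
  moreover have "det A = (\<Sum>j<r + 1. A $$ (0, j) * cofactor A 0 j)"
    by (rule laplace_expansion_row[OF A]) simp
  ultimately show ?thesis unfolding eq by (simp add: A_def mult.commute)
qed

text \<open>Expansion by a foreign row: with row \<open>i\<close> put in place of row 0, two rows
  agree, while the cofactors along row 0 are still the \<open>k j\<close>.\<close>

lemma entry_orthogonal:
  assumes i: "0 < i" "i < r + 1"
  shows "(\<Sum>j<r + 1. entry i j * k j) = 0"
proof -
  define A where "A = mat (r + 1) (r + 1) (\<lambda>(i', j). entry (if i' = 0 then i else i') j)"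
  have A: "A \<in> carrier_mat (r + 1) (r + 1)" by (simp add: A_def)
  have "det A = 0"
    by (rule det_identical_rows[OF A, of 0 i]) (use i in \<open>auto simp: A_def row_def\<close>)
  moreover have "det A = (\<Sum>j<r + 1. A $$ (0, j) * cofactor A 0 j)"
    by (rule laplace_expansion_row[OF A]) simp
  moreover have "cofactor A 0 j = k j" if j: "j < r + 1" for j
  proof -
    have "mat_delete A 0 j = mat_delete S 0 j"
      using j by (intro eq_matI) (auto simp: mat_delete_def A_def S_def)
    then show ?thesis by (simp add: k_def cofactor_def)
  qed
  ultimately show ?thesis by (simp add: A_def)
qed

text \<open>The minor is triangular for dominance by \<open>entry_zero\<close>, with the factors of
  \<open>u_coeff\<close> on its diagonal.\<close>

lemma k_0: "k 0 = u_coeff n lam"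
proof -
  define A where "A = mat r r (\<lambda>(i, j). entry (Suc i) (Suc j))"
  have A: "A \<in> carrier_mat r r" by (simp add: A_def)
  have "mat_delete S 0 0 = A"
    by (intro eq_matI) (auto simp: mat_delete_def A_def S_def)
  then have "k 0 = det A" by (simp add: k_def cofactor_def)
  also have "\<dots> = (\<Prod>i<r. A $$ (i, i))"
  proof (rule det_triangular_rank[OF A, where rk = "\<lambda>i. dom_rank d (L (Suc i))"])
    fix i j assume ij: "i < r" "j < r" "i \<noteq> j" "A $$ (i, j) \<noteq> 0"
    then have dom: "dominance_le (L (Suc i)) (L (Suc j))"
      using entry_zero[of "Suc i" "Suc j"] by (auto simp: A_def)
    show "dom_rank d (L (Suc i)) < dom_rank d (L (Suc j))"
    proof (rule ccontr)
      assume "\<not> ?thesis"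
      then have "L (Suc i) = L (Suc j)"
        using dom_rank_strict[OF L_partition L_partition dom] ij by simp
      then show False using L_inj[of "Suc i" "Suc j"] ij by simp
    qed
  qed
  also have "\<dots> = (\<Prod>i<r. ev - tq_size n (part (conj_part (mus ! i))))"
    by (intro prod.cong refl) (simp add: A_def entry_diagonal, simp add: L_def)
  also have "\<dots> = (\<Prod>mu\<in>set mus. ev - tq_size n (part (conj_part mu)))"
    by (rule prod.reindex_bij_betw[OF bij_betw_nth[OF dist]]) (simp_all add: r)
  finally show ?thesis by (simp add: u_coeff_def mus)
qed

lemma u_nonzero: "u_coeff n lam \<noteq> 0"
  unfolding u_coeff_def prod_zero_iff[OF finite_strictly_below]
proof (rule notI, elim bexE)
  fix mu assume mu: "mu \<in> strictly_below lam" and eq: "ev - tq_size n (part (conj_part mu)) = 0"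
  note D = strictly_below_D[OF mu lam]
  have "lam = mu"
    by (rule tq_size_conj_inj[OF lam D(1) dn]) (use eq in simp)
  then show False using D(3) by simp
qed

definition F :: laurent where
  "F = const (1 / u_coeff n lam) * full_det"

lemma F_expand: "F = (\<Sum>j<r + 1. const (k j / u_coeff n lam) * monomial_sym n (L j))"
  unfolding F_def full_det_expand sum_distrib_left
  by (intro sum.cong refl) (simp add: mult.assoc[symmetric] const_mult[symmetric])

lemma F_unitriangular:
  "\<exists>v. F = monomial_sym n lam + (\<Sum>mu\<in>strictly_below lam. const (v mu) * monomial_sym n mu)"
proof -
  define v where "v mu = k (the_inv_into {1..<r + 1} L mu) / u_coeff n lam" for mu
  have inj: "inj_on L {1..<r + 1}" by (rule inj_onI) (use L_inj in auto)
  have img: "L ` {1..<r + 1} = strictly_below lam"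
  proof
    show "strictly_below lam \<subseteq> L ` {1..<r + 1}"
    proof
      fix mu assume mu: "mu \<in> strictly_below lam"
      note D = strictly_below_D[OF mu lam]
      obtain i where i: "i < r + 1" "L i = mu" using L_surj[OF D(1,2)] by blast
      then have "i \<noteq> 0" using L_0 D(3) by metis
      then show "mu \<in> L ` {1..<r + 1}" using i by (intro image_eqI[of _ _ i]) auto
    qed
  qed (use L_below in auto)
  have "{..<r + 1} = insert 0 {1..<r + 1}" by auto
  then have "F = const (k 0 / u_coeff n lam) * monomial_sym n (L 0) +
      (\<Sum>j\<in>{1..<r + 1}. const (k j / u_coeff n lam) * monomial_sym n (L j))"
    unfolding F_expand by simp
  also have "const (k 0 / u_coeff n lam) * monomial_sym n (L 0) = monomial_sym n lam"
    using u_nonzero by (simp add: k_0 L_0)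
  also have "(\<Sum>j\<in>{1..<r + 1}. const (k j / u_coeff n lam) * monomial_sym n (L j)) =
      (\<Sum>j\<in>{1..<r + 1}. const (v (L j)) * monomial_sym n (L j))"
    by (intro sum.cong refl) (simp only: v_def the_inv_into_f_f[OF inj])
  also have "\<dots> = (\<Sum>mu\<in>strictly_below lam. const (v mu) * monomial_sym n mu)"
    unfolding img[symmetric] sum.reindex[OF inj] by simp
  finally show ?thesis by blast
qed

lemma F_sym_space: "F \<in> sym_space n d"
proof -
  have "lvs.subspace (sym_space n d)" unfolding sym_space_def by (rule lvs.subspace_span)
  then show ?thesis
    unfolding F_expand
    by (intro lvs.subspace_sum lvs.subspace_scale monomial_in_sym_space[OF L_partition dn]) auto
qed

text \<open>Triangularity refers to the conjugate \<open>nu\<close> of the test partition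
  \<open>kap\<close>. If \<open>nu\<close> is dominated by \<open>lam\<close>, the test is one of
  the rows of \<open>entry\<close>; otherwise every pairing in it vanishes.\<close>

lemma F_eigen: "eigen n d F ev"
  unfolding eigen_def
proof (intro conjI ballI F_sym_space)
  fix kap assume kap: "kap \<in> partitions_of d"
  define nu where "nu = conj_part kap"
  have nu: "nu \<in> partitions_of d" "conj_part nu = kap"
    using conj_part_partition[OF kap] conj_conj_part[OF kap] by (simp_all add: nu_def)
  let ?f = "\<lambda>j. form n (monomial_sym n kap) (monomial_sym n (L j))"
  let ?w = "\<lambda>j. wform n (monomial_sym n kap) (monomial_sym n (L j))"
  have "(\<Sum>j<r + 1. k j * (ev * ?f j - ?w j)) = 0"
  proof (cases "dominance_le nu lam")
    case True
    obtain i where i: "i < r + 1" "L i = nu" using L_surj[OF nu(1) True] by blast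
    have e: "ev * ?f j - ?w j = (-1) ^ d * entry i j" for j
      by (simp add: entry_def i(2) nu(2) flip: mult.assoc power_mult_distrib)
    have "(\<Sum>j<r + 1. k j * (ev * ?f j - ?w j)) = (-1) ^ d * (\<Sum>j<r + 1. entry i j * k j)"
      unfolding e sum_distrib_left by (intro sum.cong refl) (simp only: mult_ac)
    \<comment> \<open>Row 0 is outside the reach of \<open>entry_orthogonal\<close> but vanishes
      entirely: the eigenvalue is subtracted from itself on the diagonal, and dominance excludes the
      other entries.\<close>
    also have "(\<Sum>j<r + 1. entry i j * k j) = 0"
    proof (cases "i = 0")
      case True
      have "entry 0 j = 0" if j: "j < r + 1" for j
      proof (cases "j = 0")
        case True
        then show ?thesis using entry_diagonal[of 0] by (simp add: L_0)
      next
        case False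
        have "\<not> dominance_le lam (L j)"
          using dominance_le_antisym[OF L_partition[OF j] lam L_le[OF j]] strictly_below_D(3)[OF L_below lam] j False
          by blast
        then show ?thesis using entry_zero[of 0 j] j by (simp add: L_0)
      qed
      then show ?thesis using True by simp
    qed (use entry_orthogonal i(1) in simp)
    finally show ?thesis by simp
  next
    case False
    have "ev * ?f j - ?w j = 0" if j: "j < r + 1" for j
    proof -
      have "\<not> dominance_le nu (L j)" using dominance_trans[OF _ L_le[OF j]] False by blast
      from form_dominance[OF nu(1) L_partition[OF j] dn this] show ?thesis by (simp add: nu(2))
    qed
    then show ?thesis by simp
  qed
  then have "(\<Sum>j<r + 1. k j * ?w j) = ev * (\<Sum>j<r + 1. k j * ?f j)"
    by (simp add: right_diff_distrib sum_subtractf sum_distrib_left mult.left_commute del: sum.lessThan_Suc)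
  then show "wform n (monomial_sym n kap) F = ev * form n (monomial_sym n kap) F"
    unfolding F_expand wform_sum_right form_sum_right
    by (simp add: sum_divide_distrib[symmetric] del: sum.lessThan_Suc)
qed

end

text \<open>The normalised determinant for some chosen listing. It witnesses the existence of a
  Macdonald family; that the listing does not matter follows only from uniqueness.\<close>

definition mac :: "nat \<Rightarrow> nat list \<Rightarrow> laurent" where
  "mac n lam = below_list.F n (length (SOME mus. distinct mus \<and> set mus = strictly_below lam)) lam
     (SOME mus. distinct mus \<and> set mus = strictly_below lam)"

lemma mac_below_list:
  assumes "lam \<in> partitions_of d" "d \<le> n"
  obtains r mus where "below_list n d r lam mus" "mac n lam = below_list.F n r lam mus"
proof -
  define mus where "mus = (SOME mus. distinct mus \<and> set mus = strictly_below lam)"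
  have "\<exists>mus. distinct mus \<and> set mus = strictly_below lam"
    using finite_distinct_list[OF finite_strictly_below] by blast
  then have "distinct mus \<and> set mus = strictly_below lam"
    unfolding mus_def by (rule someI_ex)
  then have "below_list n d (length mus) lam mus" using assms by unfold_locales auto
  then show thesis by (rule that) (simp add: mac_def mus_def)
qed

lemma mac_unitriangular:
  assumes "lam \<in> partitions_of d" "d \<le> n"
  shows "\<exists>v. mac n lam = monomial_sym n lam + (\<Sum>mu\<in>strictly_below lam. const (v mu) * monomial_sym n mu)"
proof -
  obtain r mus where b: "below_list n d r lam mus" "mac n lam = below_list.F n r lam mus"
    by (rule mac_below_list[OF assms])
  show ?thesis unfolding b(2) by (rule below_list.F_unitriangular[OF b(1)])
qed

lemma mac_eigen:
  assumes "lam \<in> partitions_of d" "d \<le> n"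
  shows "eigen n d (mac n lam) (tq_size n (part (conj_part lam)))"
proof -
  obtain r mus where b: "below_list n d r lam mus" "mac n lam = below_list.F n r lam mus"
    by (rule mac_below_list[OF assms])
  show ?thesis unfolding b(2) by (rule below_list.F_eigen[OF b(1)])
qed

lemma mac_orthogonal:
  assumes lam: "lam \<in> partitions_of d" and mu: "mu \<in> partitions_of d" and d: "d \<le> n" and ne: "lam \<noteq> mu"
  shows "qt_scalar n d (mac n lam) (mac n mu) = 0"
proof (rule eigen_orthogonal[OF d mac_eigen[OF lam d] mac_eigen[OF mu d]])
  show "tq_size n (part (conj_part lam)) \<noteq> tq_size n (part (conj_part mu))"
    using tq_size_conj_inj[OF lam mu d] ne by blast
qed

lemma mac_family: "d \<le> n \<Longrightarrow> is_macdonald_family n d (mac n)"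
  unfolding is_macdonald_family_def using mac_unitriangular mac_orthogonal by blast

lemma mac_sym_space: "lam \<in> partitions_of d \<Longrightarrow> d \<le> n \<Longrightarrow> mac n lam \<in> sym_space n d"
  using mac_eigen by (simp add: eigen_def)

text \<open>The unitriangular expansion is inverted by induction on the rank.\<close>

lemma monomial_in_mac_span:
  assumes "mu \<in> partitions_of d" "d \<le> n"
  shows "monomial_sym n mu \<in> lvs.span (mac n ` {nu \<in> partitions_of d. dominance_le nu mu})"
  using assms(1)
proof (induction "dom_rank d mu" arbitrary: mu rule: less_induct)
  case less
  let ?S = "\<lambda>mu. mac n ` {nu \<in> partitions_of d. dominance_le nu mu}"
  obtain v where "mac n mu = monomial_sym n mu + (\<Sum>nu\<in>strictly_below mu. const (v nu) * monomial_sym n nu)"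
    using mac_unitriangular[OF less.prems assms(2)] by blast
  then have eq: "monomial_sym n mu = mac n mu - (\<Sum>nu\<in>strictly_below mu. const (v nu) * monomial_sym n nu)"
    by simp
  have "monomial_sym n nu \<in> lvs.span (?S mu)" if nu: "nu \<in> strictly_below mu" for nu
  proof -
    note D = strictly_below_D[OF nu less.prems]
    have "dom_rank d nu < dom_rank d mu"
      using dom_rank_strict[OF D(1) less.prems D(2)] D(3) by force
    from less.hyps[OF this D(1)] have "monomial_sym n nu \<in> lvs.span (?S nu)" .
    moreover have "?S nu \<subseteq> ?S mu" using dominance_trans[OF _ D(2)] by blast
    ultimately show ?thesis using lvs.span_mono by blast
  qed
  moreover have "mac n mu \<in> lvs.span (?S mu)"
    using less.prems dominance_refl by (intro lvs.span_base) blast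
  ultimately show ?case
    unfolding eq by (intro lvs.span_diff lvs.span_sum lvs.span_scale)
qed

text \<open>By induction on the rank the families agree below \<open>lam\<close>. So
  \<open>G\<close> is orthogonal to every \<open>mac n nu\<close> with \<open>nu\<close> strictly
  below \<open>lam\<close>; it also lies in their span, hence is orthogonal to all the other
  \<open>mac n nu\<close>, and nondegeneracy leaves only 0.\<close>

lemma macdonald_family_unique:
  assumes d: "d \<le> n" and P: "is_macdonald_family n d P" and "lam \<in> partitions_of d"
  shows "P lam = mac n lam"
  using assms(3)
proof (induction "dom_rank d lam" arbitrary: lam rule: less_induct)
  case (less lam)
  note lam = less.prems
  define G where "G = P lam - mac n lam"
  have IH: "P mu = mac n mu" if mu: "mu \<in> strictly_below lam" for mu
  proof -
    note D = strictly_below_D[OF mu lam]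
    have "dom_rank d mu < dom_rank d lam"
      using dom_rank_strict[OF D(1) lam D(2)] D(3) by force
    then show ?thesis by (rule less.hyps[OF _ D(1)])
  qed
  have sub: "lvs.subspace (sym_space n d)" unfolding sym_space_def by (rule lvs.subspace_span)
  obtain v where v: "P lam = monomial_sym n lam + (\<Sum>mu\<in>strictly_below lam. const (v mu) * monomial_sym n mu)"
    using P lam unfolding is_macdonald_family_def by blast
  obtain w where w: "mac n lam = monomial_sym n lam + (\<Sum>mu\<in>strictly_below lam. const (w mu) * monomial_sym n mu)"
    using mac_unitriangular[OF lam d] by blast
  have Plam: "P lam \<in> sym_space n d"
    unfolding v using strictly_below_D(1)[OF _ lam]
    by (intro lvs.subspace_add[OF sub] lvs.subspace_sum[OF sub] lvs.subspace_scale[OF sub]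
        monomial_in_sym_space[OF _ d] lam) auto
  have Gs: "G \<in> sym_space n d"
    unfolding G_def by (intro lvs.subspace_diff[OF sub] Plam mac_sym_space[OF lam d])
  have Gspan: "G \<in> lvs.span (mac n ` strictly_below lam)"
  proof -
    have "G = (\<Sum>mu\<in>strictly_below lam. const (v mu) * monomial_sym n mu) -
        (\<Sum>mu\<in>strictly_below lam. const (w mu) * monomial_sym n mu)"
      by (simp add: G_def v w)
    moreover have "monomial_sym n mu \<in> lvs.span (mac n ` strictly_below lam)" if mu: "mu \<in> strictly_below lam" for mu
    proof -
      note D = strictly_below_D[OF mu lam]
      have "nu \<in> strictly_below lam" if "nu \<in> partitions_of d" "dominance_le nu mu" for nu
        using that dominance_trans[OF that(2) D(2)] dominance_le_antisym[OF D(1) lam D(2)] D(3)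
          partitions_of_D(3)[OF lam] by (auto simp: strictly_below_def)
      then have "mac n ` {nu \<in> partitions_of d. dominance_le nu mu} \<subseteq> mac n ` strictly_below lam" by blast
      then show ?thesis using monomial_in_mac_span[OF D(1) d] lvs.span_mono by blast
    qed
    ultimately show ?thesis by (simp only:) (intro lvs.span_diff lvs.span_sum lvs.span_scale)
  qed
  have orth: "qt_scalar n d (mac n nu) G = 0" if nu: "nu \<in> partitions_of d" for nu
  proof (cases "nu \<in> strictly_below lam")
    case True
    note D = strictly_below_D[OF True lam]
    have "qt_scalar n d (P nu) (P lam) = 0"
      using P D lam unfolding is_macdonald_family_def by blast
    then have 1: "qt_scalar n d (mac n nu) (P lam) = 0" by (simp add: IH[OF True])
    have 2: "qt_scalar n d (mac n nu) (mac n lam) = 0" by (rule mac_orthogonal[OF D(1) lam d D(3)])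
    have "G = const (-1) * mac n lam + P lam" by (simp add: G_def const_minus)
    then show ?thesis using qt_scalar_linear[OF d mac_sym_space[OF lam d] Plam, of "mac n nu" "-1"] 1 2 by simp
  next
    case False
    show ?thesis
    proof (rule qt_scalar_span_zero[OF d _ _ Gspan])
      show "mac n ` strictly_below lam \<subseteq> sym_space n d"
        using mac_sym_space[OF strictly_below_D(1)[OF _ lam] d] by blast
      fix x assume "x \<in> mac n ` strictly_below lam"
      then obtain mu where mu: "mu \<in> strictly_below lam" "x = mac n mu" by blast
      then have "nu \<noteq> mu" using False by blast
      then show "qt_scalar n d (mac n nu) x = 0"
        unfolding mu(2) by (rule mac_orthogonal[OF nu strictly_below_D(1)[OF mu(1) lam] d])
    qed
  qed
  \<comment> \<open>Orthogonality to the whole family passes by linearity to the power sums, where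
    nondegeneracy is visible.\<close>
  have "G = 0"
  proof (rule qt_scalar_nondegenerate[OF d Gs])
    fix \<sigma> assume \<sigma>: "\<sigma> \<in> partitions_of d"
    have S: "mac n ` partitions_of d \<subseteq> sym_space n d" using mac_sym_space[OF _ d] by blast
    have "monomial_sym n mu \<in> lvs.span (mac n ` partitions_of d)" if "mu \<in> partitions_of d" for mu
      by (rule subsetD[OF lvs.span_mono monomial_in_mac_span[OF that d]]) auto
    then have "power_sum n \<sigma> \<in> lvs.span (mac n ` partitions_of d)"
      by (subst power_sum_expand[OF \<sigma> d]) (intro lvs.span_sum lvs.span_scale)
    then show "qt_scalar n d G (power_sum n \<sigma>) = 0"
      by (rule qt_scalar_span_zero[OF d S, rotated]) (use orth qt_scalar_commute in auto)
  qed
  then show ?case by (simp add: G_def)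
qed

lemma macdonald_P_eq:
  assumes "lam \<in> partitions_of (sum_list lam)" "sum_list lam \<le> n"
  shows "macdonald_P n lam = mac n lam"
  unfolding macdonald_P_def
  by (rule the_equality) (use assms mac_family macdonald_family_unique in blast)+

theorem theorem3p3:
  fixes n r :: nat and lam :: "nat list" and mus :: "nat list list"
  assumes "lam \<in> partitions_of (sum_list lam)"
    and "sum_list lam \<le> n"
    and "distinct mus"
    and "set mus = strictly_below lam"
    and "r = length mus"
  shows "macdonald_J n lam =
    const (c_coeff lam / u_coeff n lam) *
    det (mat (r + 1) (r + 1) (\<lambda>(i, j).
      if i = 0 then monomial_sym n ((lam # mus) ! j)
      else bracket n (conj_part lam) (conj_part ((lam # mus) ! i))
             (monomial_sym n ((lam # mus) ! j))))"
proof -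
  interpret below_list n "sum_list lam" r lam mus
    by unfold_locales (use assms in auto)
  \<comment> \<open>\<open>F\<close> belongs to the given listing, \<open>mac n lam\<close> to a
    chosen one. Exchanging one for the other again gives a Macdonald family, so uniqueness
    identifies them.\<close>
  have "is_macdonald_family n (sum_list lam) (\<lambda>mu. if mu = lam then F else mac n mu)"
    unfolding is_macdonald_family_def
  proof (intro conjI ballI impI)
    fix mu assume mu: "mu \<in> partitions_of (sum_list lam)"
    show "\<exists>v. (if mu = lam then F else mac n mu) =
        monomial_sym n mu + (\<Sum>nu\<in>strictly_below mu. const (v nu) * monomial_sym n nu)"
      using F_unitriangular mac_unitriangular[OF mu assms(2)] by auto
  next
    fix mu nu assume mu: "mu \<in> partitions_of (sum_list lam)" and nu: "nu \<in> partitions_of (sum_list lam)" and "mu \<noteq> nu"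
    have ev: "eigen n (sum_list lam) (if mu = lam then F else mac n mu) (tq_size n (part (conj_part mu)))"
      if "mu \<in> partitions_of (sum_list lam)" for mu
      using F_eigen mac_eigen[OF that assms(2)] by simp
    show "qt_scalar n (sum_list lam) (if mu = lam then F else mac n mu) (if nu = lam then F else mac n nu) = 0"
    proof (rule eigen_orthogonal[OF assms(2) ev[OF mu] ev[OF nu]])
      show "tq_size n (part (conj_part mu)) \<noteq> tq_size n (part (conj_part nu))"
        using tq_size_conj_inj[OF mu nu assms(2)] \<open>mu \<noteq> nu\<close> by blast
    qed
  qed
  from macdonald_family_unique[OF assms(2) this assms(1)] have "mac n lam = F" by simp
  then have "macdonald_J n lam = const (c_coeff lam) * F"
    by (simp add: macdonald_J_def macdonald_P_eq[OF assms(1,2)])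
  also have "\<dots> = const (c_coeff lam / u_coeff n lam) * full_det"
    by (simp add: F_def mult.assoc[symmetric] const_mult[symmetric])
  finally show ?thesis by (simp only: full_det_def)
qed

end
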